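(* The following are equivalent for a finitely generated multiplicative system $(X,\mu,S)$: (i) $S$ is aperiodic. (ii) $\mathcal{H}_1$ consists of constant functions and $\mathcal{H}_\chi=\{0\}$ for any non-principal Dirichlet character $\chi$. (iii) $S$ is pretentiously ergodic and $\sigma_{\mathrm{pr.rat}}(S)=\mathcal{A}_1$.
   Context: $\mathbb{N}=\{1,2,\dots\}$, $\mathbb{P}$ is the set of primes, $\mathbb{S}^1$ the complex unit circle. Every probability space $(X,\mu)$ is assumed regular: $X$ is a compact metric space with its Borel $\sigma$-algebra. A multiplicative system $(X,\mu,S)$ consists of a probability space $(X,\mu)$ and a sequence $S=(S_n)_{n\in\mathbb{N}}$ of commuting invertible measure-preserving transformations of $(X,\mu)$ with $S_{nm}=S_n\circ S_m$ for all $n,m\in\mathbb{N}$. It is finitely generated if $\{S_p:p\in\mathbb{P}\}$ is finite. For $F\in L^2(X)$, $S_nF=F\circ S_n$. "Constant" means $\mu$-almost everywhere constant. $S$ is aperiodic if for any $F\in L^2(X)$ and any $r,q\in\mathbb{N}$, $\lim_{N\to\infty}\frac1N\sum_{n=1}^N S_{qn+r}F=\int_X F\,d\mu$ in $L^2(X)$. For $f$ a completely multiplicative function with $|f|=1$ or a Dirichlet character, put $\mathbb{D}_F(S,f)=\big(\frac12\sum_{p\in\mathbb{P}}\frac{\|S_pF-f(p)F\|_2^2}{p}\big)^{1/2}\in[0,\infty]$, $\mathcal{H}_f=\{F\in L^2(X):\mathbb{D}_F(S,f)<\infty\}$ and $\mathbb{D}(S,f)=\inf_{\|F\|_2=1}\mathbb{D}_F(S,f)$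 (the finitely many primes where a Dirichlet character vanishes do not affect finiteness). $S$ is pretentiously ergodic if every measurable $A\subseteq X$ with $\mathbf{1}_A\in\mathcal{H}_1$ has $\mu(A)\in\{0,1\}$. $\mathcal{M}^{\mathrm c}$ is the set of completely multiplicative $f:\mathbb{N}\to\mathbb{S}^1$. For multiplicative $f,g$ bounded by $1$ in modulus, $\mathbb{D}(f,g)=\big(\sum_{p\in\mathbb{P}}\frac{1-\mathrm{Re}(f(p)\overline{g(p)})}{p}\big)^{1/2}\in[0,\infty]$, and $\mathcal{A}_f=\{g\in\mathcal{M}^{\mathrm c}:\mathbb{D}(f,g)<\infty\}$. The pretentious rational spectrum is $\sigma_{\mathrm{pr.rat}}(S)=\bigcup_{\chi:\,\mathbb{D}(S,\chi)<\infty}\mathcal{A}_\chi$, the union over Dirichlet characters $\chi$. *)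

theory Defs
  imports "HOL-Probability.Probability" "HOL-Computational_Algebra.Primes"
begin

text \<open>
  The positive integers are the type \<^typ>\<open>nat\<close> with all conditions restricted to positive arguments.
  A probability space is a measure on the Borel sets of a type that is a compact metric space.
\<close>

definition sqrt_ennreal :: "ennreal \<Rightarrow> ennreal" where
  "sqrt_ennreal x = (if x = \<infinity> then \<infinity> else ennreal (sqrt (enn2real x)))"

text \<open>The convention \<open>f 0 = 0\<close> makes these correspond exactly to functions on the positive integers.\<close>

definition completely_multiplicative_unimodular :: "(nat \<Rightarrow> complex) set" where
  "completely_multiplicative_unimodular =
     {f. f 0 = 0 \<and> (\<forall>m>0. \<forall>n>0. f (m * n) = f m * f n) \<and> (\<forall>n>0. cmod (f n) = 1)}"

definition dirichlet_character :: "nat \<Rightarrow> (nat \<Rightarrow> complex) \<Rightarrow> bool" where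
  "dirichlet_character k chi \<longleftrightarrow>
     k > 0 \<and>
     (\<forall>n. chi (n + k) = chi n) \<and>
     (\<forall>m n. chi (m * n) = chi m * chi n) \<and>
     (\<forall>n. chi n \<noteq> 0 \<longleftrightarrow> coprime n k)"

definition principal_character :: "nat \<Rightarrow> nat \<Rightarrow> complex" where
  "principal_character k n = (if coprime n k then 1 else 0)"

definition pretentious_dist :: "(nat \<Rightarrow> complex) \<Rightarrow> (nat \<Rightarrow> complex) \<Rightarrow> ennreal" where
  "pretentious_dist f g =
     sqrt_ennreal (\<Sum>\<^sub>\<infinity>p\<in>{p. prime p}. ennreal ((1 - Re (f p * cnj (g p))) / real p))"

text \<open>
  Only the values of \<open>f\<close> at primes matter here, so \<open>f\<close> may be the constant \<open>1\<close> or a Dirichlet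
  character, whatever its value at \<open>0\<close>.
\<close>

definition pretentious_class :: "(nat \<Rightarrow> complex) \<Rightarrow> (nat \<Rightarrow> complex) set" where
  "pretentious_class f = {g \<in> completely_multiplicative_unimodular. pretentious_dist f g < \<infinity>}"

text \<open>
  Elements of \<open>L2 M\<close> are representatives, not classes modulo null sets: equality in the Hilbert
  space is equality almost everywhere.
\<close>

definition L2 :: "'a measure \<Rightarrow> ('a \<Rightarrow> complex) set" where
  "L2 M = {F \<in> borel_measurable M. integrable M (\<lambda>x. (cmod (F x))\<^sup>2)}"

definition L2_norm :: "'a measure \<Rightarrow> ('a \<Rightarrow> complex) \<Rightarrow> real" where
  "L2_norm M F = sqrt (\<integral>x. (cmod (F x))\<^sup>2 \<partial>M)"

definition ae_constant :: "'a measure \<Rightarrow> ('a \<Rightarrow> complex) \<Rightarrow> bool" where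
  "ae_constant M F \<longleftrightarrow> (\<exists>c. AE x in M. F x = c)"

definition invertible_measure_preserving :: "'a measure \<Rightarrow> ('a \<Rightarrow> 'a) \<Rightarrow> bool" where
  "invertible_measure_preserving M T \<longleftrightarrow>
     T \<in> measurable M M \<and> bij_betw T (space M) (space M) \<and>
     the_inv_into (space M) T \<in> measurable M M \<and> distr M M T = M"

locale multiplicative_system = prob_space M
  for M :: "'a::metric_space measure" and S :: "nat \<Rightarrow> 'a \<Rightarrow> 'a" +
  assumes compact_UNIV: "compact (UNIV :: 'a set)"
    and sets_eq_borel: "sets M = sets borel"
    and invertible_mp: "n > 0 \<Longrightarrow> invertible_measure_preserving M (S n)"
    and commuting: "m > 0 \<Longrightarrow> n > 0 \<Longrightarrow> S m \<circ> S n = S n \<circ> S m"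
    and multiplicative: "m > 0 \<Longrightarrow> n > 0 \<Longrightarrow> S (n * m) = S n \<circ> S m"

definition finitely_generated :: "(nat \<Rightarrow> 'a \<Rightarrow> 'a) \<Rightarrow> bool" where
  "finitely_generated S \<longleftrightarrow> finite (S ` {p. prime p})"

definition aperiodic :: "'a measure \<Rightarrow> (nat \<Rightarrow> 'a \<Rightarrow> 'a) \<Rightarrow> bool" where
  "aperiodic M S \<longleftrightarrow>
     (\<forall>F\<in>L2 M. \<forall>r>0. \<forall>q>0.
        (\<lambda>N. L2_norm M (\<lambda>x. (\<Sum>n=1..N. F (S (q * n + r) x)) / of_nat N - (\<integral>y. F y \<partial>M)))
          \<longlonglongrightarrow> 0)"

definition dist_along :: "'a measure \<Rightarrow> (nat \<Rightarrow> 'a \<Rightarrow> 'a) \<Rightarrow> ('a \<Rightarrow> complex) \<Rightarrow> (nat \<Rightarrow> complex) \<Rightarrow> ennreal" where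
  "dist_along M S F f =
     sqrt_ennreal ((1 / 2) *
       (\<Sum>\<^sub>\<infinity>p\<in>{p. prime p}. ennreal ((L2_norm M (\<lambda>x. F (S p x) - f p * F x))\<^sup>2 / real p)))"

definition pretentious_space :: "'a measure \<Rightarrow> (nat \<Rightarrow> 'a \<Rightarrow> 'a) \<Rightarrow> (nat \<Rightarrow> complex) \<Rightarrow> ('a \<Rightarrow> complex) set" where
  "pretentious_space M S f = {F \<in> L2 M. dist_along M S F f < \<infinity>}"

definition system_dist :: "'a measure \<Rightarrow> (nat \<Rightarrow> 'a \<Rightarrow> 'a) \<Rightarrow> (nat \<Rightarrow> complex) \<Rightarrow> ennreal" where
  "system_dist M S f = (INF F\<in>{F \<in> L2 M. L2_norm M F = 1}. dist_along M S F f)"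

definition pretentiously_ergodic :: "'a measure \<Rightarrow> (nat \<Rightarrow> 'a \<Rightarrow> 'a) \<Rightarrow> bool" where
  "pretentiously_ergodic M S \<longleftrightarrow>
     (\<forall>A\<in>sets M. (indicator A :: 'a \<Rightarrow> complex) \<in> pretentious_space M S (\<lambda>_. 1)
        \<longrightarrow> measure M A \<in> {0, 1})"

definition pretentious_rational_spectrum :: "'a measure \<Rightarrow> (nat \<Rightarrow> 'a \<Rightarrow> 'a) \<Rightarrow> (nat \<Rightarrow> complex) set" where
  "pretentious_rational_spectrum M S =
     (\<Union>chi\<in>{chi. (\<exists>k. dirichlet_character k chi) \<and> system_dist M S chi < \<infinity>}. pretentious_class chi)"

end

theory Submission
  imports Defs "HOL-Number_Theory.Number_Theory" "HOL-Computational_Algebra.Squarefree"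
begin

text \<open>
  Since only finitely many pairs \<open>(S p, chi p)\<close> occur, \<open>F\<close> lies in \<open>\<H>\<^sub>\<chi>\<close> iff \<open>F \<circ> S p = chi p * F\<close> for
  all primes \<open>p\<close> outside a set with convergent reciprocal sum. If \<open>S\<close> is aperiodic, averaging such an
  \<open>F\<close> along a progression \<open>q * n + 1\<close> whose members mostly avoid the exceptional primes shows that \<open>F\<close> is
  constant; the same sieve shows that a non-principal character differs from 1 on primes with
  divergent reciprocal sum, which separates constants from \<open>\<H>\<^sub>\<chi>\<close> and distinguishes the classes of
  characters in the spectrum.

  For the converse, write \<open>V n F = chi n * F \<circ> S n\<close>. Projecting onto the closed space of functions whose
  averages of \<open>V n F\<close> vanish, it suffices to show that this space contains every coboundary
  \<open>V p G - G\<close> for which the primes \<open>q\<close> with \<open>V q = V p\<close> have divergent reciprocal sum. Let \<open>A x\<close> be the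
  average up to \<open>x\<close>. As \<open>ln\<^sup>2 = 1 * \<Lambda>\<^sub>2\<close>, \<open>A x\<close> is a mean of the vectors \<open>V d (A (x / d))\<close> with weights
  \<open>\<Lambda>\<^sub>2 d / d\<close>, so at scales where \<open>A x\<close> has almost maximal norm, convexity forces most of them to be
  close to \<open>A x\<close>. By Selberg's formula the almost primes \<open>d\<close>, on which \<open>V d\<close> takes finitely many values,
  are dense enough on a logarithmic scale to conclude that \<open>A\<close> is nearly constant on long windows.
  There the Turan-Kubilius inequality gives \<open>V p (A x) \<approx> A x\<close>, which for a coboundary is only possible
  if \<open>A x\<close> is small.
\<close>

subsection \<open>Sums over integers and Chebyshev's bound\<close>

text \<open>The argument needs, for arbitrarily small \<open>\<delta>\<close>, usable divisors
  \<open>d\<close> of positive logarithmic mass in every interval from \<open>y\<close> to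
  \<open>y * exp \<delta>\<close>. Nothing is lost, because \<open>S (p * q)\<close> is a
  composition of two generators and so still has finitely many values. The averages need not
  converge, so everything is compared at scales where their norm is close to its limsup. Windows can
  be made arbitrarily long because the oscillation inside one is bounded by the number of operator
  values, not by its length.

  A residual of the projection is fixed by \<open>V p\<close>, that is, an eigenfunction with
  eigenvalue \<open>cnj (chi p)\<close>; the spectral hypothesis is therefore applied to the
  conjugate character. Progressions come in last: a class coprime to its modulus is expanded in
  characters, and a common factor \<open>d\<close> of \<open>q\<close> and \<open>r\<close> is
  absorbed by passing to \<open>F\<close> composed with \<open>S d\<close>.\<close>

definition nat_upto :: "real \<Rightarrow> nat set" where
  "nat_upto x = {n. 0 < n \<and> real n \<le> x}"

lemma nat_upto_altdef: "nat_upto x = {1..nat \<lfloor>x\<rfloor>}"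
proof -
  have "real n \<le> x \<longleftrightarrow> n \<le> nat \<lfloor>x\<rfloor>" if "n > 0" for n using that by linarith
  thus ?thesis by (auto simp: nat_upto_def)
qed

lemma finite_nat_upto [simp, intro]: "finite (nat_upto x)"
  by (simp add: nat_upto_altdef)

lemma card_nat_upto: "x \<ge> 0 \<Longrightarrow> real (card (nat_upto x)) = of_int \<lfloor>x\<rfloor>"
  by (simp add: nat_upto_altdef)

lemma card_nat_upto_bounds:
  assumes "x \<ge> 0"
  shows "real (card (nat_upto x)) \<le> x" "real (card (nat_upto x)) > x - 1"
  using card_nat_upto[OF assms] by linarith+

lemma nat_upto_of_nat: "nat_upto (real n) = {1..n}"
  by (auto simp: nat_upto_def)

lemma nat_upto_empty: "x < 1 \<Longrightarrow> nat_upto x = {}"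
  by (auto simp: nat_upto_def)

lemma nat_upto_mono: "x \<le> y \<Longrightarrow> nat_upto x \<subseteq> nat_upto y"
  by (auto simp: nat_upto_def)

text \<open>Writing \<open>n = d * m\<close> identifies pairs (number, divisor) with lattice points
  under the hyperbola \<open>d * m \<le> x\<close>. Every Dirichlet convolution below is opened this
  way.\<close>

lemma sum_divisors_nat_upto:
  fixes h :: "nat \<Rightarrow> nat \<Rightarrow> 'b::comm_monoid_add"
  shows "(\<Sum>n\<in>nat_upto x. \<Sum>d | d dvd n. h d (n div d)) =
         (\<Sum>d\<in>nat_upto x. \<Sum>m\<in>nat_upto (x / real d). h d m)"
proof -
  have "(\<Sum>n\<in>nat_upto x. \<Sum>d | d dvd n. h d (n div d)) =
        (\<Sum>(n,d)\<in>(SIGMA n:nat_upto x. {d. d dvd n}). h d (n div d))"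
    by (rule sum.Sigma) (simp, auto simp: nat_upto_def)
  also have "\<dots> = (\<Sum>(d,m)\<in>(SIGMA d:nat_upto x. nat_upto (x / real d)). h d m)"
  proof (rule sum.reindex_bij_witness[where i = "\<lambda>(d,m). (d*m,d)" and j = "\<lambda>(n,d). (d, n div d)"], goal_cases)
    case (2 a)
    then obtain n d m where a: "a = (n,d)" "n = d * m" "n > 0" "real n \<le> x"
      by (auto simp: nat_upto_def elim!: dvdE)
    have "real d \<le> x"
      using a(2-4) of_nat_mono[of d n, where ?'a=real] by (intro order.trans[OF _ a(4)]) auto
    with a show ?case by (auto simp: nat_upto_def field_simps)
  qed (auto simp: nat_upto_def field_simps)
  also have "\<dots> = (\<Sum>d\<in>nat_upto x. \<Sum>m\<in>nat_upto (x / real d). h d m)"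
    by (rule sum.Sigma[symmetric]) auto
  finally show ?thesis .
qed

lemma sum_nat_upto_swap:
  fixes h :: "nat \<Rightarrow> nat \<Rightarrow> 'b::comm_monoid_add"
  shows "(\<Sum>d\<in>nat_upto x. \<Sum>m\<in>nat_upto (x / real d). h d m) =
         (\<Sum>m\<in>nat_upto x. \<Sum>d\<in>nat_upto (x / real m). h d m)"
proof -
  have "(\<Sum>d\<in>nat_upto x. \<Sum>m\<in>nat_upto (x / real d). h d m) = 
        (\<Sum>(d,m)\<in>(SIGMA d:nat_upto x. nat_upto (x / real d)). h d m)"
    by (rule sum.Sigma) auto
  also have "\<dots> = (\<Sum>(m,d)\<in>(SIGMA m:nat_upto x. nat_upto (x / real m)). h d m)"
  proof (rule sum.reindex_bij_witness[where i = prod.swap and j = prod.swap], goal_cases)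
    case (2 a)
    then obtain d m where a: "a = (d,m)" "d > 0" "m > 0" "real d * real m \<le> x"
      by (auto simp: nat_upto_def field_simps)
    have "real m \<le> x" using a mult_right_mono[of 1 "real d" "real m"] by linarith
    with a show ?case by (auto simp: nat_upto_def field_simps)
  next
    case (4 a)
    then obtain d m where a: "a = (m,d)" "d > 0" "m > 0" "real d * real m \<le> x"
      by (auto simp: nat_upto_def field_simps)
    have "real d \<le> x" using a mult_left_mono[of 1 "real m" "real d"] by linarith
    with a show ?case by (auto simp: nat_upto_def field_simps)
  qed auto
  also have "\<dots> = (\<Sum>m\<in>nat_upto x. \<Sum>d\<in>nat_upto (x / real m). h d m)"
    by (rule sum.Sigma[symmetric]) auto
  finally show ?thesis .
qed

section \<open>Von Mangoldt sums: bounds of Stirling, Chebyshev and Mertens\<close>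

abbreviation Lam :: "nat \<Rightarrow> real" ("\<Lambda>") where "\<Lambda> \<equiv> mangoldt"

definition psi :: "real \<Rightarrow> real" ("\<psi>") where "\<psi> x = (\<Sum>n\<in>nat_upto x. \<Lambda> n)"

definition ln_sum :: "real \<Rightarrow> real" where "ln_sum x = (\<Sum>n\<in>nat_upto x. ln (real n))"

lemma psi_nonneg [simp]: "\<psi> x \<ge> 0"
  unfolding psi_def by (intro sum_nonneg mangoldt_nonneg)

lemma ln_sum_nat_bounds:
  assumes "n \<ge> 1"
  shows "(\<Sum>k=1..n. ln (real k)) \<ge> real n * ln (real n) - real n + 1 \<and>
         (\<Sum>k=1..n. ln (real k)) \<le> real n * ln (real n) - real n + 1 + ln (real n)"
  using assms
proof (induction n rule: dec_induct)
  case (step n)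
  have n: "real n > 0" using step by simp
  have "ln (1 + 1 / real n) \<le> 1 / real n"
    by (rule ln_add_one_self_le_self) auto
  moreover have e: "ln (1 + 1 / real n) = ln (real n + 1) - ln (real n)"
    using n ln_div[of "real n + 1" "real n"] by (simp add: add_divide_distrib)
  ultimately have "ln (real n + 1) - ln (real n) \<le> 1 / real n" by simp
  hence 1: "real n * (ln (real n + 1) - ln (real n)) \<le> 1"
    using n by (simp add: pos_le_divide_eq mult.commute)
  have "ln (real n / (real n + 1)) \<le> real n / (real n + 1) - 1"
    using n by (intro ln_le_minus_one) auto
  also have "ln (real n / (real n + 1)) = ln (real n) - ln (real n + 1)"
    using n by (simp add: ln_div)
  finally have 2: "(real n + 1) * (ln (real n + 1) - ln (real n)) \<ge> 1"
    using n by (simp add: field_simps)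
  show ?case using step.IH 1 2 by (simp add: algebra_simps)
qed simp

text \<open>Stirling at \<open>nat \<lfloor>x\<rfloor>\<close>, then moved to \<open>x\<close>: the
  main term has derivative \<open>ln\<close>, so a shift of less than 1 costs at most another
  \<open>ln x\<close>.\<close>

lemma ln_sum_bounds:
  assumes "x \<ge> 1"
  shows "\<bar>ln_sum x - (x * ln x - x)\<bar> \<le> 1 + 2 * ln x"
proof -
  define n where "n = nat \<lfloor>x\<rfloor>"
  have n: "n \<ge> 1" "real n \<le> x" "x < real n + 1" using assms unfolding n_def by linarith+
  have N: "ln_sum x = (\<Sum>k=1..n. ln (real k))"
    by (simp add: ln_sum_def nat_upto_altdef n_def)
  have n0: "real n > 0" "x > 0" using n by auto
  have "ln (x / real n) \<le> x / real n - 1" using n0 by (intro ln_le_minus_one) auto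
  hence 1: "real n * (ln x - ln (real n)) \<le> x - real n"
    using n0 by (simp add: ln_div field_simps)
  have "ln (real n / x) \<le> real n / x - 1" using n0 by (intro ln_le_minus_one) auto
  hence 2: "x * (ln x - ln (real n)) \<ge> x - real n"
    using n0 by (simp add: ln_div field_simps)
  have l: "ln (real n) \<ge> 0" "ln (real n) \<le> ln x" "ln x \<ge> 0" using n by auto
  have 3: "(x - real n) * ln x \<le> 1 * ln x" using n l by (intro mult_right_mono) auto
  have 4: "(x - real n) * ln (real n) \<ge> 0" using n l by auto
  show ?thesis using ln_sum_nat_bounds[OF n(1)] 1 2 3 4 l unfolding N
    by (auto simp: abs_if algebra_simps)
qed

lemma ln_sum_eq_sum_mangoldt:
  assumes "x \<ge> 0"
  shows "ln_sum x = (\<Sum>d\<in>nat_upto x. \<Lambda> d * of_int \<lfloor>x / real d\<rfloor>)"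
proof -
  have "ln_sum x = (\<Sum>n\<in>nat_upto x. \<Sum>d | d dvd n. \<Lambda> d)"
    unfolding ln_sum_def by (intro sum.cong) (auto simp: mangoldt_sum nat_upto_def)
  also have "\<dots> = (\<Sum>d\<in>nat_upto x. \<Sum>m\<in>nat_upto (x / real d). \<Lambda> d)"
    by (rule sum_divisors_nat_upto)
  also have "\<dots> = (\<Sum>d\<in>nat_upto x. \<Lambda> d * of_int \<lfloor>x / real d\<rfloor>)"
    using assms by (intro sum.cong) (auto simp: card_nat_upto)
  finally show ?thesis .
qed

lemma ln_sum_eq_sum_psi: "ln_sum x = (\<Sum>n\<in>nat_upto x. \<psi> (x / real n))"
proof -
  have "ln_sum x = (\<Sum>n\<in>nat_upto x. \<Sum>d | d dvd n. \<Lambda> d)"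
    unfolding ln_sum_def by (intro sum.cong) (auto simp: mangoldt_sum nat_upto_def)
  also have "\<dots> = (\<Sum>d\<in>nat_upto x. \<Sum>m\<in>nat_upto (x / real d). \<Lambda> d)"
    by (rule sum_divisors_nat_upto)
  also have "\<dots> = (\<Sum>m\<in>nat_upto x. \<Sum>d\<in>nat_upto (x / real m). \<Lambda> d)"
    by (rule sum_nat_upto_swap)
  finally show ?thesis by (simp add: psi_def)
qed

text \<open>Chebyshev's device: in \<open>ln_sum x - 2 * ln_sum (x/2)\<close> the coefficient of
  \<open>\<Lambda> d\<close> is \<open>\<lfloor>y\<rfloor> - 2 * \<lfloor>y/2\<rfloor>\<close> with
  \<open>y = x / d\<close>. It is never negative and equals 1 for \<open>1 \<le> y < 2\<close>,
  while Stirling makes the whole difference linear in \<open>x\<close>.\<close>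

lemma psi_diff_half:
  assumes "x \<ge> 2"
  shows "\<psi> x - \<psi> (x / 2) \<le> 10 * x"
proof -
  have fl: "of_int \<lfloor>y\<rfloor> - 2 * of_int \<lfloor>y / 2\<rfloor> \<ge> (0::real)" for y :: real
  proof -
    have "2 * of_int \<lfloor>y / 2\<rfloor> \<le> y" by linarith
    hence "of_int (2 * \<lfloor>y / 2\<rfloor>) \<le> y" by simp
    hence "2 * \<lfloor>y / 2\<rfloor> \<le> \<lfloor>y\<rfloor>" by linarith
    thus ?thesis by linarith
  qed
  have sub: "nat_upto (x/2) \<subseteq> nat_upto x" using assms by (intro nat_upto_mono) auto
  have "ln_sum (x/2) = (\<Sum>d\<in>nat_upto (x/2). \<Lambda> d * of_int \<lfloor>x / 2 / real d\<rfloor>)"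
    using assms by (intro ln_sum_eq_sum_mangoldt) auto
  also have "\<dots> = (\<Sum>d\<in>nat_upto x. \<Lambda> d * of_int \<lfloor>x / real d / 2\<rfloor>)"
  proof (rule sum.mono_neutral_cong_left)
    show "\<forall>i\<in>nat_upto x - nat_upto (x / 2). \<Lambda> i * real_of_int \<lfloor>x / real i / 2\<rfloor> = 0"
    proof
      fix d assume d: "d \<in> nat_upto x - nat_upto (x / 2)"
      hence "x / real d / 2 < 1" "x / real d / 2 \<ge> 0" using assms by (auto simp: nat_upto_def field_simps)
      thus "\<Lambda> d * real_of_int \<lfloor>x / real d / 2\<rfloor> = 0" by (simp add: floor_eq_iff)
    qed
  qed (use sub in \<open>auto simp: mult.commute\<close>)
  finally have "ln_sum x - 2 * ln_sum (x/2) = 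
      (\<Sum>d\<in>nat_upto x. \<Lambda> d * (of_int \<lfloor>x / real d\<rfloor> - 2 * of_int \<lfloor>x / real d / 2\<rfloor>))"
    using assms by (simp add: ln_sum_eq_sum_mangoldt sum_distrib_left sum_subtractf algebra_simps)
  also have "\<dots> \<ge> (\<Sum>d\<in>nat_upto x - nat_upto (x/2). \<Lambda> d * (of_int \<lfloor>x / real d\<rfloor> - 2 * of_int \<lfloor>x / real d / 2\<rfloor>))"
  proof (rule sum_mono2)
    show "\<Lambda> d * (of_int \<lfloor>x / real d\<rfloor> - 2 * of_int \<lfloor>x / real d / 2\<rfloor>) \<ge> 0" for d
      by (rule mult_nonneg_nonneg[OF mangoldt_nonneg fl])
  qed auto
  also have "(\<Sum>d\<in>nat_upto x - nat_upto (x/2). \<Lambda> d * (of_int \<lfloor>x / real d\<rfloor> - 2 * of_int \<lfloor>x / real d / 2\<rfloor>)) =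
             (\<Sum>d\<in>nat_upto x - nat_upto (x/2). \<Lambda> d)"
  proof (rule sum.cong)
    fix d assume d: "d \<in> nat_upto x - nat_upto (x/2)"
    hence a: "x / real d < 2" "x / real d \<ge> 1" using assms by (auto simp: nat_upto_def field_simps)
    hence "\<lfloor>x / real d\<rfloor> = 1" "\<lfloor>x / real d / 2\<rfloor> = 0" by (auto simp: floor_eq_iff)
    thus "\<Lambda> d * (of_int \<lfloor>x / real d\<rfloor> - 2 * of_int \<lfloor>x / real d / 2\<rfloor>) = \<Lambda> d" by simp
  qed auto
  also have "(\<Sum>d\<in>nat_upto x - nat_upto (x/2). \<Lambda> d) = \<psi> x - \<psi> (x/2)"
    unfolding psi_def using sub by (subst sum_diff) auto
  finally have A: "\<psi> x - \<psi> (x/2) \<le> ln_sum x - 2 * ln_sum (x/2)" .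
  have l: "ln (x/2) = ln x - ln 2" using assms by (simp add: ln_div)
  have b1: "ln_sum x \<le> x * ln x - x + 1 + 2 * ln x" using ln_sum_bounds[of x] assms by linarith
  have b2: "ln_sum (x/2) \<ge> x/2 * ln (x/2) - x/2 - 1 - 2 * ln (x/2)" using ln_sum_bounds[of "x/2"] assms by linarith
  have l2: "ln 2 \<le> (1::real)" "ln 2 \<ge> (0::real)" using ln_le_minus_one[of 2] by auto
  have lx: "ln x \<le> x - 1" using assms by (intro ln_le_minus_one) auto
  have "x * ln 2 \<le> x * 1" using l2 assms by (intro mult_left_mono) auto
  moreover have "x / 2 * ln (x / 2) = x * ln x / 2 - x * ln 2 / 2" by (simp add: l algebra_simps)
  ultimately show ?thesis using A b1 b2 l l2 lx assms by linarith
qed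

text \<open>Repeated halving sums the bounds \<open>10 * x\<close>, \<open>10 * x / 2\<close>, ...
  to \<open>20 * x\<close>.\<close>

lemma psi_le:
  assumes "x \<ge> 0"
  shows "\<psi> x \<le> 20 * x"
proof -
  have "\<psi> x \<le> 20 * x" if "x \<ge> 0" "x < 2 ^ k" for k :: nat and x
    using that
  proof (induction k arbitrary: x)
    case 0
    thus ?case by (simp add: psi_def nat_upto_empty)
  next
    case (Suc k)
    show ?case
    proof (cases "x \<ge> 2")
      case True
      have "\<psi> (x/2) \<le> 20 * (x/2)" using Suc by (intro Suc.IH) auto
      with psi_diff_half[OF True] show ?thesis by simp
    next
      case False
      hence "nat_upto x \<subseteq> {1}" by (auto simp: nat_upto_def)
      hence "\<psi> x \<le> (\<Sum>n\<in>{1}. \<Lambda> n)" unfolding psi_def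
        by (intro sum_mono2) (auto simp: mangoldt_nonneg)
      thus ?thesis using Suc.prems by simp
    qed
  qed
  moreover obtain k :: nat where "x < 2 ^ k" using real_arch_pow[of 2 x] by auto
  ultimately show ?thesis using assms by blast
qed

text \<open>Removing the floors in \<open>ln_sum_eq_sum_mangoldt\<close> costs at most
  \<open>\<psi> x \<le> 20 * x\<close>; the rest of the constant absorbs the error in Stirling's
  formula.\<close>

lemma sum_mangoldt_over_bounds:
  assumes "x \<ge> 1"
  shows "\<bar>(\<Sum>d\<in>nat_upto x. \<Lambda> d / real d) - ln x\<bar> \<le> 24"
proof -
  define E where "E = (\<Sum>d\<in>nat_upto x. \<Lambda> d / real d)"
  have "x * E - ln_sum x = (\<Sum>d\<in>nat_upto x. \<Lambda> d * (x / real d - of_int \<lfloor>x / real d\<rfloor>))"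
    using assms by (simp add: E_def ln_sum_eq_sum_mangoldt sum_distrib_left sum_subtractf algebra_simps)
  moreover have "\<dots> \<ge> 0" by (intro sum_nonneg mult_nonneg_nonneg mangoldt_nonneg) auto
  moreover have "(\<Sum>d\<in>nat_upto x. \<Lambda> d * (x / real d - of_int \<lfloor>x / real d\<rfloor>)) \<le> (\<Sum>d\<in>nat_upto x. \<Lambda> d * 1)"
    by (intro sum_mono mult_left_mono mangoldt_nonneg) linarith
  moreover have "(\<Sum>d\<in>nat_upto x. \<Lambda> d * 1) \<le> 20 * x" using psi_le[of x] assms by (simp add: psi_def)
  ultimately have 1: "x * E - ln_sum x \<ge> 0" "x * E - ln_sum x \<le> 20 * x" by linarith+
  have lx: "ln x \<le> x - 1" using assms by (intro ln_le_minus_one) auto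
  have "\<bar>x * E - x * ln x\<bar> \<le> 24 * x" using 1 ln_sum_bounds[OF assms] lx assms by (auto simp: abs_if algebra_simps split: if_splits)
  hence "x * \<bar>E - ln x\<bar> \<le> x * 24" using assms by (simp add: abs_mult flip: right_diff_distrib)
  thus ?thesis unfolding E_def using assms by simp
qed

subsection \<open>Selberg's formula\<close>

text \<open>For a prime \<open>p\<close> dividing \<open>n\<close>, the squarefree divisors of
  \<open>n\<close> pair off as \<open>d\<close> and \<open>p * d\<close> with opposite signs. Only
  the bound and the divisor sum are exported, as nothing else about the Moebius function is
  used.\<close>

lemma moebius_exists:
  obtains mu :: "nat \<Rightarrow> real"
  where "\<And>n. \<bar>mu n\<bar> \<le> 1" "\<And>n. n > 0 \<Longrightarrow> (\<Sum>d | d dvd n. mu d) = (if n = 1 then 1 else 0)"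
proof -
  define mu :: "nat \<Rightarrow> real" where "mu = (\<lambda>n. if squarefree n then (-1) ^ card (prime_factors n) else 0)"
  have "(\<Sum>d | d dvd n. mu d) = 0" if n: "n > 1" for n
  proof -
    obtain p where p: "prime p" "p dvd n" using n prime_factor_nat[of n] by auto
    define D0 where "D0 = {d. d dvd n \<and> squarefree d \<and> \<not> p dvd d}"
    have fin: "finite {d. d dvd n}" using n by simp
    have fin0: "finite D0" unfolding D0_def by (rule finite_subset[OF _ fin]) auto
    have cop: "coprime p d" if "d \<in> D0" for d using that p by (auto simp: D0_def prime_imp_coprime)
    have split: "{d. d dvd n \<and> squarefree d} = D0 \<union> (\<lambda>d. p * d) ` D0"
    proof (intro equalityI subsetI)
      fix d assume d: "d \<in> {d. d dvd n \<and> squarefree d}"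
      show "d \<in> D0 \<union> (\<lambda>d. p * d) ` D0"
      proof (cases "p dvd d")
        case True
        then obtain e where e: "d = p * e" by blast
        have "squarefree e" using d e by (intro squarefree_mono[of e d]) auto
        moreover have "\<not> p dvd e"
        proof
          assume "p dvd e"
          hence "p ^ 2 dvd d" by (auto simp: e power2_eq_square)
          hence "p dvd 1" using d by (intro squarefreeD) auto
          with p show False by auto
        qed
        moreover have "e dvd n" using d e by (auto dest: dvd_mult_right)
        ultimately show ?thesis by (auto simp: D0_def e)
      qed (use d in \<open>auto simp: D0_def\<close>)
    next
      fix d assume d: "d \<in> D0 \<union> (\<lambda>d. p * d) ` D0"
      thus "d \<in> {d. d dvd n \<and> squarefree d}"
      proof
        assume "d \<in> (\<lambda>d. p * d) ` D0"
        then obtain e where e: "d = p * e" "e \<in> D0" by auto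
        have "p * e dvd n" using e p cop[of e] by (intro divides_mult) (auto simp: D0_def)
        moreover have "squarefree (p * e)" using e p cop[of e]
          by (subst squarefree_mult_coprime) (auto simp: D0_def squarefree_prime)
        ultimately show ?thesis by (simp add: e)
      qed (auto simp: D0_def)
    qed
    have mup: "mu (p * d) = - mu d" if "d \<in> D0" for d
    proof -
      have d0: "d \<noteq> 0" "squarefree d" "\<not> p dvd d" using that by (auto simp: D0_def intro!: Nat.gr0I)
      have "squarefree (p * d)" using d0 p cop[OF that]
        by (subst squarefree_mult_coprime) (auto simp: squarefree_prime)
      moreover have "prime_factors (p * d) = insert p (prime_factors d)"
        using d0 p by (subst prime_factors_product) (auto simp: prime_prime_factors)
      moreover have "p \<notin> prime_factors d" using d0 by auto
      ultimately show ?thesis using d0 by (simp add: mu_def)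
    qed
    have "(\<Sum>d | d dvd n. mu d) = (\<Sum>d | d dvd n \<and> squarefree d. mu d)"
      using fin by (intro sum.mono_neutral_right) (auto simp: mu_def)
    also have "\<dots> = (\<Sum>d\<in>D0. mu d) + (\<Sum>d\<in>(\<lambda>d. p * d) ` D0. mu d)"
      unfolding split using fin0 by (intro sum.union_disjoint) (auto simp: D0_def)
    also have "(\<Sum>d\<in>(\<lambda>d. p * d) ` D0. mu d) = (\<Sum>d\<in>D0. mu (p * d))"
      using p by (subst sum.reindex) (auto simp: inj_on_def prime_gt_0_nat)
    also have "\<dots> = - (\<Sum>d\<in>D0. mu d)" by (simp add: mup sum_negf)
    finally show ?thesis by simp
  qed
  moreover have "\<bar>mu n\<bar> \<le> 1" for n by (simp add: mu_def power_abs)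
  moreover have "(\<Sum>d | d dvd n. mu d) = 1" if "n = 1" for n using that by (simp add: mu_def)
  ultimately show ?thesis by (intro that[of mu]) auto
qed

lemma sum_divisors_swap:
  fixes h :: "nat \<Rightarrow> nat \<Rightarrow> 'b::comm_monoid_add"
  assumes "n > 0"
  shows "(\<Sum>d | d dvd n. \<Sum>e | e dvd n div d. h d e) = (\<Sum>e | e dvd n. \<Sum>d | d dvd n div e. h d e)"
proof -
  have f: "finite {d. d dvd m}" if "m dvd n" for m using assms that by (auto intro!: finite_divisors_nat Nat.gr0I)
  have "(\<Sum>d | d dvd n. \<Sum>e | e dvd n div d. h d e) = 
        (\<Sum>(d,e)\<in>(SIGMA d:{d. d dvd n}. {e. e dvd n div d}). h d e)"
    using assms by (intro sum.Sigma ballI f) (auto simp: div_dvd_iff_mult intro!: f)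
  also have "\<dots> = (\<Sum>(e,d)\<in>(SIGMA e:{e. e dvd n}. {d. d dvd n div e}). h d e)"
    using assms
    by (intro sum.reindex_bij_witness[where i = prod.swap and j = prod.swap])
       (auto elim!: dvdE)
  also have "\<dots> = (\<Sum>e | e dvd n. \<Sum>d | d dvd n div e. h d e)"
    using assms by (intro sum.Sigma[symmetric] ballI f) (auto simp: div_dvd_iff_mult intro!: f)
  finally show ?thesis .
qed

text \<open>Inverting \<open>mangoldt_sum\<close> gives \<open>\<Lambda> n\<close> as the sum of
  \<open>mu d * ln (n / d)\<close>. Splitting this logarithm leaves \<open>ln n\<close> times the
  divisor sum of \<open>mu\<close>, which vanishes: either the sum is 0 or
  \<open>ln 1 = 0\<close>.\<close>

lemma sum_moebius_ln:
  fixes mu :: "nat \<Rightarrow> real"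
  assumes mu: "\<And>n. n > 0 \<Longrightarrow> (\<Sum>d | d dvd n. mu d) = (if n = 1 then 1 else 0)" and n: "n > 0"
  shows "(\<Sum>d | d dvd n. mu d * ln (real d)) = - \<Lambda> n"
proof -
  have fin: "finite {d. d dvd n}" using n by simp
  have "(\<Sum>d | d dvd n. mu d * ln (real (n div d))) = (\<Sum>d | d dvd n. \<Sum>e | e dvd n div d. mu d * \<Lambda> e)"
    unfolding sum_distrib_left[symmetric] using n
    by (intro sum.cong) (auto simp: mangoldt_sum dvd_div_eq_0_iff)
  also have "\<dots> = (\<Sum>e | e dvd n. \<Sum>d | d dvd n div e. mu d * \<Lambda> e)"
    by (rule sum_divisors_swap[OF n])
  also have "\<dots> = (\<Sum>e | e dvd n. if e = n then \<Lambda> e else 0)"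
    unfolding sum_distrib_right[symmetric]
  proof (intro sum.cong)
    fix e assume e: "e \<in> {e. e dvd n}"
    hence *: "n div e > 0" using n by (auto elim!: dvdE)
    have "n div e = 1 \<longleftrightarrow> e = n" using e n by (auto elim!: dvdE)
    thus "(\<Sum>d | d dvd n div e. mu d) * \<Lambda> e = (if e = n then \<Lambda> e else 0)"
      by (subst mu[OF *]) auto
  qed auto
  also have "\<dots> = \<Lambda> n" using fin by simp
  finally have 1: "(\<Sum>d | d dvd n. mu d * ln (real (n div d))) = \<Lambda> n" .
  have "(\<Sum>d | d dvd n. mu d * ln (real (n div d))) = (\<Sum>d | d dvd n. mu d * (ln (real n) - ln (real d)))"
    using n by (intro sum.cong) (auto simp: real_of_nat_div ln_div elim!: dvdE)
  also have "\<dots> = ln (real n) * (\<Sum>d | d dvd n. mu d) - (\<Sum>d | d dvd n. mu d * ln (real d))"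
    by (simp add: algebra_simps sum_subtractf sum_distrib_left)
  also have "ln (real n) * (\<Sum>d | d dvd n. mu d) = 0" using n by (simp add: mu)
  finally show ?thesis using 1 by simp
qed

text \<open>The error has to be of order \<open>1 / x\<close>, because Selberg's formula multiplies
  this estimate by \<open>x\<close>.\<close>

lemma harm_approx:
  assumes "x \<ge> 1"
  shows "\<bar>(\<Sum>n\<in>nat_upto x. 1 / real n) - ln x - euler_mascheroni\<bar> \<le> 2 / x"
proof -
  define n where "n = nat \<lfloor>x\<rfloor>"
  have n: "n \<ge> 1" "real n \<le> x" "x < real n + 1" using assms unfolding n_def by linarith+
  have H: "(\<Sum>n\<in>nat_upto x. 1 / real n) = harm n"
    by (simp add: nat_upto_altdef n_def harm_def field_simps)
  have up: "euler_mascheroni \<le> harm n - ln (real n)"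
  proof (rule LIMSEQ_le_const2[OF euler_mascheroni_LIMSEQ])
    show "\<exists>N. \<forall>m\<ge>N. harm m - ln (real m) \<le> harm n - ln (real n)"
      using n by (intro exI[of _ n] allI impI euler_mascheroni_sequence_decreasing) auto
  qed
  obtain k where k: "n = Suc k" using n by (cases n) auto
  have lo: "harm n - ln (real n + 1) \<le> euler_mascheroni"
    using order.trans[OF _ euler_mascheroni_lower[of k], of "harm n - ln (real n + 1)"] by (simp add: k add_ac)
  have d1: "ln (real n + 1) - ln (real n) \<le> 1 / real n"
    using n ln_add_one_self_le_self[of "1 / real n"] ln_div[of "real n + 1" "real n"]
    by (simp add: add_divide_distrib)
  have d2: "ln x \<le> ln (real n + 1)" "ln x \<ge> ln (real n)" using n assms by auto
  have "real n \<ge> 1" using n by simp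
  hence "x \<le> 2 * real n" using n(3) by linarith
  moreover have "0 < 2 * real n" "0 < x" using n assms by auto
  ultimately have "1 / real n \<le> 2 / x" by (simp add: field_simps)
  thus ?thesis unfolding H using up lo d1 d2 by linarith
qed

lemma sum_inverse_sqrt_le: "(\<Sum>k=1..n. 1 / sqrt (real k)) \<le> 2 * sqrt (real n)"
proof (induction n)
  case (Suc n)
  define a where "a = sqrt (real n)"
  define b where "b = sqrt (real (Suc n))"
  have ab: "a \<ge> 0" "b > 0" "a \<le> b" "b\<^sup>2 - a\<^sup>2 = 1" by (auto simp: a_def b_def)
  have "1 = (b - a) * (b + a)" using ab by (simp add: power2_eq_square algebra_simps)
  also have "\<dots> \<le> (b - a) * (2 * b)" using ab by (intro mult_left_mono) auto
  finally have "1 / b \<le> 2 * (b - a)" using ab by (simp add: field_simps)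
  thus ?case using Suc by (simp add: a_def b_def)
qed simp

text \<open>Errors of size \<open>sqrt (x / d)\<close> add up to \<open>O(x)\<close> with no
  logarithm; this is why a square-root bound on the logarithmic sums suffices in Selberg's
  formula.\<close>

lemma sum_sqrt_div_le:
  assumes "x \<ge> 0"
  shows "(\<Sum>d\<in>nat_upto x. sqrt (x / real d)) \<le> 2 * x"
proof -
  define n where "n = nat \<lfloor>x\<rfloor>"
  have n: "real n \<le> x" using assms unfolding n_def by linarith
  have "(\<Sum>d\<in>nat_upto x. sqrt (x / real d)) = sqrt x * (\<Sum>k=1..n. 1 / sqrt (real k))"
    by (simp add: nat_upto_altdef n_def real_sqrt_divide sum_distrib_left)
  also have "\<dots> \<le> sqrt x * (2 * sqrt x)"
    using sum_inverse_sqrt_le[of n] n assms 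
    by (intro mult_left_mono order.trans[OF sum_inverse_sqrt_le]) auto
  also have "\<dots> = 2 * x" using assms by simp
  finally show ?thesis .
qed

lemma ln_times_affine_ln_le_sqrt:
  fixes c :: real
  assumes "x \<ge> 1" "c \<ge> 0"
  shows "ln x * (c + 2 * ln x) \<le> (4 * c + 32) * sqrt x"
proof -
  define s where "s = sqrt (sqrt x)"
  have s: "s \<ge> 1" "s * s = sqrt x" "(s * s) * (s * s) = x" using assms by (auto simp: s_def)
  have "ln x = 4 * ln s" using s(1) by (subst s(3)[symmetric]) (simp add: ln_mult)
  also have "\<dots> \<le> 4 * s" using ln_le_minus_one[of s] s by simp
  finally have l: "ln x \<le> 4 * s" .
  have "ln x * (c + 2 * ln x) \<le> 4 * s * (c * s + 2 * (4 * s))"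
  proof (intro mult_mono add_mono)
    show "c \<le> c * s" using assms s mult_left_mono[of 1 s c] by simp
  qed (use l s assms in auto)
  also have "\<dots> = (4 * c + 32) * sqrt x" by (simp add: s(2)[symmetric] algebra_simps)
  finally show ?thesis .
qed

text \<open>
  Tatuzawa and Iseki's derivation of Selberg's formula: Moebius inversion with a logarithmic weight,
  applied to \<open>\<psi> x - x + \<gamma> + 1\<close>, whose sum over \<open>x / n\<close> is only logarithmic in size.
\<close>

lemma selberg_formula:
  obtains C :: real where "\<And>x. x \<ge> 1 \<Longrightarrow>
    \<bar>\<psi> x * ln x + (\<Sum>n\<in>nat_upto x. \<Lambda> n * \<psi> (x / real n)) - 2 * x * ln x\<bar> \<le> C * x"
proof -
  obtain mu :: "nat \<Rightarrow> real" where mu: "\<And>n. \<bar>mu n\<bar> \<le> 1"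
    "\<And>n. n > 0 \<Longrightarrow> (\<Sum>d | d dvd n. mu d) = (if n = 1 then 1 else 0)"
    using moebius_exists by blast
  define g :: real where "g = euler_mascheroni"
  have g: "g \<ge> 0" using euler_mascheroni_pos by (simp add: g_def)
  \<comment> \<open>The shift makes the main terms cancel: summing over \<open>x / n\<close>,
    \<open>\<psi>\<close> gives \<open>x ln x - x\<close>, the linear part removes
    \<open>x ln x + g x\<close>, and the constant \<open>g + 1\<close> restores
    \<open>(g + 1) x\<close>. Only a logarithmic error remains.\<close>
  define F where "F = (\<lambda>x. \<psi> x - x + g + 1)"
  define G where "G = (\<lambda>x. ln x * (\<Sum>n\<in>nat_upto x. F (x / real n)))"
  define c where "c = 4 + g"
  have S: "\<bar>\<Sum>n\<in>nat_upto x. F (x / real n)\<bar> \<le> c + 2 * ln x" if x: "x \<ge> 1" for x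
  proof -
    define H where "H = (\<Sum>n\<in>nat_upto x. 1 / real n)"
    have eq: "(\<Sum>n\<in>nat_upto x. F (x / real n)) = ln_sum x - x * H + (g + 1) * real (card (nat_upto x))"
      by (simp add: F_def ln_sum_eq_sum_psi sum_subtractf sum.distrib H_def sum_distrib_left algebra_simps)
    have "x * \<bar>H - ln x - g\<bar> \<le> x * (2 / x)" unfolding H_def g_def
      using x by (intro mult_left_mono harm_approx) auto
    moreover have "x * H - x * ln x - x * g = x * (H - ln x - g)" by (simp add: algebra_simps)
    ultimately have 1: "\<bar>x * H - x * ln x - x * g\<bar> \<le> 2" using x by (simp only: abs_mult) simp
    have 2: "\<bar>ln_sum x - (x * ln x - x)\<bar> \<le> 1 + 2 * ln x" by (rule ln_sum_bounds[OF x])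
    have "\<bar>(g + 1) * (real (card (nat_upto x)) - x)\<bar> \<le> (g + 1) * 1"
      unfolding abs_mult using card_nat_upto_bounds[of x] x g by (intro mult_mono) auto
    hence 3: "\<bar>(g + 1) * real (card (nat_upto x)) - x * g - x\<bar> \<le> g + 1" by (simp add: algebra_simps)
    show ?thesis unfolding eq c_def using 1 2 3 by linarith
  qed
  have Gb: "\<bar>G x\<bar> \<le> (4 * c + 32) * sqrt x" if x: "x \<ge> 1" for x
  proof -
    have "\<bar>G x\<bar> = ln x * \<bar>\<Sum>n\<in>nat_upto x. F (x / real n)\<bar>" using x by (simp add: G_def abs_mult)
    also have "\<dots> \<le> ln x * (c + 2 * ln x)" using x S[OF x] by (intro mult_left_mono) auto
    also have "\<dots> \<le> (4 * c + 32) * sqrt x" using x g by (intro ln_times_affine_ln_le_sqrt) (auto simp: c_def)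
    finally show ?thesis .
  qed
  \<comment> \<open>In the weight \<open>mu d * ln (x / d)\<close>, the part
    \<open>mu d * ln x\<close> isolates \<open>n = 1\<close>, and \<open>- mu d * ln d\<close>
    produces \<open>\<Lambda> n\<close> by \<open>sum_moebius_ln\<close>.\<close>
  have inv: "F x * ln x + (\<Sum>n\<in>nat_upto x. \<Lambda> n * F (x / real n)) = (\<Sum>d\<in>nat_upto x. mu d * G (x / real d))"
    if x: "x \<ge> 1" for x
  proof -
    have "(\<Sum>d\<in>nat_upto x. mu d * G (x / real d)) = 
          (\<Sum>d\<in>nat_upto x. \<Sum>m\<in>nat_upto (x / real d). mu d * ln (x / real d) * F (x / real (d * m)))"
      by (simp add: G_def sum_distrib_left mult_ac)
    also have "\<dots> = (\<Sum>n\<in>nat_upto x. \<Sum>d | d dvd n. mu d * ln (x / real d) * F (x / real (d * (n div d))))"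
      by (rule sum_divisors_nat_upto[symmetric])
    also have "\<dots> = (\<Sum>n\<in>nat_upto x. F (x / real n) * ((if n = 1 then ln x else 0) + \<Lambda> n))"
    proof (intro sum.cong refl)
      fix n assume n: "n \<in> nat_upto x"
      hence n0: "n > 0" by (auto simp: nat_upto_def)
      have "(\<Sum>d | d dvd n. mu d * ln (x / real d) * F (x / real (d * (n div d)))) =
            (\<Sum>d | d dvd n. F (x / real n) * (ln x * mu d - mu d * ln (real d)))"
      proof (intro sum.cong refl)
        fix d assume "d \<in> {d. d dvd n}"
        then obtain m where m: "n = d * m" by auto
        hence "d > 0" using n0 by auto
        hence "d * (n div d) = n" "ln (x / real d) = ln x - ln (real d)" using x by (auto simp: m ln_div)
        thus "mu d * ln (x / real d) * F (x / real (d * (n div d))) =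
              F (x / real n) * (ln x * mu d - mu d * ln (real d))"
          by (simp only:) (simp add: algebra_simps)
      qed
      also have "\<dots> = F (x / real n) * (ln x * (\<Sum>d | d dvd n. mu d) - (\<Sum>d | d dvd n. mu d * ln (real d)))"
        by (simp add: sum_distrib_left sum_subtractf algebra_simps)
      also have "(\<Sum>d | d dvd n. mu d * ln (real d)) = - \<Lambda> n"
        using mu(2) n0 by (intro sum_moebius_ln) auto
      finally show "(\<Sum>d | d dvd n. mu d * ln (x / real d) * F (x / real (d * (n div d)))) =
                    F (x / real n) * ((if n = 1 then ln x else 0) + \<Lambda> n)"
        using n0 by (simp add: mu(2))
    qed
    also have "\<dots> = (\<Sum>n\<in>nat_upto x. if n = 1 then F x * ln x else 0) + (\<Sum>n\<in>nat_upto x. \<Lambda> n * F (x / real n))"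
      by (subst sum.distrib[symmetric]) (auto intro!: sum.cong simp: algebra_simps)
    also have "(\<Sum>n\<in>nat_upto x. if n = 1 then F x * ln x else 0) = F x * ln x"
      using x by (subst sum.delta[OF finite_nat_upto]) (auto simp: nat_upto_def)
    finally show ?thesis by simp
  qed
  define C where "C = 2 * (4 * c + 32) + 24 + 21 * (g + 1)"
  show ?thesis
  proof (rule that[of C])
    fix x :: real assume x: "x \<ge> 1"
    have "\<bar>\<Sum>d\<in>nat_upto x. mu d * G (x / real d)\<bar> \<le> (\<Sum>d\<in>nat_upto x. 1 * ((4 * c + 32) * sqrt (x / real d)))"
    proof (rule order.trans[OF sum_abs sum_mono])
      fix d assume d: "d \<in> nat_upto x"
      show "\<bar>mu d * G (x / real d)\<bar> \<le> 1 * ((4 * c + 32) * sqrt (x / real d))"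
        unfolding abs_mult using d by (intro mult_mono mu Gb) (auto simp: nat_upto_def)
    qed
    also have "\<dots> = (4 * c + 32) * (\<Sum>d\<in>nat_upto x. sqrt (x / real d))" by (simp add: sum_distrib_left)
    also have "\<dots> \<le> (4 * c + 32) * (2 * x)" using x g by (intro mult_left_mono sum_sqrt_div_le) (auto simp: c_def)
    finally have B: "\<bar>F x * ln x + (\<Sum>n\<in>nat_upto x. \<Lambda> n * F (x / real n))\<bar> \<le> 2 * (4 * c + 32) * x"
      unfolding inv[OF x] by (simp only: mult_ac)
    define E where "E = (\<Sum>n\<in>nat_upto x. \<Lambda> n / real n)"
    define P where "P = (\<Sum>n\<in>nat_upto x. \<Lambda> n * \<psi> (x / real n))"
    have eq: "(\<Sum>n\<in>nat_upto x. \<Lambda> n * F (x / real n)) = P - x * E + (g + 1) * \<psi> x"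
      by (simp add: F_def P_def E_def psi_def sum_distrib_left sum.distrib sum_subtractf algebra_simps)
    have "x * \<bar>E - ln x\<bar> \<le> x * 24" unfolding E_def using x by (intro mult_left_mono sum_mangoldt_over_bounds) auto
    moreover have "x * E - x * ln x = x * (E - ln x)" by (simp add: algebra_simps)
    ultimately have 1: "\<bar>x * E - x * ln x\<bar> \<le> 24 * x" using x by (simp only: abs_mult)
    have 2: "(g + 1) * \<psi> x \<le> (g + 1) * (20 * x)" "(g + 1) * \<psi> x \<ge> 0"
      using psi_le[of x] x g by (auto intro!: mult_left_mono)
    have 3: "(g + 1) * ln x \<le> (g + 1) * x" "(g + 1) * ln x \<ge> 0"
      using ln_le_minus_one[of x] x g by (auto intro!: mult_left_mono)
    have "C * x = 2 * (4 * c + 32) * x + 24 * x + ((g + 1) * (20 * x) + (g + 1) * x)" by (simp add: C_def algebra_simps)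
    moreover have "F x * ln x = \<psi> x * ln x - x * ln x + (g + 1) * ln x" by (simp add: F_def algebra_simps)
    ultimately have "\<bar>\<psi> x * ln x + P - 2 * x * ln x\<bar> \<le> C * x"
      using B 1 2 3 unfolding eq by linarith
    thus "\<bar>\<psi> x * ln x + (\<Sum>n\<in>nat_upto x. \<Lambda> n * \<psi> (x / real n)) - 2 * x * ln x\<bar> \<le> C * x"
      by (simp add: P_def)
  qed
qed

subsection \<open>Almost primes in short intervals\<close>

text \<open>Selberg's weight, the Moebius inverse of the squared logarithm. The two summands are
  those of Selberg's formula, so its summatory function has an elementary asymptotic although that
  of \<open>\<Lambda>\<close> does not.\<close>

definition Lam2 :: "nat \<Rightarrow> real" ("\<Lambda>\<^sub>2") where
  "\<Lambda>\<^sub>2 n = \<Lambda> n * ln (real n) + (\<Sum>d | d dvd n. \<Lambda> d * \<Lambda> (n div d))"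

lemma Lam2_nonneg: "\<Lambda>\<^sub>2 n \<ge> 0"
proof -
  have "ln (real n) \<ge> 0" by (cases "n = 0") auto
  thus ?thesis unfolding Lam2_def
    by (intro add_nonneg_nonneg sum_nonneg mult_nonneg_nonneg mangoldt_nonneg)
qed

lemma sum_inverse_squares_le: "(\<Sum>k=1..n. 1 / (real k)\<^sup>2) \<le> 2"
proof -
  have "(\<Sum>k=1..n. 1 / (real k)\<^sup>2) \<le> 2 - 1 / real n" if "n \<ge> 1"
    using that
  proof (induction n rule: dec_induct)
    case (step n)
    have "1 / (real (Suc n))\<^sup>2 \<le> 1 / real n - 1 / real (Suc n)"
    proof -
      have "1 / (real (Suc n))\<^sup>2 \<le> 1 / (real n * real (Suc n))"
        using step(1) by (intro divide_left_mono) (auto simp: power2_eq_square)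
      also have "\<dots> = 1 / real n - 1 / real (Suc n)" using step(1) by (simp add: field_simps)
      finally show ?thesis .
    qed
    with step show ?case by simp
  qed simp
  thus ?thesis by (cases "n = 0") (auto intro: order.trans[of _ "2 - 1 / real n"])
qed

lemma ln_le_sum_inverse:
  assumes "x \<ge> 1"
  shows "ln x \<le> (\<Sum>m\<in>nat_upto x. 1 / real m)"
proof -
  have "ln x \<le> ln (real (nat \<lfloor>x\<rfloor>) + 1)" 
    using assms by (intro ln_le_cancel_iff[THEN iffD2]) linarith+
  also have "\<dots> \<le> harm (nat \<lfloor>x\<rfloor>)" by (rule ln_le_harm)
  finally show ?thesis by (simp add: nat_upto_altdef harm_def field_simps)
qed

text \<open>Bounding the logarithm by a harmonic sum and exchanging the sums leaves
  \<open>\<psi> (x / m) / m \<le> 20 x / m^2\<close>, hence \<open>20 * 2 = 40\<close>. This lets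
  the weight \<open>ln n\<close> in \<open>\<Lambda>\<^sub>2\<close> be replaced by
  \<open>ln x\<close>.\<close>

lemma sum_mangoldt_ln_div_le:
  assumes "x \<ge> 1"
  shows "(\<Sum>n\<in>nat_upto x. \<Lambda> n * ln (x / real n)) \<le> 40 * x"
proof -
  have "(\<Sum>n\<in>nat_upto x. \<Lambda> n * ln (x / real n)) \<le> (\<Sum>n\<in>nat_upto x. \<Lambda> n * (\<Sum>m\<in>nat_upto (x / real n). 1 / real m))"
    by (intro sum_mono mult_left_mono mangoldt_nonneg ln_le_sum_inverse) (auto simp: nat_upto_def)
  also have "\<dots> = (\<Sum>n\<in>nat_upto x. \<Sum>m\<in>nat_upto (x / real n). \<Lambda> n * (1 / real m))" by (simp add: sum_distrib_left)
  also have "\<dots> = (\<Sum>m\<in>nat_upto x. \<Sum>n\<in>nat_upto (x / real m). \<Lambda> n * (1 / real m))" by (rule sum_nat_upto_swap)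
  also have "\<dots> = (\<Sum>m\<in>nat_upto x. \<psi> (x / real m) * (1 / real m))" by (simp add: psi_def sum_divide_distrib)
  also have "\<dots> \<le> (\<Sum>m\<in>nat_upto x. 20 * (x / real m) * (1 / real m))"
    using assms by (intro sum_mono mult_right_mono psi_le) auto
  also have "\<dots> = 20 * x * (\<Sum>k=1..nat \<lfloor>x\<rfloor>. 1 / (real k)\<^sup>2)"
    by (simp add: nat_upto_altdef sum_distrib_left power2_eq_square field_simps)
  also have "\<dots> \<le> 20 * x * 2" using assms by (intro mult_left_mono sum_inverse_squares_le) auto
  finally show ?thesis by simp
qed

lemma sum_Lam2_bounds:
  obtains C :: real where "C \<ge> 0" "\<And>x. x \<ge> 1 \<Longrightarrow> \<bar>(\<Sum>n\<in>nat_upto x. \<Lambda>\<^sub>2 n) - 2 * x * ln x\<bar> \<le> C * x"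
proof -
  obtain C :: real where C: "\<And>x. x \<ge> 1 \<Longrightarrow>
    \<bar>\<psi> x * ln x + (\<Sum>n\<in>nat_upto x. \<Lambda> n * \<psi> (x / real n)) - 2 * x * ln x\<bar> \<le> C * x"
    using selberg_formula by blast
  have C0: "C \<ge> 0" using C[of 1] by simp
  show ?thesis
  proof (rule that[of "C + 40"])
    fix x :: real assume x: "x \<ge> 1"
    have "(\<Sum>n\<in>nat_upto x. \<Lambda>\<^sub>2 n) = (\<Sum>n\<in>nat_upto x. \<Lambda> n * ln (real n)) + (\<Sum>n\<in>nat_upto x. \<Lambda> n * \<psi> (x / real n))"
      unfolding Lam2_def sum.distrib by (subst sum_divisors_nat_upto) (simp add: psi_def sum_distrib_left)
    also have "(\<Sum>n\<in>nat_upto x. \<Lambda> n * ln (real n)) = (\<Sum>n\<in>nat_upto x. \<Lambda> n * ln x - \<Lambda> n * ln (x / real n))"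
      using x by (intro sum.cong) (auto simp: nat_upto_def ln_div algebra_simps)
    also have "\<dots> = \<psi> x * ln x - (\<Sum>n\<in>nat_upto x. \<Lambda> n * ln (x / real n))"
      by (simp add: sum_subtractf psi_def sum_distrib_right)
    finally have "(\<Sum>n\<in>nat_upto x. \<Lambda>\<^sub>2 n) = \<psi> x * ln x - (\<Sum>n\<in>nat_upto x. \<Lambda> n * ln (x / real n)) + (\<Sum>n\<in>nat_upto x. \<Lambda> n * \<psi> (x / real n))" .
    moreover have "(\<Sum>n\<in>nat_upto x. \<Lambda> n * ln (x / real n)) \<ge> 0"
      by (intro sum_nonneg mult_nonneg_nonneg mangoldt_nonneg) (auto simp: nat_upto_def)
    moreover note C[OF x] sum_mangoldt_ln_div_le[OF x]
    ultimately show "\<bar>(\<Sum>n\<in>nat_upto x. \<Lambda>\<^sub>2 n) - 2 * x * ln x\<bar> \<le> (C + 40) * x"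
      unfolding distrib_right by linarith
  qed (use C0 in auto)
qed

lemma sum_divisors_divisors:
  fixes h :: "nat \<Rightarrow> nat \<Rightarrow> 'b::comm_monoid_add"
  assumes "n > 0"
  shows "(\<Sum>d | d dvd n. \<Sum>e | e dvd d. h e (d div e)) = (\<Sum>e | e dvd n. \<Sum>f | f dvd n div e. h e f)"
proof -
  have f: "finite {d. d dvd m}" if "m dvd n" for m using assms that by (auto intro!: finite_divisors_nat Nat.gr0I)
  have "(\<Sum>d | d dvd n. \<Sum>e | e dvd d. h e (d div e)) =
        (\<Sum>(d,e)\<in>(SIGMA d:{d. d dvd n}. {e. e dvd d}). h e (d div e))"
    using assms by (intro sum.Sigma ballI f) auto
  also have "\<dots> = (\<Sum>(e,f)\<in>(SIGMA e:{e. e dvd n}. {f. f dvd n div e}). h e f)"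
    using assms
    by (intro sum.reindex_bij_witness[where i = "\<lambda>(e,f). (e*f,e)" and j = "\<lambda>(d,e). (e,d div e)"])
       (auto elim!: dvdE)
  also have "\<dots> = (\<Sum>e | e dvd n. \<Sum>f | f dvd n div e. h e f)"
    using assms by (intro sum.Sigma[symmetric] ballI f) (auto simp: div_dvd_iff_mult intro!: f)
  finally show ?thesis .
qed

text \<open>Summing the convolution part over divisors turns one factor \<open>\<Lambda>\<close>
  into \<open>ln (n / e)\<close>, which completes \<open>ln e\<close> to \<open>ln n\<close>;
  \<open>mangoldt_sum\<close> then supplies the second logarithm.\<close>

lemma sum_divisors_Lam2:
  assumes "n > 0"
  shows "(\<Sum>d | d dvd n. \<Lambda>\<^sub>2 d) = (ln (real n))\<^sup>2"
proof -
  have "(\<Sum>d | d dvd n. \<Lambda>\<^sub>2 d) = (\<Sum>d | d dvd n. \<Lambda> d * ln (real d)) + (\<Sum>e | e dvd n. \<Sum>f | f dvd n div e. \<Lambda> e * \<Lambda> f)"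
    unfolding Lam2_def sum.distrib by (subst sum_divisors_divisors[OF assms]) simp
  also have "(\<Sum>e | e dvd n. \<Sum>f | f dvd n div e. \<Lambda> e * \<Lambda> f) = (\<Sum>e | e dvd n. \<Lambda> e * ln (real (n div e)))"
    unfolding sum_distrib_left[symmetric] using assms
    by (intro sum.cong) (auto simp: mangoldt_sum dvd_div_eq_0_iff)
  also have "(\<Sum>d | d dvd n. \<Lambda> d * ln (real d)) + (\<Sum>e | e dvd n. \<Lambda> e * ln (real (n div e))) =
             (\<Sum>d | d dvd n. \<Lambda> d * ln (real n))"
    unfolding sum.distrib[symmetric] using assms
    by (intro sum.cong) (auto simp: ln_mult algebra_simps elim!: dvdE)
  also have "\<dots> = (ln (real n))\<^sup>2"
    using assms by (simp add: sum_distrib_right[symmetric] mangoldt_sum power2_eq_square)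
  finally show ?thesis .
qed

text \<open>Since \<open>ln n\<close> differs from \<open>ln x\<close> by a bounded amount on
  average, an average weighted by the squared logarithm agrees with the plain one up to a relative
  error of order \<open>1 / ln x\<close>.\<close>

lemma sum_ln_squared_defect:
  assumes "x \<ge> 1"
  shows "(\<Sum>n\<in>nat_upto x. (ln x)\<^sup>2 - (ln (real n))\<^sup>2) \<le> 8 * x * ln x"
proof -
  have "(\<Sum>n\<in>nat_upto x. (ln x)\<^sup>2 - (ln (real n))\<^sup>2) \<le> (\<Sum>n\<in>nat_upto x. (ln x - ln (real n)) * (2 * ln x))"
  proof (rule sum_mono)
    fix n assume n: "n \<in> nat_upto x"
    hence l: "ln (real n) \<le> ln x" using assms by (auto simp: nat_upto_def)
    have "(ln x)\<^sup>2 - (ln (real n))\<^sup>2 = (ln x - ln (real n)) * (ln x + ln (real n))"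
      by (simp add: power2_eq_square algebra_simps)
    also have "\<dots> \<le> (ln x - ln (real n)) * (2 * ln x)" using l by (intro mult_left_mono) auto
    finally show "(ln x)\<^sup>2 - (ln (real n))\<^sup>2 \<le> (ln x - ln (real n)) * (2 * ln x)" .
  qed
  also have "\<dots> = (real (card (nat_upto x)) * ln x - ln_sum x) * (2 * ln x)"
    by (simp add: sum_distrib_right[symmetric] sum_subtractf ln_sum_def)
  also have "\<dots> \<le> (4 * x) * (2 * ln x)"
  proof (rule mult_right_mono)
    have "real (card (nat_upto x)) * ln x \<le> x * ln x"
      using assms by (intro mult_right_mono card_nat_upto_bounds) auto
    thus "real (card (nat_upto x)) * ln x - ln_sum x \<le> 4 * x"
      using ln_sum_bounds[OF assms] ln_le_minus_one[of x] assms by linarith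
  qed (use assms in auto)
  finally show ?thesis by simp
qed

text \<open>Counting the sum of the squared logarithms through \<open>sum_divisors_Lam2\<close> and
  removing the floors. It shows that the weights \<open>\<Lambda>\<^sub>2 d / d\<close>, divided by
  the square of \<open>ln x\<close>, have total mass close to 1.\<close>

lemma sum_Lam2_over_bounds:
  obtains C :: real where "C \<ge> 0" "\<And>x. x \<ge> 1 \<Longrightarrow> \<bar>(\<Sum>d\<in>nat_upto x. \<Lambda>\<^sub>2 d / real d) - (ln x)\<^sup>2\<bar> \<le> C + 11 * ln x"
proof -
  obtain C where C: "C \<ge> 0" "\<And>x. x \<ge> 1 \<Longrightarrow> \<bar>(\<Sum>n\<in>nat_upto x. \<Lambda>\<^sub>2 n) - 2 * x * ln x\<bar> \<le> C * x"
    using sum_Lam2_bounds by blast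
  show ?thesis
  proof (rule that[OF C(1)])
    fix x :: real assume x: "x \<ge> 1"
    define E where "E = (\<Sum>d\<in>nat_upto x. \<Lambda>\<^sub>2 d / real d)"
    define Q where "Q = (\<Sum>n\<in>nat_upto x. (ln (real n))\<^sup>2)"
    have "Q = (\<Sum>n\<in>nat_upto x. \<Sum>d | d dvd n. \<Lambda>\<^sub>2 d)"
      unfolding Q_def by (intro sum.cong) (auto simp: nat_upto_def sum_divisors_Lam2)
    also have "\<dots> = (\<Sum>d\<in>nat_upto x. \<Sum>m\<in>nat_upto (x / real d). \<Lambda>\<^sub>2 d)" by (rule sum_divisors_nat_upto)
    also have "\<dots> = (\<Sum>d\<in>nat_upto x. \<Lambda>\<^sub>2 d * of_int \<lfloor>x / real d\<rfloor>)"
      using x by (intro sum.cong) (auto simp: card_nat_upto)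
    finally have "x * E - Q = (\<Sum>d\<in>nat_upto x. \<Lambda>\<^sub>2 d * (x / real d - of_int \<lfloor>x / real d\<rfloor>))"
      by (simp add: E_def sum_distrib_left sum_subtractf algebra_simps)
    moreover have "\<dots> \<ge> 0" by (intro sum_nonneg mult_nonneg_nonneg Lam2_nonneg) auto
    moreover have "(\<Sum>d\<in>nat_upto x. \<Lambda>\<^sub>2 d * (x / real d - of_int \<lfloor>x / real d\<rfloor>)) \<le> (\<Sum>d\<in>nat_upto x. \<Lambda>\<^sub>2 d * 1)"
      by (intro sum_mono mult_left_mono Lam2_nonneg) linarith
    moreover have "(\<Sum>d\<in>nat_upto x. \<Lambda>\<^sub>2 d * 1) \<le> C * x + 2 * x * ln x" using C(2)[OF x] by simp
    ultimately have 1: "x * E - Q \<ge> 0" "x * E - Q \<le> C * x + 2 * x * ln x" by linarith+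
    have "(ln x)\<^sup>2 \<le> x * ln x"
      unfolding power2_eq_square using ln_le_minus_one[of x] x by (intro mult_right_mono) auto
    moreover have "(x - real (card (nat_upto x))) * (ln x)\<^sup>2 \<le> 1 * (ln x)\<^sup>2"
      "(x - real (card (nat_upto x))) * (ln x)\<^sup>2 \<ge> 0"
      using card_nat_upto_bounds[of x] x by (intro mult_right_mono, auto)+
    moreover have "real (card (nat_upto x)) * (ln x)\<^sup>2 - Q \<le> 8 * x * ln x"
      using sum_ln_squared_defect[OF x] by (simp add: Q_def sum_subtractf)
    moreover have "Q \<le> (\<Sum>n\<in>nat_upto x. (ln x)\<^sup>2)"
      unfolding Q_def by (intro sum_mono power_mono) (auto simp: nat_upto_def)
    hence "Q \<le> real (card (nat_upto x)) * (ln x)\<^sup>2" by simp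
    ultimately have "\<bar>x * E - x * (ln x)\<^sup>2\<bar> \<le> x * (C + 11 * ln x)"
      using 1 by (simp add: abs_le_iff algebra_simps)
    moreover have "x * E - x * (ln x)\<^sup>2 = x * (E - (ln x)\<^sup>2)" by (simp add: algebra_simps)
    ultimately have "x * \<bar>E - (ln x)\<^sup>2\<bar> \<le> x * (C + 11 * ln x)" using x by (simp add: abs_mult)
    thus "\<bar>(\<Sum>d\<in>nat_upto x. \<Lambda>\<^sub>2 d / real d) - (ln x)\<^sup>2\<bar> \<le> C + 11 * ln x" using x by (simp add: E_def)
  qed
qed

text \<open>Squares of primes are included: what matters is only that \<open>S d\<close> is a
  generator or a product of two of them.\<close>

definition almost_prime :: "nat \<Rightarrow> bool" where
  "almost_prime d \<longleftrightarrow> prime d \<or> (\<exists>p q. prime p \<and> prime q \<and> d = p * q)"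

text \<open>The exponent \<open>3/4\<close> is below 1, which also controls the logarithmic weight in \<^const>\<open>Lam2\<close>.\<close>

lemma sum_mangoldt_nonprime_bound:
  obtains K :: real where "K \<ge> 0"
    "\<And>x. (\<Sum>d\<in>nat_upto x. (if prime d then 0 else \<Lambda> d) * real d powr (-3/4)) \<le> K"
proof -
  have sm: "summable (\<lambda>n. real n powr (-5/4))" by (subst summable_real_powr_iff) auto
  \<comment> \<open>For each prime the exponents from 2 on form a geometric series of size at most
    \<open>4 * p^(-3/2)\<close>, and \<open>ln p \<le> 4 * p^(1/4)\<close>; hence the factor 16 and
    the exponent \<open>-5/4\<close>.\<close>
  define K where "K = 16 * (\<Sum>n. real n powr (-5/4))"
  have K0: "K \<ge> 0" unfolding K_def by (intro mult_nonneg_nonneg suminf_nonneg sm) auto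
  show ?thesis
  proof (rule that[OF K0])
    fix x :: real
    define N where "N = nat \<lfloor>x\<rfloor>"
    define T where "T = {2..N} \<times> {2..N}"
    define g where "g = (\<lambda>(p,a). ln (real p) * (real p powr (-3/4)) ^ a)"
    define A where "A = {d\<in>nat_upto x. \<not> prime d \<and> primepow d}"
    have pow: "real (p ^ a) powr (-3/4) = (real p powr (-3/4)) ^ a" for p a :: nat
      by (induction a) (auto simp: powr_mult)
    have sub: "\<exists>t. t \<in> T \<and> fst t ^ snd t = d \<and> \<Lambda> d * real d powr (-3/4) = g t" if d: "d \<in> A" for d
    proof -
      obtain p a where pa: "prime p" "a > 0" "d = p ^ a" using d by (auto simp: A_def primepow_def)
      have "a \<noteq> 1" using d pa by (auto simp: A_def)
      hence a: "a \<ge> 2" using pa by simp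
      have p2: "p \<ge> 2" using pa prime_ge_2_nat by simp
      have dN: "d \<le> N" using d by (auto simp: A_def nat_upto_altdef N_def)
      have "p \<le> d" using pa p2 self_le_power[of p a] by simp
      moreover have "a \<le> d" using power_mono[OF p2, of a] less_exp[of a] unfolding pa(3) by linarith
      ultimately have "(p,a) \<in> T" using dN a p2 by (auto simp: T_def)
      moreover have "\<Lambda> d * real d powr (-3/4) = g (p,a)"
        using pa pow[of p a] by (simp add: g_def)
      ultimately show ?thesis using pa by (intro exI[of _ "(p,a)"]) auto
    qed
    then obtain t where t: "\<And>d. d \<in> A \<Longrightarrow> t d \<in> T" "\<And>d. d \<in> A \<Longrightarrow> fst (t d) ^ snd (t d) = d"
      "\<And>d. d \<in> A \<Longrightarrow> \<Lambda> d * real d powr (-3/4) = g (t d)" by metis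
    \<comment> \<open>A proper prime power determines its pair (base, exponent), so the sum embeds
      into one over a box of pairs with both entries at least 2.\<close>
    have inj: "inj_on t A" by (rule inj_onI) (metis t(2))
    have finT: "finite T" by (simp add: T_def)
    have g0: "g u \<ge> 0" if "u \<in> T" for u using that by (auto simp: g_def T_def)
    have "(\<Sum>d\<in>nat_upto x. (if prime d then 0 else \<Lambda> d) * real d powr (-3/4)) = (\<Sum>d\<in>A. \<Lambda> d * real d powr (-3/4))"
      unfolding A_def by (intro sum.mono_neutral_cong_right) (auto simp: mangoldt_def)
    also have "\<dots> = (\<Sum>d\<in>A. g (t d))" using t(3) by (intro sum.cong) auto
    also have "\<dots> = (\<Sum>u\<in>t ` A. g u)" using inj by (simp add: sum.reindex)
    also have "\<dots> \<le> (\<Sum>u\<in>T. g u)" using t(1) g0 finT by (intro sum_mono2) auto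
    also have "\<dots> = (\<Sum>p\<in>{2..N}. \<Sum>a\<in>{2..N}. ln (real p) * (real p powr (-3/4)) ^ a)"
      unfolding T_def g_def by (rule sum.cartesian_product[symmetric])
    also have "\<dots> \<le> (\<Sum>p\<in>{2..N}. 16 * real p powr (-5/4))"
    proof (rule sum_mono)
      fix p assume p: "p \<in> {2..N}"
      define r where "r = real p powr (-3/4)"
      have r0: "r \<ge> 0" by (simp add: r_def)
      have "r \<le> 2 powr (-3/4)" unfolding r_def using p by (intro powr_mono2') auto
      also have "\<dots> \<le> 3/4"
      proof -
        have "(2 powr (-3/4)) ^ 4 = 2 powr (-3::real)" by (simp add: powr_power)
        also have "\<dots> = 1/8" by (simp add: powr_minus powr_numeral)
        also have "\<dots> \<le> (3/4::real) ^ 4" by (simp add: power4_eq_xxxx)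
        finally show ?thesis by (rule power_le_imp_le_base[of _ 3, simplified]) simp
      qed
      finally have r1: "r \<le> 3/4" .
      have "(\<Sum>a\<in>{2..N}. r ^ a) \<le> 4 * r ^ 2"
      proof (cases "N \<ge> 2")
        case True
        have "(\<Sum>a\<in>{2..N}. r ^ a) * (1 - r) = r ^ 2 - r ^ Suc N"
          using sum_gp_multiplied[of 2 N r] True by (simp add: mult.commute)
        also have "\<dots> \<le> r ^ 2" using r0 by simp
        finally have "(\<Sum>a\<in>{2..N}. r ^ a) * (1 - r) \<le> r ^ 2" .
        moreover have "(\<Sum>a\<in>{2..N}. r ^ a) * (1/4) \<le> (\<Sum>a\<in>{2..N}. r ^ a) * (1 - r)"
          using r0 r1 by (intro mult_left_mono sum_nonneg) auto
        ultimately show ?thesis by simp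
      qed (use r0 in auto)
      moreover have "ln (real p) \<le> 4 * real p powr (1/4)"
        using ln_powr_bound[of "real p" "1/4"] p by simp
      ultimately have "ln (real p) * (\<Sum>a\<in>{2..N}. r ^ a) \<le> 4 * real p powr (1/4) * (4 * r ^ 2)"
        using p r0 by (intro mult_mono sum_nonneg) auto
      also have "\<dots> = 16 * real p powr (-5/4)"
        using p by (simp add: r_def power2_eq_square powr_add[symmetric])
      finally show "(\<Sum>a\<in>{2..N}. ln (real p) * (real p powr (-3/4)) ^ a) \<le> 16 * real p powr (-5/4)"
        by (simp add: r_def sum_distrib_left)
    qed
    also have "\<dots> = 16 * (\<Sum>p\<in>{2..N}. real p powr (-5/4))" by (simp add: sum_distrib_left)
    also have "\<dots> \<le> K" unfolding K_def
      using sum_le_suminf[OF sm, of "{2..N}"] by simp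
    finally show "(\<Sum>d\<in>nat_upto x. (if prime d then 0 else \<Lambda> d) * real d powr (-3/4)) \<le> K" .
  qed
qed

text \<open>If \<open>d\<close> is not almost prime, every nonzero term of
  \<open>\<Lambda>\<^sub>2 d\<close> involves a proper prime power, on which \<open>L\<close>
  carries the von Mangoldt weight. Such powers are so sparse that the total loses the logarithm:
  \<open>4 K x\<close> from the diagonal part and \<open>20 K x\<close> from each of the two
  convolutions.\<close>

lemma sum_Lam2_not_almost_prime_le:
  obtains C :: real where "C \<ge> 0" "\<And>x. x \<ge> 1 \<Longrightarrow> (\<Sum>d\<in>{d\<in>nat_upto x. \<not> almost_prime d}. \<Lambda>\<^sub>2 d) \<le> C * x"
proof -
  obtain K where K: "K \<ge> 0" 
    "\<And>x. (\<Sum>d\<in>nat_upto x. (if prime d then 0 else \<Lambda> d) * real d powr (-3/4)) \<le> K"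
    using sum_mangoldt_nonprime_bound by blast
  define L where "L = (\<lambda>d. if prime d then 0 else \<Lambda> d)"
  have L0: "L d \<ge> 0" for d by (auto simp: L_def mangoldt_nonneg)
  show ?thesis
  proof (rule that[of "44 * K"])
    fix x :: real assume x: "x \<ge> 1"
    have pt: "\<Lambda>\<^sub>2 d \<le> L d * ln (real d) + (\<Sum>e | e dvd d. L e * \<Lambda> (d div e) + \<Lambda> e * L (d div e))"
      if d: "\<not> almost_prime d" "d > 0" for d
      unfolding Lam2_def
    proof (intro add_mono sum_mono)
      show "\<Lambda> d * ln (real d) \<le> L d * ln (real d)" using d by (auto simp: L_def almost_prime_def)
      fix e assume e: "e \<in> {e. e dvd d}"
      hence "d = e * (d div e)" by simp
      hence "\<not> (prime e \<and> prime (d div e))" using d(1) unfolding almost_prime_def by metis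
      thus "\<Lambda> e * \<Lambda> (d div e) \<le> L e * \<Lambda> (d div e) + \<Lambda> e * L (d div e)"
        by (auto simp: L_def mangoldt_nonneg)
    qed
    have L1: "(\<Sum>d\<in>nat_upto x. L d * ln (real d)) \<le> 4 * K * x"
    proof -
      have "(\<Sum>d\<in>nat_upto x. L d * ln (real d)) \<le> (\<Sum>d\<in>nat_upto x. (L d * real d powr (-3/4)) * (4 * x))"
      proof (rule sum_mono)
        fix d assume d: "d \<in> nat_upto x"
        hence d0: "d > 0" "real d \<le> x" by (auto simp: nat_upto_def)
        have "ln (real d) \<le> 4 * real d powr (1/4)" using ln_powr_bound[of "real d" "1/4"] d0 by simp
        also have "\<dots> = real d powr (-3/4) * (4 * real d)"
          using d0 powr_add[of "real d" "-3/4" 1] by simp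
        also have "\<dots> \<le> real d powr (-3/4) * (4 * x)" using d0 by (intro mult_left_mono) auto
        finally show "L d * ln (real d) \<le> (L d * real d powr (-3/4)) * (4 * x)"
          using L0[of d] by (simp add: mult_left_mono mult.assoc)
      qed
      also have "\<dots> \<le> K * (4 * x)" unfolding sum_distrib_right[symmetric]
        using x K(2)[of x] by (intro mult_right_mono) (auto simp: L_def)
      finally show ?thesis by simp
    qed
    have L2: "(\<Sum>e\<in>nat_upto x. L e * \<psi> (x / real e)) \<le> 20 * K * x"
    proof -
      have "(\<Sum>e\<in>nat_upto x. L e * \<psi> (x / real e)) \<le> (\<Sum>e\<in>nat_upto x. (L e * real e powr (-3/4)) * (20 * x))"
      proof (rule sum_mono)
        fix e assume e: "e \<in> nat_upto x"
        hence e0: "e > 0" "real e \<ge> 1" by (auto simp: nat_upto_def)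
        have "\<psi> (x / real e) \<le> 20 * (x / real e)" using x by (intro psi_le) auto
        also have "\<dots> = real e powr (-1) * (20 * x)" using e0 by (simp add: powr_minus field_simps)
        also have "\<dots> \<le> real e powr (-3/4) * (20 * x)" using e0 x by (intro mult_right_mono powr_mono) auto
        finally show "L e * \<psi> (x / real e) \<le> (L e * real e powr (-3/4)) * (20 * x)"
          using L0[of e] by (simp add: mult_left_mono mult.assoc)
      qed
      also have "\<dots> \<le> K * (20 * x)" unfolding sum_distrib_right[symmetric]
        using x K(2)[of x] by (intro mult_right_mono) (auto simp: L_def)
      finally show ?thesis by simp
    qed
    have "(\<Sum>d\<in>{d\<in>nat_upto x. \<not> almost_prime d}. \<Lambda>\<^sub>2 d) \<le>
          (\<Sum>d\<in>{d\<in>nat_upto x. \<not> almost_prime d}. L d * ln (real d) + (\<Sum>e | e dvd d. L e * \<Lambda> (d div e) + \<Lambda> e * L (d div e)))"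
      by (intro sum_mono pt) (auto simp: nat_upto_def)
    also have "\<dots> \<le> (\<Sum>d\<in>nat_upto x. L d * ln (real d) + (\<Sum>e | e dvd d. L e * \<Lambda> (d div e) + \<Lambda> e * L (d div e)))"
      by (intro sum_mono2 add_nonneg_nonneg sum_nonneg mult_nonneg_nonneg L0 mangoldt_nonneg)
         (auto simp: nat_upto_altdef)
    also have "\<dots> = (\<Sum>d\<in>nat_upto x. L d * ln (real d)) + (\<Sum>e\<in>nat_upto x. \<Sum>f\<in>nat_upto (x / real e). L e * \<Lambda> f)
                   + (\<Sum>f\<in>nat_upto x. \<Sum>e\<in>nat_upto (x / real f). \<Lambda> f * L e)"
      by (simp add: sum.distrib sum_divisors_nat_upto[of "\<lambda>e f. L e * \<Lambda> f"] sum_divisors_nat_upto[of "\<lambda>e f. \<Lambda> e * L f"])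
    also have "(\<Sum>f\<in>nat_upto x. \<Sum>e\<in>nat_upto (x / real f). \<Lambda> f * L e) = (\<Sum>e\<in>nat_upto x. \<Sum>f\<in>nat_upto (x / real e). \<Lambda> f * L e)"
      by (rule sum_nat_upto_swap)
    also have "(\<Sum>e\<in>nat_upto x. \<Sum>f\<in>nat_upto (x / real e). L e * \<Lambda> f) = (\<Sum>e\<in>nat_upto x. L e * \<psi> (x / real e))"
      by (simp add: psi_def sum_distrib_left)
    also have "(\<Sum>e\<in>nat_upto x. \<Sum>f\<in>nat_upto (x / real e). \<Lambda> f * L e) = (\<Sum>e\<in>nat_upto x. L e * \<psi> (x / real e))"
      by (simp add: psi_def sum_distrib_left mult.commute)
    finally show "(\<Sum>d\<in>{d\<in>nat_upto x. \<not> almost_prime d}. \<Lambda>\<^sub>2 d) \<le> 44 * K * x" using L1 L2 by linarith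
  qed (use K in auto)
qed

text \<open>Subtracting \<open>sum_Lam2_bounds\<close> at the two endpoints leaves a main term
  \<open>2 * y * \<delta> * ln y\<close> against errors \<open>O(y)\<close>, so every fixed
  \<open>\<delta>\<close> works once \<open>y\<close> is large. The final division by
  \<open>d \<le> 3 * y\<close> gives the factor \<open>1/3\<close>.\<close>

lemma almost_prime_short_interval:
  fixes \<delta> :: real
  assumes "0 < \<delta>" "\<delta> \<le> 1"
  obtains Y where "Y \<ge> 1"
    "\<And>y. y \<ge> Y \<Longrightarrow> (\<Sum>d | almost_prime d \<and> y < real d \<and> real d \<le> y * exp \<delta>. \<Lambda>\<^sub>2 d / real d) \<ge> \<delta> / 3 * ln y"
proof -
  obtain C1 where C1: "C1 \<ge> 0" "\<And>x. x \<ge> 1 \<Longrightarrow> \<bar>(\<Sum>n\<in>nat_upto x. \<Lambda>\<^sub>2 n) - 2 * x * ln x\<bar> \<le> C1 * x"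
    using sum_Lam2_bounds by blast
  obtain C2 where C2: "C2 \<ge> 0" "\<And>x. x \<ge> 1 \<Longrightarrow> (\<Sum>d\<in>{d\<in>nat_upto x. \<not> almost_prime d}. \<Lambda>\<^sub>2 d) \<le> C2 * x"
    using sum_Lam2_not_almost_prime_le by blast
  define C where "C = 4 * C1 + 3 * C2"
  have C0: "C \<ge> 0" using C1 C2 by (simp add: C_def)
  show ?thesis
  \<comment> \<open>Beyond this threshold the errors are at most half of the main term.\<close>
  proof (rule that[of "exp (C / \<delta>)"])
    fix y assume y: "y \<ge> exp (C / \<delta>)"
    have y1: "y \<ge> 1" using y C0 assms one_le_exp_iff[of "C / \<delta>"] by (auto intro: order.trans[OF _ y])
    have "C / \<delta> \<le> ln y" using y y1 by (simp add: ln_ge_iff)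
    hence Cl: "C \<le> \<delta> * ln y" using assms by (simp add: field_simps)
    define z where "z = y * exp \<delta>"
    have e3: "exp \<delta> \<le> 3" using exp_le assms order.trans[of "exp \<delta>" "exp 1" 3] by simp
    have e1: "exp \<delta> \<ge> 1 + \<delta>" by (rule exp_ge_add_one_self)
    have z: "z \<ge> y" "z \<le> 3 * y" "z \<ge> 1" using y1 e1 e3 assms by (auto simp: z_def mult_le_cancel_left1 intro: order.trans[of _ y])
    have lz: "ln z = ln y + \<delta>" using y1 by (simp add: z_def ln_mult)
    have sub: "nat_upto y \<subseteq> nat_upto z" using z by (intro nat_upto_mono) auto
    define D where "D = {d. almost_prime d \<and> y < real d \<and> real d \<le> y * exp \<delta>}"
    have D: "D = (nat_upto z - nat_upto y) - {d\<in>nat_upto z - nat_upto y. \<not> almost_prime d}"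
      using y1 by (auto simp: D_def nat_upto_def z_def)
    have "(\<Sum>d\<in>D. \<Lambda>\<^sub>2 d) = (\<Sum>d\<in>nat_upto z - nat_upto y. \<Lambda>\<^sub>2 d) - (\<Sum>d\<in>{d\<in>nat_upto z - nat_upto y. \<not> almost_prime d}. \<Lambda>\<^sub>2 d)"
      unfolding D by (subst sum_diff) auto
    also have "(\<Sum>d\<in>nat_upto z - nat_upto y. \<Lambda>\<^sub>2 d) = (\<Sum>d\<in>nat_upto z. \<Lambda>\<^sub>2 d) - (\<Sum>d\<in>nat_upto y. \<Lambda>\<^sub>2 d)"
      using sub by (subst sum_diff) auto
    finally have eq: "(\<Sum>d\<in>D. \<Lambda>\<^sub>2 d) = (\<Sum>d\<in>nat_upto z. \<Lambda>\<^sub>2 d) - (\<Sum>d\<in>nat_upto y. \<Lambda>\<^sub>2 d) - (\<Sum>d\<in>{d\<in>nat_upto z - nat_upto y. \<not> almost_prime d}. \<Lambda>\<^sub>2 d)" .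
    have "(\<Sum>d\<in>{d\<in>nat_upto z - nat_upto y. \<not> almost_prime d}. \<Lambda>\<^sub>2 d) \<le> (\<Sum>d\<in>{d\<in>nat_upto z. \<not> almost_prime d}. \<Lambda>\<^sub>2 d)"
      by (intro sum_mono2) (auto simp: Lam2_nonneg)
    also have "\<dots> \<le> C2 * z" using C2 z by auto
    also have "\<dots> \<le> C2 * (3 * y)" using C2 z by (intro mult_left_mono) auto
    finally have b3: "(\<Sum>d\<in>{d\<in>nat_upto z - nat_upto y. \<not> almost_prime d}. \<Lambda>\<^sub>2 d) \<le> C2 * (3 * y)" .
    have "C1 * z \<le> C1 * (3 * y)" using C1 z by (intro mult_left_mono) auto
    hence b1: "(\<Sum>d\<in>nat_upto z. \<Lambda>\<^sub>2 d) \<ge> 2 * z * ln z - C1 * (3 * y)" using C1(2)[OF z(3)] by linarith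
    have b2: "(\<Sum>d\<in>nat_upto y. \<Lambda>\<^sub>2 d) \<le> 2 * y * ln y + C1 * y" using C1(2)[OF y1] by linarith
    have "z * ln z \<ge> (y * (1 + \<delta>)) * ln y"
      unfolding lz z_def using y1 assms e1 by (intro mult_mono) auto
    hence "(\<Sum>d\<in>D. \<Lambda>\<^sub>2 d) \<ge> 2 * (y * \<delta> * ln y) - C * y"
      unfolding eq C_def using b1 b2 b3 by (simp add: algebra_simps)
    moreover have "C * y \<le> \<delta> * ln y * y" using Cl y1 by (intro mult_right_mono) auto
    ultimately have main: "(\<Sum>d\<in>D. \<Lambda>\<^sub>2 d) \<ge> y * \<delta> * ln y" by (simp add: algebra_simps)
    have "\<delta> / 3 * ln y = (y * \<delta> * ln y) * (1 / (3 * y))" using y1 by simp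
    also have "\<dots> \<le> (\<Sum>d\<in>D. \<Lambda>\<^sub>2 d) * (1 / (3 * y))" using main y1 by (intro mult_right_mono) auto
    also have "\<dots> = (\<Sum>d\<in>D. \<Lambda>\<^sub>2 d / (3 * y))" by (simp add: sum_divide_distrib)
    also have "\<dots> \<le> (\<Sum>d\<in>D. \<Lambda>\<^sub>2 d / real d)"
      using y1 z(2) by (intro sum_mono divide_left_mono Lam2_nonneg) (auto simp: D_def z_def intro: order.trans[OF _ z(2)[unfolded z_def]])
    finally show "(\<Sum>d | almost_prime d \<and> y < real d \<and> real d \<le> y * exp \<delta>. \<Lambda>\<^sub>2 d / real d) \<ge> \<delta> / 3 * ln y"
      by (simp add: D_def)
  qed (use C0 assms in auto)
qed

subsection \<open>Sets of primes with convergent reciprocal sum\<close>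

definition thin :: "nat set \<Rightarrow> bool" where
  "thin Q \<longleftrightarrow> (\<exists>C. \<forall>F. finite F \<longrightarrow> F \<subseteq> Q \<longrightarrow> (\<Sum>p\<in>F. 1 / real p) \<le> C)"

lemma thin_subset: "thin Q \<Longrightarrow> P \<subseteq> Q \<Longrightarrow> thin P"
  unfolding thin_def by (meson order.trans)

lemma thin_finite:
  assumes "finite Q"
  shows "thin Q"
  unfolding thin_def
proof (intro exI[of _ "\<Sum>p\<in>Q. 1 / real p"] allI impI)
  fix F assume "F \<subseteq> Q"
  with assms show "(\<Sum>p\<in>F. 1 / real p) \<le> (\<Sum>p\<in>Q. 1 / real p)" by (intro sum_mono2) auto
qed

lemma thin_Un:
  assumes "thin P" "thin Q"
  shows "thin (P \<union> Q)"
proof -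
  obtain C where C: "\<And>F. finite F \<Longrightarrow> F \<subseteq> P \<Longrightarrow> (\<Sum>p\<in>F. 1 / real p) \<le> C" using assms(1) unfolding thin_def by blast
  obtain D where D: "\<And>F. finite F \<Longrightarrow> F \<subseteq> Q \<Longrightarrow> (\<Sum>p\<in>F. 1 / real p) \<le> D" using assms(2) unfolding thin_def by blast
  show ?thesis unfolding thin_def
  proof (intro exI[of _ "C + D"] allI impI)
    fix F assume F: "finite F" "F \<subseteq> P \<union> Q"
    have "(\<Sum>p\<in>F. 1 / real p) = (\<Sum>p\<in>(F \<inter> P) \<union> (F - P). 1 / real p)" by (intro sum.cong) auto
    also have "\<dots> = (\<Sum>p\<in>F \<inter> P. 1 / real p) + (\<Sum>p\<in>F - P. 1 / real p)"
      using F by (intro sum.union_disjoint) auto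
    also have "\<dots> \<le> C + D" using F by (intro add_mono C D) auto
    finally show "(\<Sum>p\<in>F. 1 / real p) \<le> C + D" .
  qed
qed

lemma thin_UN:
  assumes "finite I" "\<And>i. i \<in> I \<Longrightarrow> thin (Q i)"
  shows "thin (\<Union>i\<in>I. Q i)"
  using assms
proof (induction rule: finite_induct)
  case (insert i I)
  thus ?case using thin_Un[of "Q i" "\<Union>i\<in>I. Q i"] by simp
qed (simp add: thin_finite)

lemma not_thinD:
  assumes "\<not> thin Q"
  obtains F where "finite F" "F \<subseteq> Q" "(\<Sum>p\<in>F. 1 / real p) > C"
proof -
  have "\<exists>F. finite F \<and> F \<subseteq> Q \<and> C < (\<Sum>p\<in>F. 1 / real p)"
    using assms unfolding thin_def by (auto simp: not_le dest: spec[of _ C])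
  thus ?thesis using that by blast
qed

text \<open>A finite subset whose sum is within \<open>\<epsilon>\<close> of the supremum leaves at
  most \<open>\<epsilon>\<close> for everything beyond its maximum.\<close>

lemma thin_tail:
  assumes "thin Q" "\<epsilon> > 0"
  obtains y :: nat where "\<And>F. finite F \<Longrightarrow> F \<subseteq> {p\<in>Q. p > y} \<Longrightarrow> (\<Sum>p\<in>F. 1 / real p) \<le> \<epsilon>"
proof -
  define A where "A = (\<lambda>F. \<Sum>p\<in>F. 1 / real p) ` {F. finite F \<and> F \<subseteq> Q}"
  obtain C where C: "\<And>F. finite F \<Longrightarrow> F \<subseteq> Q \<Longrightarrow> (\<Sum>p\<in>F. 1 / real p) \<le> C" using assms(1) unfolding thin_def by blast
  have bdd: "bdd_above A" unfolding A_def using C by (intro bdd_aboveI[of _ C]) auto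
  have ne: "A \<noteq> {}" by (auto simp: A_def)
  have "Sup A - \<epsilon> < Sup A" using assms by simp
  then obtain a where a: "a \<in> A" "Sup A - \<epsilon> < a"
    using less_cSup_iff[OF ne bdd] by blast
  then obtain F0 where F0: "finite F0" "F0 \<subseteq> Q" "Sup A - \<epsilon> < (\<Sum>p\<in>F0. 1 / real p)"
    unfolding A_def by blast
  show ?thesis
  proof (rule that[of "Max (insert 0 F0)"])
    fix F assume F: "finite F" "F \<subseteq> {p\<in>Q. p > Max (insert 0 F0)}"
    have disj: "F0 \<inter> F = {}" using F F0(1) Max_ge[of "insert 0 F0"] by fastforce
    have "(\<Sum>p\<in>F0 \<union> F. 1 / real p) \<le> Sup A"
      using F F0 by (intro cSup_upper bdd) (auto simp: A_def)
    thus "(\<Sum>p\<in>F. 1 / real p) \<le> \<epsilon>" using F0 F disj by (subst (asm) sum.union_disjoint) auto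
  qed
qed

text \<open>As \<open>p\<close> does not divide \<open>q\<close>, the admissible \<open>m\<close>
  form at most one residue class modulo \<open>p\<close>, so each block of \<open>p\<close>
  consecutive integers contains at most one of them.\<close>

lemma card_dvd_progression_le:
  fixes q r N p :: nat
  assumes "prime p" "\<not> p dvd q"
  shows "real (card {m\<in>{1..N}. p dvd q * m + r}) \<le> real N / real p + 1"
proof -
  have p0: "p > 0" using assms prime_gt_0_nat by auto
  have key: "m = m'" if "p dvd q * m + r" "p dvd q * m' + r" "(m - 1) div p = (m' - 1) div p"
    "m \<ge> 1" "m' \<ge> 1" "m \<le> m'" for m m'
  proof -
    have "p dvd (q * m' + r) - (q * m + r)" using that by (intro dvd_diff_nat)
    also have "(q * m' + r) - (q * m + r) = q * (m' - m)" by (simp add: right_diff_distrib')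
    finally have "p dvd m' - m" using assms prime_dvd_mult_iff by blast
    then obtain j where j: "m' - m = p * j" by blast
    hence "m' - 1 = (m - 1) + p * j" using that by linarith
    hence "(m' - 1) div p = (m - 1) div p + j" using p0 by simp
    hence "j = 0" using that(3) by simp
    with j that show ?thesis by simp
  qed
  have inj: "inj_on (\<lambda>m. (m - 1) div p) {m\<in>{1..N}. p dvd q * m + r}"
  proof (rule inj_onI)
    fix m m' assume *: "m \<in> {m\<in>{1..N}. p dvd q * m + r}" "m' \<in> {m\<in>{1..N}. p dvd q * m + r}"
      "(m - 1) div p = (m' - 1) div p"
    show "m = m'" using * key[of m m'] key[of m' m] by (cases "m \<le> m'") auto
  qed
  have "card {m\<in>{1..N}. p dvd q * m + r} \<le> card {0..N div p}"
  proof (rule card_inj_on_le[OF inj])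
    show "(\<lambda>m. (m - 1) div p) ` {m\<in>{1..N}. p dvd q * m + r} \<subseteq> {0..N div p}"
      by (auto intro!: div_le_mono)
  qed auto
  hence "real (card {m\<in>{1..N}. p dvd q * m + r}) \<le> real (N div p) + 1" by simp
  also have "real (N div p) \<le> real N / real p" by (rule of_nat_div_le_of_nat)
  finally show ?thesis by simp
qed

text \<open>Primes of \<open>Q\<close> up to \<open>y\<close> divide \<open>q\<close> and hence no
  term of the progression. For the others the count is at most \<open>N / p + 1\<close>. If
  \<open>p \<le> N\<close>, this is at most \<open>2 N / p\<close>, which contributes
  \<open>2 \<epsilon> N\<close>. For larger \<open>p\<close> the summand 1 dominates; terms reach
  only \<open>2 q N\<close>, so it costs \<open>O(q N / p)\<close>, and the factor \<open>q\<close>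
  is paid for by the smaller tail beyond \<open>z\<close>.\<close>

lemma progression_sieve:
  fixes q r y :: nat
  assumes Q: "thin Q" "\<And>p. p \<in> Q \<Longrightarrow> prime p" and q: "q > 0" "coprime r q"
    and small: "\<And>p. p \<in> Q \<Longrightarrow> p \<le> y \<Longrightarrow> p dvd q"
    and tail: "\<And>F. finite F \<Longrightarrow> F \<subseteq> {p\<in>Q. p > y} \<Longrightarrow> (\<Sum>p\<in>F. 1 / real p) \<le> \<epsilon>" and eps: "\<epsilon> > 0"
  shows "eventually (\<lambda>N. real (card {m\<in>{1..N}. \<exists>p\<in>Q. p dvd q * m + r}) \<le> 3 * \<epsilon> * real N) sequentially"
proof -
  obtain z where z: "\<And>F. finite F \<Longrightarrow> F \<subseteq> {p\<in>Q. p > z} \<Longrightarrow> (\<Sum>p\<in>F. 1 / real p) \<le> \<epsilon> / (4 * real q)"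
    using thin_tail[OF Q(1), of "\<epsilon> / (4 * real q)"] q eps by auto
  show ?thesis
  proof (rule eventually_sequentiallyI[of "max 1 (max z r)"])
    fix N assume "N \<ge> max 1 (max z r)"
    hence N: "N \<ge> 1" "N \<ge> z" "N \<ge> r" by auto
    define P where "P = {p\<in>Q. \<not> p dvd q \<and> p \<le> 2 * q * N}"
    define P1 where "P1 = {p\<in>P. p \<le> N}"
    define P2 where "P2 = {p\<in>P. p > N}"
    have fin: "finite P" unfolding P_def by (rule finite_subset[of _ "{..2 * q * N}"]) auto
    have Psplit: "P = P1 \<union> P2" "P1 \<inter> P2 = {}" by (auto simp: P1_def P2_def)
    have finP: "finite P1" "finite P2" using fin by (auto simp: P1_def P2_def)
    have sub: "{m\<in>{1..N}. \<exists>p\<in>Q. p dvd q * m + r} \<subseteq> (\<Union>p\<in>P. {m\<in>{1..N}. p dvd q * m + r})"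
    proof
      fix m assume m: "m \<in> {m\<in>{1..N}. \<exists>p\<in>Q. p dvd q * m + r}"
      then obtain p where p: "p \<in> Q" "p dvd q * m + r" by auto
      have "\<not> p dvd q"
      proof
        assume pq: "p dvd q"
        hence "p dvd r" using p(2) by (simp add: dvd_add_right_iff)
        with pq q Q(2)[OF p(1)] show False by (meson coprime_common_divisor not_prime_unit)
      qed
      moreover have "p \<le> q * m + r" using p(2) m q by (intro dvd_imp_le) auto
      moreover have "q * m + r \<le> 2 * q * N" 
      proof -
        have "q * m \<le> q * N" using m by auto
        moreover have "r \<le> q * N" using N(3) q(1) order.trans[of r "1 * N" "q * N"] by simp
        ultimately show ?thesis by linarith
      qed
      ultimately show "m \<in> (\<Union>p\<in>P. {m\<in>{1..N}. p dvd q * m + r})" using p m by (auto simp: P_def)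
    qed
    have "real (card {m\<in>{1..N}. \<exists>p\<in>Q. p dvd q * m + r}) \<le> real (card (\<Union>p\<in>P. {m\<in>{1..N}. p dvd q * m + r}))"
      using sub fin by (intro of_nat_mono card_mono) auto
    also have "\<dots> \<le> real (\<Sum>p\<in>P. card {m\<in>{1..N}. p dvd q * m + r})"
      using fin by (intro of_nat_mono card_UN_le)
    also have "\<dots> \<le> (\<Sum>p\<in>P. real N / real p + 1)"
      unfolding of_nat_sum by (intro sum_mono card_dvd_progression_le) (auto simp: P_def Q)
    also have "\<dots> = (\<Sum>p\<in>P1. real N / real p + 1) + (\<Sum>p\<in>P2. real N / real p + 1)"
      using Psplit finP by (simp add: sum.union_disjoint)
    also have "(\<Sum>p\<in>P1. real N / real p + 1) \<le> (\<Sum>p\<in>P1. 2 * real N * (1 / real p))"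
    proof (rule sum_mono)
      fix p assume p: "p \<in> P1"
      hence "real p > 0" "real p \<le> real N" using Q(2)[of p] prime_gt_0_nat[of p] by (auto simp: P1_def P_def)
      thus "real N / real p + 1 \<le> 2 * real N * (1 / real p)" by (simp add: field_simps)
    qed
    also have "\<dots> = 2 * real N * (\<Sum>p\<in>P1. 1 / real p)" by (simp add: sum_distrib_left)
    also have "\<dots> \<le> 2 * real N * \<epsilon>"
    proof (intro mult_left_mono tail finP)
      show "P1 \<subseteq> {p\<in>Q. p > y}" using small by (force simp: P1_def P_def)
    qed auto
    also have "(\<Sum>p\<in>P2. real N / real p + 1) \<le> (\<Sum>p\<in>P2. (4 * real q * real N) * (1 / real p))"
    proof (rule sum_mono)
      fix p assume p: "p \<in> P2"
      have b: "real p \<le> real (2 * q * N)" using p unfolding of_nat_le_iff by (auto simp: P2_def P_def)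
      have "real p > real N" using p by (auto simp: P2_def)
      hence "real p > 0" "real N / real p \<le> 1" by (auto simp: field_simps)
      moreover from this have "1 \<le> real (2 * q * N) / real p" using b by (simp add: field_simps)
      moreover have "(4 * real q * real N) * (1 / real p) = 2 * (real (2 * q * N) / real p)" by simp
      ultimately show "real N / real p + 1 \<le> (4 * real q * real N) * (1 / real p)" by linarith
    qed
    also have "\<dots> = 4 * real q * real N * (\<Sum>p\<in>P2. 1 / real p)" by (simp add: sum_distrib_left)
    also have "\<dots> \<le> 4 * real q * real N * (\<epsilon> / (4 * real q))"
    proof (intro mult_left_mono z finP)
      show "P2 \<subseteq> {p\<in>Q. p > z}" using N by (auto simp: P2_def P_def)
    qed auto
    also have "\<dots> = real N * \<epsilon>" using q by simp
    finally show "real (card {m\<in>{1..N}. \<exists>p\<in>Q. p dvd q * m + r}) \<le> 3 * \<epsilon> * real N" by simp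
  qed
qed


text \<open>The number of prime divisors from \<open>B\<close> is almost always close to its mean
  \<open>L\<close>. Expanding the square, two distinct primes divide \<open>n\<close> together with
  frequency at most \<open>1 / (p q)\<close>, so only the diagonal \<open>t * L\<close> survives;
  the term with \<open>card B\<close> comes from the floors in the first moment.\<close>

lemma turan_kubilius:
  assumes B: "finite B" "\<And>p. p \<in> B \<Longrightarrow> prime p" and t: "t \<ge> 0"
  defines "L \<equiv> \<Sum>p\<in>B. 1 / real p"
  shows "(\<Sum>n\<in>nat_upto t. (real (card {p\<in>B. p dvd n}) - L)\<^sup>2) \<le> t * L + 2 * L * real (card B)"
proof -
  define w where "w = (\<lambda>n. \<Sum>p\<in>B. if p dvd n then 1 else 0 :: real)"
  have w: "real (card {p\<in>B. p dvd n}) = w n" for n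
    using B by (simp add: w_def sum.If_cases Int_def conj_commute)
  have cnt: "(\<Sum>n\<in>nat_upto t. if d dvd n then 1 else 0 :: real) = of_int \<lfloor>t / real d\<rfloor>" if d: "d > 0" for d
  proof -
    have "(\<Sum>n\<in>nat_upto t. if d dvd n then 1 else 0 :: real) = real (card {n\<in>nat_upto t. d dvd n})"
      by (simp add: sum.If_cases Int_def conj_commute)
    also have "{n\<in>nat_upto t. d dvd n} = (\<lambda>m. d * m) ` nat_upto (t / real d)"
      using d by (auto simp: nat_upto_def field_simps elim!: dvdE)
    also have "card \<dots> = card (nat_upto (t / real d))"
      using d by (intro card_image) (auto simp: inj_on_def)
    also have "real \<dots> = of_int \<lfloor>t / real d\<rfloor>" using t by (intro card_nat_upto) auto
    finally show ?thesis .
  qed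
  have p0: "p > 0" if "p \<in> B" for p using B(2)[OF that] prime_gt_0_nat by auto
  have L0: "L \<ge> 0" unfolding L_def by (intro sum_nonneg) auto
  have "(\<Sum>n\<in>nat_upto t. w n) = (\<Sum>p\<in>B. \<Sum>n\<in>nat_upto t. if p dvd n then 1 else 0)"
    unfolding w_def by (rule sum.swap)
  also have "\<dots> = (\<Sum>p\<in>B. of_int \<lfloor>t / real p\<rfloor>)" by (intro sum.cong cnt p0) auto
  also have "\<dots> \<ge> (\<Sum>p\<in>B. t / real p - 1)" by (intro sum_mono) linarith
  also have "(\<Sum>p\<in>B. t / real p - 1) = t * L - real (card B)" by (simp add: sum_subtractf L_def sum_distrib_left)
  finally have s1: "(\<Sum>n\<in>nat_upto t. w n) \<ge> t * L - real (card B)" .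
  have "(\<Sum>n\<in>nat_upto t. (w n)\<^sup>2) = 
        (\<Sum>n\<in>nat_upto t. \<Sum>p\<in>B. \<Sum>q\<in>B. (if p dvd n then 1 else 0) * (if q dvd n then 1 else 0))"
    unfolding w_def power2_eq_square sum_product ..
  also have "\<dots> = (\<Sum>p\<in>B. \<Sum>q\<in>B. \<Sum>n\<in>nat_upto t. (if p dvd n then 1 else 0) * (if q dvd n then 1 else 0))"
    by (subst sum.swap, rule sum.cong[OF refl], subst sum.swap, rule refl)
  also have "\<dots> \<le> (\<Sum>p\<in>B. \<Sum>q\<in>B. t * ((1 / real p) * (1 / real q)) + (if p = q then t / real p else 0))"
  proof (intro sum_mono)
    fix p q assume pq: "p \<in> B" "q \<in> B"
    define d where "d = (if p = q then p else p * q)"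
    have d0: "d > 0" using pq p0 by (auto simp: d_def)
    have "p dvd n \<and> q dvd n \<longleftrightarrow> d dvd n" for n
    proof (cases "p = q")
      case False
      hence "coprime p q" using pq B(2) primes_coprime by blast
      thus ?thesis using False divides_mult[of p n q] by (auto simp: d_def dest: dvd_mult_left dvd_mult_right)
    qed (auto simp: d_def)
    hence "(\<Sum>n\<in>nat_upto t. (if p dvd n then 1 else 0) * (if q dvd n then 1 else 0 :: real)) =
          (\<Sum>n\<in>nat_upto t. if d dvd n then 1 else 0)"
      by (intro sum.cong) (metis mult_1 mult_zero_left mult_zero_right)+
    also have "\<dots> = of_int \<lfloor>t / real d\<rfloor>" by (rule cnt[OF d0])
    also have "\<dots> \<le> t / real d" by linarith
    also have "\<dots> \<le> t * ((1 / real p) * (1 / real q)) + (if p = q then t / real p else 0)"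
      using t by (auto simp: d_def)
    finally show "(\<Sum>n\<in>nat_upto t. (if p dvd n then 1 else 0) * (if q dvd n then 1 else 0 :: real)) \<le>
      t * ((1 / real p) * (1 / real q)) + (if p = q then t / real p else 0)" .
  qed
  also have "\<dots> = t * (L * L) + t * L"
  proof -
    have "(\<Sum>p\<in>B. \<Sum>q\<in>B. t * ((1 / real p) * (1 / real q))) = t * (L * L)"
    proof -
      have "L * L = (\<Sum>p\<in>B. \<Sum>q\<in>B. (1 / real p) * (1 / real q))" unfolding L_def by (rule sum_product)
      thus ?thesis by (simp only: sum_distrib_left)
    qed
    moreover have "(\<Sum>p\<in>B. \<Sum>q\<in>B. if p = q then t / real p else 0) = t * L"
      using B(1) by (simp add: L_def sum_distrib_left)
    ultimately show ?thesis by (simp only: sum.distrib)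
  qed
  finally have s2: "(\<Sum>n\<in>nat_upto t. (w n)\<^sup>2) \<le> t * (L * L) + t * L" .
  have "(\<Sum>n\<in>nat_upto t. (w n - L)\<^sup>2) = (\<Sum>n\<in>nat_upto t. (w n)\<^sup>2) - 2 * L * (\<Sum>n\<in>nat_upto t. w n) + real (card (nat_upto t)) * (L * L)"
    by (simp add: power2_diff sum.distrib sum_subtractf sum_distrib_left power2_eq_square algebra_simps)
  also have "\<dots> \<le> (t * (L * L) + t * L) - 2 * L * (t * L - real (card B)) + t * (L * L)"
    using s1 s2 L0 t card_nat_upto_bounds[of t]
    by (intro add_mono diff_mono mult_left_mono mult_right_mono) auto
  also have "\<dots> = t * L + 2 * L * real (card B)" by (simp add: algebra_simps)
  finally show ?thesis by (simp add: w)
qed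

lemma turan_kubilius_L1:
  assumes B: "finite B" "\<And>p. p \<in> B \<Longrightarrow> prime p" and t: "t \<ge> 0"
  defines "L \<equiv> \<Sum>p\<in>B. 1 / real p"
  shows "(\<Sum>n\<in>nat_upto t. \<bar>real (card {p\<in>B. p dvd n}) - L\<bar>) \<le> sqrt (t * (t * L + 2 * L * real (card B)))"
proof (rule real_le_rsqrt)
  have L0: "L \<ge> 0" unfolding L_def by (intro sum_nonneg) auto
  have "(\<Sum>n\<in>nat_upto t. \<bar>real (card {p\<in>B. p dvd n}) - L\<bar>)\<^sup>2 \<le>
        (\<Sum>n\<in>nat_upto t. 1\<^sup>2) * (\<Sum>n\<in>nat_upto t. \<bar>real (card {p\<in>B. p dvd n}) - L\<bar>\<^sup>2)"
    using Cauchy_Schwarz_ineq_sum[of "\<lambda>_. 1" "\<lambda>n. \<bar>real (card {p\<in>B. p dvd n}) - L\<bar>" "nat_upto t"] by simp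
  also have "\<dots> = real (card (nat_upto t)) * (\<Sum>n\<in>nat_upto t. (real (card {p\<in>B. p dvd n}) - L)\<^sup>2)" by simp
  also have "\<dots> \<le> t * (t * L + 2 * L * real (card B))"
    unfolding L_def using card_nat_upto_bounds[of t] t
    by (intro mult_mono turan_kubilius B) (auto intro: sum_nonneg)
  finally show "(\<Sum>n\<in>nat_upto t. \<bar>real (card {p\<in>B. p dvd n}) - L\<bar>)\<^sup>2 \<le> t * (t * L + 2 * L * real (card B))" .
qed

section \<open>Dirichlet characters and the primes where they differ from 1\<close>

lemma dirichlet_character_period:
  assumes "dirichlet_character k chi"
  shows "chi (n + k * j) = chi n"
proof (induction j)
  case (Suc j)
  have "chi (n + k * Suc j) = chi ((n + k * j) + k)" by (simp add: add_ac)
  with Suc assms show ?case by (simp add: dirichlet_character_def)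
qed simp

lemma dirichlet_character_mod: "dirichlet_character k chi \<Longrightarrow> chi (n mod k) = chi n"
  using dirichlet_character_period[of k chi "n mod k" "n div k"] by simp

lemma dirichlet_character_cong: "dirichlet_character k chi \<Longrightarrow> [m = n] (mod k) \<Longrightarrow> chi m = chi n"
  using dirichlet_character_mod[of k chi m] dirichlet_character_mod[of k chi n] by (simp add: cong_def)

lemma dirichlet_character_mult: "dirichlet_character k chi \<Longrightarrow> chi (m * n) = chi m * chi n"
  by (simp add: dirichlet_character_def)

lemma dirichlet_character_1:
  assumes "dirichlet_character k chi"
  shows "chi 1 = 1"
proof -
  have "coprime (1::nat) k" by simp
  hence ne: "chi 1 \<noteq> 0" using assms unfolding dirichlet_character_def by blast
  have "chi 1 * chi 1 = chi (1 * 1)" by (rule dirichlet_character_mult[OF assms, symmetric])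
  also have "\<dots> = chi 1 * 1" by (simp only: mult_1_right)
  finally show ?thesis using mult_left_cancel[OF ne] by blast
qed

lemma dirichlet_character_power:
  assumes "dirichlet_character k chi"
  shows "chi (n ^ j) = chi n ^ j"
proof (induction j)
  case 0
  show ?case using dirichlet_character_1[OF assms] by simp
next
  case (Suc j)
  show ?case unfolding power_Suc dirichlet_character_mult[OF assms] Suc ..
qed

lemma finite_range_dirichlet_character:
  assumes "dirichlet_character k chi"
  shows "finite (range chi)"
proof (rule finite_subset[of _ "chi ` {..<k}"])
  show "range chi \<subseteq> chi ` {..<k}"
  proof
    fix z assume "z \<in> range chi"
    then obtain n where "z = chi n" by auto
    hence "z = chi (n mod k)" "n mod k < k"
      using assms dirichlet_character_mod[OF assms] by (auto simp: dirichlet_character_def)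
    thus "z \<in> chi ` {..<k}" by blast
  qed
qed auto

lemma norm_dirichlet_character:
  assumes "dirichlet_character k chi"
  shows "cmod (chi n) = (if coprime n k then 1 else 0)"
proof (cases "coprime n k")
  case True
  have k: "k > 0" using assms by (simp add: dirichlet_character_def)
  have "[n ^ totient k = 1] (mod k)" using True by (rule euler_theorem)
  hence "chi n ^ totient k = 1"
    using dirichlet_character_cong[OF assms] dirichlet_character_1[OF assms] dirichlet_character_power[OF assms] by metis
  hence "cmod (chi n) ^ totient k = 1" by (metis norm_one norm_power)
  hence "cmod (chi n) = 1" using k power_eq_imp_eq_base[of "cmod (chi n)" "totient k" 1] by simp
  thus ?thesis using True by simp
qed (use assms in \<open>auto simp: dirichlet_character_def\<close>)

lemma norm_dirichlet_character_le_1: "dirichlet_character k chi \<Longrightarrow> cmod (chi n) \<le> 1"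
  using norm_dirichlet_character[of k chi n] by simp

lemma dirichlet_character_cnj: "dirichlet_character k chi \<Longrightarrow> dirichlet_character k (\<lambda>n. cnj (chi n))"
  by (simp only: dirichlet_character_def complex_cnj_zero_iff complex_cnj_mult) blast

lemma dirichlet_character_principal:
  assumes "k > 0"
  shows "dirichlet_character k (principal_character k)"
proof -
  have "coprime (n + k) k \<longleftrightarrow> coprime n k" for n by (simp only: coprime_iff_gcd_eq_1 gcd_add1)
  thus ?thesis using assms unfolding dirichlet_character_def principal_character_def by simp
qed

lemma dirichlet_character_one: "dirichlet_character 1 (\<lambda>_. 1)"
  unfolding dirichlet_character_def by auto

lemma dirichlet_character_eq_1:
  assumes chi: "dirichlet_character k chi" and n: "n > 0" "\<And>p. prime p \<Longrightarrow> p dvd n \<Longrightarrow> chi p = 1"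
  shows "chi n = 1"
  using n
proof (induction n rule: prime_divisors_induct)
  case (unit n)
  thus ?case using dirichlet_character_1[OF chi] by simp
next
  case (factor p n)
  hence "chi n = 1" by auto
  thus ?case using factor chi by (auto simp: dirichlet_character_def)
qed simp

lemma finite_primes_not_coprime: "(k::nat) > 0 \<Longrightarrow> finite {p. prime p \<and> \<not> coprime p k}"
proof (rule finite_subset[of _ "{..k}"])
  assume k: "k > 0"
  show "{p. prime p \<and> \<not> coprime p k} \<subseteq> {..k}"
  proof
    fix p assume "p \<in> {p. prime p \<and> \<not> coprime p k}"
    hence "p dvd k" using prime_imp_coprime[of p k] by auto
    thus "p \<in> {..k}" using k by (auto dest: dvd_imp_le)
  qed
qed auto

text \<open>A sieve replaces non-vanishing of L-functions: were the exceptional set thin, some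
  number congruent to \<open>a\<close> modulo \<open>k\<close> with \<open>chi a \<noteq> 1\<close>
  would have only prime factors at which \<open>chi\<close> is 1, forcing
  \<open>chi a = 1\<close>.\<close>

lemma nonprincipal_not_thin:
  assumes chi: "dirichlet_character k chi" and np: "chi \<noteq> principal_character k"
  shows "\<not> thin {p. prime p \<and> chi p \<noteq> 1}"
proof
  define Q where "Q = {p. prime p \<and> chi p \<noteq> 1}"
  assume "thin {p. prime p \<and> chi p \<noteq> 1}"
  hence Q: "thin Q" by (simp add: Q_def)
  have k: "k > 0" using chi by (simp add: dirichlet_character_def)
  obtain a where a: "coprime a k" "chi a \<noteq> 1"
  proof -
    from np obtain n where n: "chi n \<noteq> principal_character k n" by blast
    hence "coprime n k" using chi by (auto simp: principal_character_def dirichlet_character_def)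
    with n that show ?thesis by (auto simp: principal_character_def)
  qed
  \<comment> \<open>With \<open>1/8\<close> the sieve removes at most \<open>3/8\<close> of the
    progression, so some member survives.\<close>
  obtain y where y: "\<And>F. finite F \<Longrightarrow> F \<subseteq> {p\<in>Q. p > y} \<Longrightarrow> (\<Sum>p\<in>F. 1 / real p) \<le> 1/8"
    using thin_tail[OF Q, of "1/8"] by auto
  define P where "P = \<Prod>{p\<in>Q. p \<le> y \<and> coprime p k}"
  have fin: "finite {p\<in>Q. p \<le> y \<and> coprime p k}" by (rule finite_subset[of _ "{..y}"]) auto
  have P: "coprime P k" unfolding P_def by (intro prod_coprime_left) auto
  have P0: "P > 0" unfolding P_def by (intro prod_pos) (auto simp: Q_def prime_gt_0_nat)
  \<comment> \<open>The first congruence fixes the value of \<open>chi\<close>; the second keeps the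
    whole progression free of the small exceptional primes coprime to \<open>k\<close>. Those
    dividing \<open>k\<close> are excluded by the first.\<close>
  obtain r0 where r0: "[r0 = a] (mod k)" "[r0 = 1] (mod P)"
    using binary_chinese_remainder_nat[of k P a 1] P by (auto simp: coprime_commute)
  define q where "q = k * P"
  have q0: "q > 0" using k P0 by (simp add: q_def)
  have ck: "coprime r0 k" using r0(1) a(1) cong_imp_coprime cong_sym by blast
  have cP: "coprime r0 P" using r0(2) cong_imp_coprime[of 1 r0 P] cong_sym by auto
  have cq: "coprime r0 q" using ck cP by (simp add: q_def)
  have "eventually (\<lambda>N. real (card {m\<in>{1..N}. \<exists>p\<in>Q. p dvd q * m + r0}) \<le> 3 * (1/8) * real N) sequentially"
  proof (rule progression_sieve[OF Q _ q0 cq _ y])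
    fix p assume p: "p \<in> Q" "p \<le> y"
    show "p dvd q"
    proof (cases "coprime p k")
      case True
      hence "p dvd P" unfolding P_def using p fin by (intro dvd_prodI[of _ _ "\<lambda>x. x"]) auto
      thus ?thesis by (simp add: q_def)
    next
      case False
      hence "p dvd k" using p prime_imp_coprime by (auto simp: Q_def)
      thus ?thesis by (simp add: q_def)
    qed
  qed (auto simp: Q_def)
  then obtain N0 where N0: "\<And>N. N \<ge> N0 \<Longrightarrow> real (card {m\<in>{1..N}. \<exists>p\<in>Q. p dvd q * m + r0}) \<le> 3 * (1/8) * real N"
    unfolding eventually_sequentially by blast
  define N where "N = max 1 N0"
  have "real (card {m\<in>{1..N}. \<exists>p\<in>Q. p dvd q * m + r0}) < real (card {1..N})"
    using N0[of N] by (simp add: N_def)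
  hence "{m\<in>{1..N}. \<exists>p\<in>Q. p dvd q * m + r0} \<noteq> {1..N}" by auto
  hence "\<exists>m\<in>{1..N}. \<forall>p\<in>Q. \<not> p dvd q * m + r0" by auto
  then obtain m where m: "m \<in> {1..N}" "\<And>p. p \<in> Q \<Longrightarrow> \<not> p dvd q * m + r0" by blast
  have "chi (q * m + r0) = 1"
  proof (rule dirichlet_character_eq_1[OF chi])
    show "q * m + r0 > 0" using m(1) q0 by simp
    show "chi p = 1" if "prime p" "p dvd q * m + r0" for p using m(2)[of p] that by (auto simp: Q_def)
  qed
  moreover have "chi (q * m + r0) = chi r0"
    using dirichlet_character_period[OF chi, of r0 "P * m"] by (simp add: q_def add_ac mult_ac)
  moreover have "chi r0 = chi a" using r0(1) by (rule dirichlet_character_cong[OF chi])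
  ultimately show False using a by simp
qed

subsection \<open>Periodic functions and characters\<close>

lemma periodic_nat_cong:
  fixes h :: "nat \<Rightarrow> 'b" and k :: nat
  assumes "\<And>n. h (n + k) = h n" "[m = n] (mod k)"
  shows "h m = h n"
proof -
  have "h (n + k * j) = h n" for n j :: nat
  proof (induction j)
    case (Suc j)
    have "h (n + k * Suc j) = h ((n + k * j) + k)" by (simp add: add_ac)
    with Suc assms(1) show ?case by simp
  qed simp
  from this[of "m mod k" "m div k"] this[of "n mod k" "n div k"] assms(2) show ?thesis
    by (simp add: cong_def)
qed

lemma sum_powers_root_of_unity:
  assumes "l < N" "N > 0"
  shows "(\<Sum>j<N. (cis (2 * pi / real N)) ^ (j * l)) = (if l = 0 then of_nat N else 0)"
proof (cases "l = 0")
  case False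
  define u where "u = cis (2 * pi * real l / real N)"
  have u: "cis (2 * pi / real N) ^ (j * l) = u ^ j" for j
    unfolding u_def Complex.DeMoivre by (simp add: mult_ac)
  have "u ^ N = 1" unfolding u_def Complex.DeMoivre using assms by simp
  moreover have "u \<noteq> 1"
  proof
    assume "u = 1"
    hence "cis (2 * pi * real l / real N) = cis (2 * pi * real 0 / real N)" by (simp add: u_def)
    moreover have "inj_on (\<lambda>k. cis (2 * pi * real k / real N)) {..<N}"
      using Complex.bij_betw_roots_unity[OF assms(2)] by (simp add: bij_betw_def)
    ultimately have "l = 0" using assms by (auto dest!: inj_onD[of _ _ l 0])
    with False show False by simp
  qed
  ultimately show ?thesis using False by (simp add: u geometric_sum)
qed simp

text \<open>
  The function is split successively into eigenvectors of the dilations \<open>n \<mapsto> s * n\<close>; a common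
  eigenvector of all of them is a multiple of a character.
\<close>

lemma periodic_characters_induct:
  fixes P :: "(nat \<Rightarrow> complex) \<Rightarrow> bool"
  assumes k: "k > 0"
    and char: "\<And>chi. dirichlet_character k chi \<Longrightarrow> P chi"
    and add: "\<And>g h. P g \<Longrightarrow> P h \<Longrightarrow> P (\<lambda>n. g n + h n)"
    and scale: "\<And>c g. P g \<Longrightarrow> P (\<lambda>n. c * g n)"
    and g: "\<And>n. g (n + k) = g n" "\<And>n. \<not> coprime n k \<Longrightarrow> g n = 0"
  shows "P g"
proof -
  define X where "X = {h :: nat \<Rightarrow> complex. (\<forall>n. h (n + k) = h n) \<and> (\<forall>n. \<not> coprime n k \<longrightarrow> h n = 0)}"
  define G where "G = {s. s < k \<and> coprime s k}"
  have zero: "P (\<lambda>_. 0)" using scale[OF char[OF dirichlet_character_principal[OF k]], of 0] by simp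
  have Xcong: "h m = h n" if "h \<in> X" "[m = n] (mod k)" for h m n
    using periodic_nat_cong[of h k m n] that by (auto simp: X_def)
  have full: "P h" if h: "h \<in> X" "\<And>s. s \<in> G \<Longrightarrow> \<exists>c. \<forall>n. h (s * n) = c * h n" for h
  proof -
    have ev: "\<exists>c. \<forall>n. h (m * n) = c * h n" if "coprime m k" for m
    proof -
      have "m mod k \<in> G" using k that by (simp add: G_def)
      moreover have "h (m * n) = h ((m mod k) * n)" for n
        by (rule Xcong[OF h(1)]) (simp add: cong_def mod_mult_left_eq)
      ultimately show ?thesis using h(2)[of "m mod k"] by simp
    qed
    \<comment> \<open>The eigenvalue of the dilation by \<open>m\<close> is read off at 1, so
      dividing by \<open>h 1\<close> makes \<open>h\<close> multiplicative.\<close>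
    have h1: "h m * h n = h 1 * h (m * n)" if m: "coprime m k" for m n
    proof -
      obtain c where c: "\<And>n. h (m * n) = c * h n" using ev[OF m] by blast
      show ?thesis using c[of 1] c[of n] by simp
    qed
    show "P h"
    proof (cases "h 1 = 0")
      case True
      have "h m = 0" for m
      proof (cases "coprime m k")
        case c: True
        obtain c where "\<And>n. h (m * n) = c * h n" using ev[OF c] by blast
        from this[of 1] True show ?thesis by simp
      qed (use h(1) in \<open>auto simp: X_def\<close>)
      hence "h = (\<lambda>_. 0)" by auto
      thus ?thesis using zero by simp
    next
      case False
      define chi where "chi = (\<lambda>n. inverse (h 1) * h n)"
      have "dirichlet_character k chi"
        unfolding dirichlet_character_def
      proof (intro conjI allI k)
        show "chi (n + k) = chi n" for n using h(1) by (simp add: X_def chi_def)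
        show "chi (m * n) = chi m * chi n" for m n
        proof (cases "coprime m k")
          case True
          thus ?thesis using h1[OF True, of n] False by (simp add: chi_def field_simps)
        next
          case nc: False
          hence "\<not> coprime (m * n) k" by simp
          with nc show ?thesis using h(1) by (simp add: chi_def X_def)
        qed
        show "chi n \<noteq> 0 \<longleftrightarrow> coprime n k" for n
        proof
          assume "chi n \<noteq> 0"
          thus "coprime n k" using h(1) by (auto simp: X_def chi_def)
        next
          assume n: "coprime n k"
          then obtain n' where "[n * n' = 1] (mod k)" using cong_solve_coprime_nat[of n k] by auto
          hence "h (n * n') = h 1" by (rule Xcong[OF h(1)])
          with h1[OF n, of n'] False show "chi n \<noteq> 0" by (auto simp: chi_def)
        qed
      qed
      hence "P (\<lambda>n. h 1 * chi n)" by (intro scale char)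
      thus ?thesis using False by (simp add: chi_def mult.assoc[symmetric])
    qed
  qed
  \<comment> \<open>\<open>T\<close> collects the dilations not yet diagonalised; the induction
    removes one at a time without disturbing the eigenvectors of the others.\<close>
  have main: "P h" if "finite T" "T \<subseteq> G" "h \<in> X" "\<And>s. s \<in> G - T \<Longrightarrow> \<exists>c. \<forall>n. h (s * n) = c * h n" for T h
    using that
  proof (induction T arbitrary: h rule: finite_induct)
    case empty
    thus ?case by (intro full) auto
  next
    case (insert s T)
    define N where "N = totient k"
    have N: "N > 0" using k by (simp add: N_def)
    have s: "coprime s k" using insert.prems by (auto simp: G_def)
    define u where "u = cis (2 * pi / real N)"
    have u0: "u \<noteq> 0" by (simp add: u_def)
    have uN: "u ^ N = 1" unfolding u_def Complex.DeMoivre using N by simp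
    have hN: "h (s ^ N * n) = h n" for n
    proof (rule Xcong[OF insert.prems(2)])
      have "[s ^ N * n = 1 * n] (mod k)" unfolding N_def by (intro cong_mult euler_theorem s cong_refl)
      thus "[s ^ N * n = n] (mod k)" by simp
    qed
    \<comment> \<open>Discrete Fourier projection onto the eigenspace of the dilation by
      \<open>s\<close> with eigenvalue \<open>inverse (u ^ j)\<close>. By Euler's theorem the
      dilation has order dividing \<open>N\<close>, so the projections sum to
      \<open>h\<close>.\<close>
    define pr where "pr = (\<lambda>j n. inverse (of_nat N) * (\<Sum>l<N. u ^ (j * l) * h (s ^ l * n)))"
    have prP: "P (pr j)" for j
    proof (rule insert.IH)
      show "T \<subseteq> G" using insert.prems by auto
      show "pr j \<in> X"
        unfolding X_def
      proof (intro CollectI conjI allI impI)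
        show "pr j (n + k) = pr j n" for n
        proof -
          have "h (s ^ l * (n + k)) = h (s ^ l * n)" for l
            by (rule Xcong[OF insert.prems(2)]) (simp add: cong_def distrib_left)
          thus ?thesis by (simp add: pr_def)
        qed
        show "pr j n = 0" if "\<not> coprime n k" for n
        proof -
          have "h (s ^ l * n) = 0" for l using insert.prems(2) that by (auto simp: X_def)
          thus ?thesis by (simp add: pr_def)
        qed
      qed
      fix s' assume s': "s' \<in> G - T"
      show "\<exists>c. \<forall>n. pr j (s' * n) = c * pr j n"
      proof (cases "s' = s")
        case False
        then obtain c where c: "\<And>n. h (s' * n) = c * h n" using insert.prems(3)[of s'] s' by auto
        have "h (s ^ l * (s' * n)) = c * h (s ^ l * n)" for l n
          using c[of "s ^ l * n"] by (simp add: mult_ac)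
        hence "pr j (s' * n) = c * pr j n" for n
          by (simp add: pr_def sum_distrib_left mult_ac)
        thus ?thesis by blast
      next
        case True
        have "u ^ j * pr j (s * n) = pr j n" for n
        proof -
          define f where "f = (\<lambda>l. u ^ (j * l) * h (s ^ l * n))"
          have "u ^ j * pr j (s * n) = inverse (of_nat N) * (\<Sum>l<N. f (Suc l))"
            by (simp add: pr_def f_def sum_distrib_left power_add mult_ac)
          also have "(\<Sum>l<N. f (Suc l)) = (\<Sum>l<N. f l)"
          proof -
            have "(\<Sum>l<Suc N. f l) = f 0 + (\<Sum>l<N. f (Suc l))" by (rule sum.lessThan_Suc_shift)
            moreover have "(\<Sum>l<Suc N. f l) = (\<Sum>l<N. f l) + f N" by simp
            moreover have "f N = f 0"
              using hN[of n] uN by (simp add: f_def mult.commute[of j] power_mult)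
            ultimately show ?thesis by simp
          qed
          finally show ?thesis by (simp add: pr_def f_def)
        qed
        hence "pr j (s * n) = inverse (u ^ j) * pr j n" for n using u0 by (simp add: field_simps)
        thus ?thesis using True by blast
      qed
    qed
    have "P (\<lambda>n. \<Sum>j<m. pr j n)" for m
    proof (induction m)
      case (Suc m)
      thus ?case using add[OF Suc prP[of m]] by simp
    qed (use zero in simp)
    moreover have "(\<Sum>j<N. pr j n) = h n" for n
    proof -
      have "(\<Sum>j<N. pr j n) = inverse (of_nat N) * (\<Sum>j<N. \<Sum>l<N. u ^ (j * l) * h (s ^ l * n))"
        by (simp add: pr_def sum_distrib_left)
      also have "(\<Sum>j<N. \<Sum>l<N. u ^ (j * l) * h (s ^ l * n)) = (\<Sum>l<N. (\<Sum>j<N. u ^ (j * l)) * h (s ^ l * n))"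
        unfolding sum_distrib_right by (rule sum.swap)
      also have "\<dots> = (\<Sum>l<N. if l = 0 then of_nat N * h n else 0)"
        unfolding u_def using N by (intro sum.cong) (auto simp: sum_powers_root_of_unity)
      also have "\<dots> = of_nat N * h n" using N by simp
      finally show ?thesis using N by simp
    qed
    hence "(\<lambda>n. \<Sum>j<N. pr j n) = h" by blast
    ultimately show ?case by metis
  qed
  show ?thesis
  proof (rule main[of G])
    show "finite G" by (rule finite_subset[of _ "{..<k}"]) (auto simp: G_def)
  qed (use g in \<open>auto simp: X_def\<close>)
qed

subsection \<open>Square-integrable functions\<close>

lemma L2_measurable [measurable_dest]: "F \<in> L2 M \<Longrightarrow> F \<in> borel_measurable M"
  by (simp add: L2_def)

lemma L2_integrable: "F \<in> L2 M \<Longrightarrow> integrable M (\<lambda>x. (cmod (F x))\<^sup>2)"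
  by (simp add: L2_def)

lemma L2_scale:
  assumes "F \<in> L2 M"
  shows "(\<lambda>x. c * F x) \<in> L2 M"
proof -
  have [measurable]: "F \<in> borel_measurable M" using assms by (simp add: L2_def)
  have "integrable M (\<lambda>x. (cmod c)\<^sup>2 * (cmod (F x))\<^sup>2)"
    using assms by (intro integrable_mult_right) (simp add: L2_def)
  thus ?thesis by (simp add: L2_def norm_mult power_mult_distrib)
qed

lemma L2_add:
  assumes "F \<in> L2 M" "G \<in> L2 M"
  shows "(\<lambda>x. F x + G x) \<in> L2 M"
proof -
  have m [measurable]: "F \<in> borel_measurable M" "G \<in> borel_measurable M" using assms by (auto simp: L2_def)
  have "integrable M (\<lambda>x. (cmod (F x + G x))\<^sup>2)"
  proof (rule Bochner_Integration.integrable_bound)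
    show "integrable M (\<lambda>x. 2 * (cmod (F x))\<^sup>2 + 2 * (cmod (G x))\<^sup>2)"
      using assms by (auto simp: L2_def)
    show "AE x in M. norm ((cmod (F x + G x))\<^sup>2) \<le> norm (2 * (cmod (F x))\<^sup>2 + 2 * (cmod (G x))\<^sup>2)"
    proof (rule AE_I2)
      fix x
      have "(cmod (F x + G x))\<^sup>2 \<le> (cmod (F x) + cmod (G x))\<^sup>2"
        by (intro power_mono norm_triangle_ineq) auto
      also have "\<dots> \<le> 2 * (cmod (F x))\<^sup>2 + 2 * (cmod (G x))\<^sup>2"
        using zero_le_power2[of "cmod (F x) - cmod (G x)"] by (simp add: power2_eq_square algebra_simps)
      finally show "norm ((cmod (F x + G x))\<^sup>2) \<le> norm (2 * (cmod (F x))\<^sup>2 + 2 * (cmod (G x))\<^sup>2)" by simp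
    qed
  qed auto
  thus ?thesis by (simp add: L2_def)
qed

lemma L2_diff: "F \<in> L2 M \<Longrightarrow> G \<in> L2 M \<Longrightarrow> (\<lambda>x. F x - G x) \<in> L2 M"
  using L2_add[of F M "\<lambda>x. (-1) * G x"] L2_scale[of G M "-1"] by simp

lemma L2_zero [simp]: "(\<lambda>x. 0) \<in> L2 M"
  by (simp add: L2_def)

lemma L2_sum:
  assumes "\<And>i. i \<in> I \<Longrightarrow> F i \<in> L2 M"
  shows "(\<lambda>x. \<Sum>i\<in>I. F i x) \<in> L2 M"
  using assms
proof (induction I rule: infinite_finite_induct)
  case (insert i I)
  thus ?case using L2_add[of "F i" M "\<lambda>x. \<Sum>j\<in>I. F j x"] by simp
qed simp_all

lemma (in finite_measure) L2_bounded:
  assumes "F \<in> borel_measurable M" "\<And>x. cmod (F x) \<le> B"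
  shows "F \<in> L2 M"
proof -
  have "integrable M (\<lambda>x. (cmod (F x))\<^sup>2)"
    using assms by (intro integrable_const_bound[of _ "B\<^sup>2"]) (auto intro!: power_mono)
  with assms show ?thesis by (simp add: L2_def)
qed

lemma L2_norm_nonneg [simp]: "L2_norm M F \<ge> 0"
  by (simp add: L2_norm_def)

lemma L2_norm_squared: "(L2_norm M F)\<^sup>2 = (\<integral>x. (cmod (F x))\<^sup>2 \<partial>M)"
  by (simp add: L2_norm_def)

lemma L2_norm_scale: "L2_norm M (\<lambda>x. c * F x) = cmod c * L2_norm M F"
  by (simp add: L2_norm_def norm_mult power_mult_distrib real_sqrt_mult)

lemma L2_norm_minus_commute: "L2_norm M (\<lambda>x. F x - G x) = L2_norm M (\<lambda>x. G x - F x)"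
  by (simp add: L2_norm_def norm_minus_commute)

lemma L2_norm_zero [simp]: "L2_norm M (\<lambda>x. 0) = 0"
  by (simp add: L2_norm_def)

lemma L2_norm_eq_0_iff:
  assumes "F \<in> L2 M"
  shows "L2_norm M F = 0 \<longleftrightarrow> (AE x in M. F x = 0)"
  unfolding L2_norm_def
  by (simp add: integral_nonneg_eq_0_iff_AE L2_integrable[OF assms])

text \<open>Obtained by integrating \<open>(u + v)^2 \<le> (a + b) * (u^2 / a + v^2 / b)\<close>
  with \<open>a\<close> and \<open>b\<close> near the two norms; the extra \<open>e\<close> keeps
  them positive.\<close>

lemma L2_norm_triangle:
  assumes "F \<in> L2 M" "G \<in> L2 M"
  shows "L2_norm M (\<lambda>x. F x + G x) \<le> L2_norm M F + L2_norm M G"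
proof (rule field_le_epsilon)
  fix e :: real assume e: "e > 0"
  define a where "a = L2_norm M F + e / 2"
  define b where "b = L2_norm M G + e / 2"
  have ab: "a > 0" "b > 0" using e by (auto simp: a_def b_def add_nonneg_pos)
  have pt: "(cmod (F x + G x))\<^sup>2 \<le> (a + b) * ((cmod (F x))\<^sup>2 / a + (cmod (G x))\<^sup>2 / b)" for x
  proof -
    define u v where "u = cmod (F x)" and "v = cmod (G x)"
    have "(cmod (F x + G x))\<^sup>2 \<le> (u + v)\<^sup>2"
      unfolding u_def v_def by (intro power_mono norm_triangle_ineq) auto
    also have "(a + b) * (u\<^sup>2 / a + v\<^sup>2 / b) - (u + v)\<^sup>2 = (b * u - a * v)\<^sup>2 / (a * b)"
      using ab by (simp add: power2_eq_square field_simps)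
    hence "(u + v)\<^sup>2 \<le> (a + b) * (u\<^sup>2 / a + v\<^sup>2 / b)" using ab
      by (smt (verit) divide_nonneg_pos mult_pos_pos zero_le_power2)
    finally show ?thesis by (simp add: u_def v_def)
  qed
  have "(L2_norm M (\<lambda>x. F x + G x))\<^sup>2 \<le> (\<integral>x. (a + b) * ((cmod (F x))\<^sup>2 / a + (cmod (G x))\<^sup>2 / b) \<partial>M)"
    unfolding L2_norm_squared using assms L2_add[OF assms] pt
    by (intro integral_mono) (auto simp: L2_integrable)
  also have "\<dots> = (a + b) * ((L2_norm M F)\<^sup>2 / a + (L2_norm M G)\<^sup>2 / b)"
    using assms by (simp add: L2_integrable L2_norm_squared)
  also have "\<dots> \<le> (a + b) * (a\<^sup>2 / a + b\<^sup>2 / b)"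
    using ab e by (intro mult_left_mono add_mono divide_right_mono power_mono) (auto simp: a_def b_def)
  also have "\<dots> = (a + b)\<^sup>2" using ab by (simp add: power2_eq_square)
  finally have "L2_norm M (\<lambda>x. F x + G x) \<le> a + b"
    by (rule power2_le_imp_le) (use ab in linarith)
  thus "L2_norm M (\<lambda>x. F x + G x) \<le> L2_norm M F + L2_norm M G + e" by (simp add: a_def b_def)
qed

lemma L2_norm_triangle_diff:
  assumes "F \<in> L2 M" "G \<in> L2 M"
  shows "L2_norm M (\<lambda>x. F x - G x) \<le> L2_norm M F + L2_norm M G"
  using L2_norm_triangle[OF assms(1) L2_scale[OF assms(2), of "-1"]] L2_norm_scale[of M "-1" G] by simp

lemma L2_norm_diff_triangle:
  assumes "F \<in> L2 M" "G \<in> L2 M" "H \<in> L2 M"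
  shows "L2_norm M (\<lambda>x. F x - H x) \<le> L2_norm M (\<lambda>x. F x - G x) + L2_norm M (\<lambda>x. G x - H x)"
  using L2_norm_triangle[OF L2_diff[OF assms(1,2)] L2_diff[OF assms(2,3)]] by simp

lemma L2_norm_reverse_triangle:
  assumes "F \<in> L2 M" "G \<in> L2 M"
  shows "L2_norm M F \<le> L2_norm M G + L2_norm M (\<lambda>x. F x - G x)"
  using L2_norm_triangle[OF assms(2) L2_diff[OF assms]] by simp

lemma L2_norm_sum_le:
  assumes "\<And>i. i \<in> I \<Longrightarrow> F i \<in> L2 M"
  shows "L2_norm M (\<lambda>x. \<Sum>i\<in>I. F i x) \<le> (\<Sum>i\<in>I. L2_norm M (F i))"
  using assms
proof (induction I rule: infinite_finite_induct)
  case (insert i I)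
  have "L2_norm M (\<lambda>x. \<Sum>j\<in>insert i I. F j x) = L2_norm M (\<lambda>x. F i x + (\<Sum>j\<in>I. F j x))"
    using insert by simp
  also have "\<dots> \<le> L2_norm M (F i) + L2_norm M (\<lambda>x. \<Sum>j\<in>I. F j x)"
    using insert by (intro L2_norm_triangle L2_sum) auto
  also have "\<dots> \<le> L2_norm M (F i) + (\<Sum>j\<in>I. L2_norm M (F j))" using insert by auto
  finally show ?case using insert by simp
qed auto

lemma L2_norm_parallelogram:
  assumes "F \<in> L2 M" "G \<in> L2 M"
  shows "(L2_norm M (\<lambda>x. F x + G x))\<^sup>2 + (L2_norm M (\<lambda>x. F x - G x))\<^sup>2 = 2 * (L2_norm M F)\<^sup>2 + 2 * (L2_norm M G)\<^sup>2"
proof -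
  have "(\<integral>x. (cmod (F x + G x))\<^sup>2 + (cmod (F x - G x))\<^sup>2 \<partial>M) = (\<integral>x. 2 * (cmod (F x))\<^sup>2 + 2 * (cmod (G x))\<^sup>2 \<partial>M)"
    unfolding cmod_power2 by (intro Bochner_Integration.integral_cong) (auto simp: power2_eq_square algebra_simps)
  thus ?thesis using L2_integrable[OF L2_add[OF assms]] L2_integrable[OF L2_diff[OF assms]] assms[THEN L2_integrable]
    by (simp add: L2_norm_squared)
qed

text \<open>A variance identity around an arbitrary centre \<open>G\<close>, with no normalisation
  of the weights; the last term corrects for a total mass other than 1. It turns a mean of almost
  maximal norm into closeness of most of its terms.\<close>

lemma L2_norm_variance:
  fixes w :: "'b \<Rightarrow> real"
  assumes fin: "finite I" and X: "\<And>i. i \<in> I \<Longrightarrow> X i \<in> L2 M" and G: "G \<in> L2 M"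
  defines "Y \<equiv> \<lambda>x. \<Sum>i\<in>I. of_real (w i) * X i x"
  shows "(\<Sum>i\<in>I. w i * (L2_norm M (\<lambda>x. X i x - G x))\<^sup>2) =
    (\<Sum>i\<in>I. w i * (L2_norm M (X i))\<^sup>2) + (L2_norm M (\<lambda>x. Y x - G x))\<^sup>2 - (L2_norm M Y)\<^sup>2
      + ((\<Sum>i\<in>I. w i) - 1) * (L2_norm M G)\<^sup>2"
proof -
  have Y: "Y \<in> L2 M" unfolding Y_def by (intro L2_sum L2_scale X)
  have pt: "(\<Sum>i\<in>I. w i * (cmod (X i x - G x))\<^sup>2) =
     (\<Sum>i\<in>I. w i * (cmod (X i x))\<^sup>2) + (cmod (Y x - G x))\<^sup>2 - (cmod (Y x))\<^sup>2 + ((\<Sum>i\<in>I. w i) - 1) * (cmod (G x))\<^sup>2" for x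
  proof -
    have ReY: "Re (Y x) = (\<Sum>i\<in>I. w i * Re (X i x))" "Im (Y x) = (\<Sum>i\<in>I. w i * Im (X i x))"
      by (simp_all add: Y_def)
    have "w i * (cmod (X i x - G x))\<^sup>2 = w i * (cmod (X i x))\<^sup>2 - 2 * Re (G x) * (w i * Re (X i x))
            - 2 * Im (G x) * (w i * Im (X i x)) + w i * (cmod (G x))\<^sup>2" for i
      unfolding cmod_power2 by (simp add: power2_eq_square algebra_simps)
    hence "(\<Sum>i\<in>I. w i * (cmod (X i x - G x))\<^sup>2) = (\<Sum>i\<in>I. w i * (cmod (X i x))\<^sup>2) - 2 * Re (G x) * Re (Y x)
            - 2 * Im (G x) * Im (Y x) + (\<Sum>i\<in>I. w i) * (cmod (G x))\<^sup>2"
      by (simp add: sum.distrib sum_subtractf ReY sum_distrib_left sum_distrib_right)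
    thus ?thesis unfolding cmod_power2 by (simp add: power2_eq_square algebra_simps)
  qed
  have "(\<Sum>i\<in>I. w i * (L2_norm M (\<lambda>x. X i x - G x))\<^sup>2) = (\<integral>x. (\<Sum>i\<in>I. w i * (cmod (X i x - G x))\<^sup>2) \<partial>M)"
    using L2_diff[OF X G] by (simp add: L2_norm_squared L2_integrable)
  also have "\<dots> = (\<integral>x. (\<Sum>i\<in>I. w i * (cmod (X i x))\<^sup>2) + (cmod (Y x - G x))\<^sup>2 - (cmod (Y x))\<^sup>2 + ((\<Sum>i\<in>I. w i) - 1) * (cmod (G x))\<^sup>2 \<partial>M)"
    by (simp only: pt)
  also have "\<dots> = (\<Sum>i\<in>I. w i * (L2_norm M (X i))\<^sup>2) + (L2_norm M (\<lambda>x. Y x - G x))\<^sup>2 - (L2_norm M Y)\<^sup>2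
      + ((\<Sum>i\<in>I. w i) - 1) * (L2_norm M G)\<^sup>2"
    using X G Y L2_integrable[OF L2_diff[OF Y G]] by (simp add: L2_norm_squared L2_integrable)
  finally show ?thesis .
qed

section \<open>Completeness and nearest points in the space of square-integrable functions\<close>

context prob_space
begin

lemma L2_integrable_1:
  assumes "F \<in> L2 M"
  shows "integrable M F"
proof (rule Bochner_Integration.integrable_bound)
  show "integrable M (\<lambda>x. 1 + (cmod (F x))\<^sup>2)" using assms by (auto simp: L2_def)
  show "AE x in M. norm (F x) \<le> norm (1 + (cmod (F x))\<^sup>2)"
  proof (rule AE_I2)
    fix x
    have "0 \<le> (cmod (F x) - 1)\<^sup>2" by simp
    hence "2 * cmod (F x) \<le> 1 + (cmod (F x))\<^sup>2" by (simp add: power2_eq_square algebra_simps)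
    hence "cmod (F x) \<le> 1 + (cmod (F x))\<^sup>2" using norm_ge_zero[of "F x"] by linarith
    thus "norm (F x) \<le> norm (1 + (cmod (F x))\<^sup>2)" by simp
  qed
qed (use assms in auto)

lemma L2_const: "(\<lambda>x. c) \<in> L2 M"
  by (simp add: L2_def)

lemma L2_norm_const: "L2_norm M (\<lambda>x. c) = cmod c"
  by (simp add: L2_norm_def prob_space)

lemma integral_norm_le_L2_norm:
  assumes "F \<in> L2 M"
  shows "(\<integral>x. cmod (F x) \<partial>M) \<le> L2_norm M F"
proof (rule field_le_epsilon)
  fix e :: real assume e: "e > 0"
  define a where "a = L2_norm M F + e"
  have a: "a > 0" using e by (simp add: a_def add_nonneg_pos)
  have "cmod (F x) \<le> a / 2 + (cmod (F x))\<^sup>2 / (2 * a)" for x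
  proof -
    have "0 \<le> (cmod (F x) - a)\<^sup>2" by simp
    thus ?thesis using a by (simp add: power2_eq_square field_simps)
  qed
  hence "(\<integral>x. cmod (F x) \<partial>M) \<le> (\<integral>x. a / 2 + (cmod (F x))\<^sup>2 / (2 * a) \<partial>M)"
    using assms L2_integrable_1[OF assms] by (intro integral_mono) (auto simp: L2_integrable)
  also have "\<dots> = a / 2 + (L2_norm M F)\<^sup>2 / (2 * a)"
    using assms by (simp add: L2_integrable L2_norm_squared prob_space)
  also have "\<dots> \<le> a / 2 + a\<^sup>2 / (2 * a)"
    using a e by (intro add_left_mono divide_right_mono power_mono) (auto simp: a_def)
  also have "\<dots> = a" using a by (simp add: power2_eq_square)
  finally show "(\<integral>x. cmod (F x) \<partial>M) \<le> L2_norm M F + e" by (simp add: a_def)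
qed

lemma norm_integral_le_L2_norm: "F \<in> L2 M \<Longrightarrow> cmod (\<integral>x. F x \<partial>M) \<le> L2_norm M F"
  using integral_norm_bound[of M F] integral_norm_le_L2_norm[of F] by linarith

text \<open>Riesz-Fischer: a subsequence with geometrically small increments converges almost
  everywhere, since the increments are summable in mean; Fatou's lemma then gives convergence in
  norm for the full sequence.\<close>

lemma L2_complete:
  assumes W: "\<And>n::nat. W n \<in> L2 M"
    and Cauchy: "\<And>e. e > 0 \<Longrightarrow> \<exists>N. \<forall>m\<ge>N. \<forall>n\<ge>N. L2_norm M (\<lambda>x. W m x - W n x) < e"
  obtains F where "F \<in> L2 M" "(\<lambda>n. L2_norm M (\<lambda>x. W n x - F x)) \<longlonglongrightarrow> 0"
proof -
  note [measurable] = L2_measurable[OF W]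
  have "\<forall>k. \<exists>N. \<forall>m\<ge>N. \<forall>n\<ge>N. L2_norm M (\<lambda>x. W m x - W n x) < (1/2) ^ k"
    using Cauchy by simp
  then obtain R where R: "\<And>k m n. m \<ge> R k \<Longrightarrow> n \<ge> R k \<Longrightarrow> L2_norm M (\<lambda>x. W m x - W n x) < (1/2) ^ k" by metis
  \<comment> \<open>Summing the thresholds makes the index sequence monotone while keeping it above
    each \<open>R k\<close>.\<close>
  define r where "r = (\<lambda>k. \<Sum>j\<le>k. R j)"
  have r1: "r k \<ge> R k" for k unfolding r_def by (intro member_le_sum) auto
  have r2: "r (Suc k) \<ge> r k" for k by (simp add: r_def)
  define D where "D = (\<lambda>k x. cmod (W (r (Suc k)) x - W (r k) x))"
  have [measurable]: "D k \<in> borel_measurable M" for k unfolding D_def by measurable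
  have DN: "(\<integral>\<^sup>+x. ennreal (D k x) \<partial>M) \<le> ennreal ((1/2) ^ k)" for k
  proof -
    have L: "(\<lambda>x. W (r (Suc k)) x - W (r k) x) \<in> L2 M" by (intro L2_diff W)
    have "integrable M (D k)" unfolding D_def by (intro integrable_norm L2_integrable_1 L)
    hence "(\<integral>\<^sup>+x. ennreal (D k x) \<partial>M) = ennreal (\<integral>x. D k x \<partial>M)"
      by (intro nn_integral_eq_integral) (auto simp: D_def)
    also have "(\<integral>x. D k x \<partial>M) \<le> L2_norm M (\<lambda>x. W (r (Suc k)) x - W (r k) x)"
      unfolding D_def by (rule integral_norm_le_L2_norm[OF L])
    also have "\<dots> \<le> (1/2) ^ k" using R[of k "r (Suc k)" "r k"] r1[of k] r2[of k] by simp
    finally show ?thesis by (simp add: ennreal_leI)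
  qed
  have "(\<integral>\<^sup>+x. (\<Sum>k. ennreal (D k x)) \<partial>M) = (\<Sum>k. \<integral>\<^sup>+x. ennreal (D k x) \<partial>M)"
    by (rule nn_integral_suminf) auto
  also have "\<dots> \<le> (\<Sum>k. ennreal ((1/2) ^ k))" by (intro suminf_le DN) auto
  also have "\<dots> = ennreal (\<Sum>k. (1/2) ^ k)" by (rule suminf_ennreal2) (auto intro: summable_geometric)
  finally have "(\<integral>\<^sup>+x. (\<Sum>k. ennreal (D k x)) \<partial>M) < \<infinity>" by (auto simp: le_less_trans)
  hence "AE x in M. (\<Sum>k. ennreal (D k x)) \<noteq> \<infinity>" by (intro nn_integral_PInf_AE) auto
  hence conv: "AE x in M. convergent (\<lambda>k. W (r k) x)"
  proof eventually_elim
    case (elim x)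
    hence "summable (\<lambda>k. D k x)" by (intro summable_suminf_not_top) (auto simp: D_def)
    hence "summable (\<lambda>k. W (r (Suc k)) x - W (r k) x)" unfolding D_def by (rule summable_norm_cancel)
    hence "convergent (\<lambda>n. \<Sum>k<n. W (r (Suc k)) x - W (r k) x)" by (simp add: summable_iff_convergent)
    hence "convergent (\<lambda>n. W (r n) x - W (r 0) x)" by (simp only: sum_lessThan_telescope[of "\<lambda>k. W (r k) x"])
    from convergent_add[OF this convergent_const[of "W (r 0) x"]] show ?case by simp
  qed
  define F where "F = (\<lambda>x. lim (\<lambda>k. W (r k) x))"
  have Fm [measurable]: "F \<in> borel_measurable M" unfolding F_def by (rule borel_measurable_lim_metric) auto
  have lim: "AE x in M. (\<lambda>k. W (r k) x) \<longlonglongrightarrow> F x"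
    using conv by eventually_elim (simp add: F_def convergent_LIMSEQ_iff)
  have key: "(\<integral>\<^sup>+x. ennreal ((cmod (W n x - F x))\<^sup>2) \<partial>M) \<le> ennreal (((1/2) ^ j)\<^sup>2)" if n: "n \<ge> R j" for n j
  proof -
    have "(\<integral>\<^sup>+x. ennreal ((cmod (W n x - F x))\<^sup>2) \<partial>M) = (\<integral>\<^sup>+x. liminf (\<lambda>k. ennreal ((cmod (W n x - W (r k) x))\<^sup>2)) \<partial>M)"
    proof (rule nn_integral_cong_AE)
      show "AE x in M. ennreal ((cmod (W n x - F x))\<^sup>2) = liminf (\<lambda>k. ennreal ((cmod (W n x - W (r k) x))\<^sup>2))"
        using lim
      proof eventually_elim
        case (elim x)
        have "(\<lambda>k. ennreal ((cmod (W n x - W (r k) x))\<^sup>2)) \<longlonglongrightarrow> ennreal ((cmod (W n x - F x))\<^sup>2)"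
          by (intro tendsto_ennrealI tendsto_power tendsto_norm tendsto_diff tendsto_const elim)
        thus ?case using lim_imp_Liminf[OF sequentially_bot] by metis
      qed
    qed
    also have "\<dots> \<le> liminf (\<lambda>k. \<integral>\<^sup>+x. ennreal ((cmod (W n x - W (r k) x))\<^sup>2) \<partial>M)"
      by (rule nn_integral_liminf) auto
    also have "\<dots> \<le> liminf (\<lambda>k. ennreal (((1/2) ^ j)\<^sup>2))"
    proof (rule Liminf_mono)
      have "\<forall>k\<ge>j. (\<integral>\<^sup>+x. ennreal ((cmod (W n x - W (r k) x))\<^sup>2) \<partial>M) \<le> ennreal (((1/2) ^ j)\<^sup>2)"
      proof (intro allI impI)
        fix k assume "k \<ge> j"
        hence "r j \<le> r k" using lift_Suc_mono_le[of r j k] r2 by blast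
        hence rk: "r k \<ge> R j" using r1[of j] by linarith
        have L: "(\<lambda>x. W n x - W (r k) x) \<in> L2 M" by (intro L2_diff W)
        have "(\<integral>\<^sup>+x. ennreal ((cmod (W n x - W (r k) x))\<^sup>2) \<partial>M) = ennreal ((L2_norm M (\<lambda>x. W n x - W (r k) x))\<^sup>2)"
          unfolding L2_norm_squared by (intro nn_integral_eq_integral L2_integrable L) auto
        also have "\<dots> \<le> ennreal (((1/2) ^ j)\<^sup>2)"
          using R[OF n rk] by (intro ennreal_leI power_mono) auto
        finally show "(\<integral>\<^sup>+x. ennreal ((cmod (W n x - W (r k) x))\<^sup>2) \<partial>M) \<le> ennreal (((1/2) ^ j)\<^sup>2)" .
      qed
      thus "\<forall>\<^sub>F k in sequentially. (\<integral>\<^sup>+x. ennreal ((cmod (W n x - W (r k) x))\<^sup>2) \<partial>M) \<le> ennreal (((1/2) ^ j)\<^sup>2)"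
        by (auto simp: eventually_sequentially)
    qed
    also have "\<dots> = ennreal (((1/2) ^ j)\<^sup>2)" by (simp add: Liminf_const)
    finally show ?thesis .
  qed
  have diffL: "(\<lambda>x. W n x - F x) \<in> L2 M" if "n \<ge> R 0" for n
  proof -
    have "integrable M (\<lambda>x. (cmod (W n x - F x))\<^sup>2)"
    proof (rule integrableI_bounded)
      have "(\<integral>\<^sup>+x. ennreal (norm ((cmod (W n x - F x))\<^sup>2)) \<partial>M) \<le> ennreal (((1/2) ^ 0)\<^sup>2)"
        using key[OF that] by simp
      thus "(\<integral>\<^sup>+x. ennreal (norm ((cmod (W n x - F x))\<^sup>2)) \<partial>M) < \<infinity>" by (auto simp: le_less_trans)
    qed auto
    thus ?thesis by (simp add: L2_def)
  qed
  have FL: "F \<in> L2 M" using L2_diff[OF W diffL[of "R 0"], of "R 0"] by simp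
  have small: "L2_norm M (\<lambda>x. W n x - F x) \<le> (1/2) ^ j" if "n \<ge> R j" for n j
  proof -
    have "ennreal ((L2_norm M (\<lambda>x. W n x - F x))\<^sup>2) = (\<integral>\<^sup>+x. ennreal ((cmod (W n x - F x))\<^sup>2) \<partial>M)"
      unfolding L2_norm_squared by (intro nn_integral_eq_integral[symmetric] L2_integrable L2_diff W FL) auto
    also have "\<dots> \<le> ennreal (((1/2) ^ j)\<^sup>2)" by (rule key[OF that])
    finally have "(L2_norm M (\<lambda>x. W n x - F x))\<^sup>2 \<le> ((1/2) ^ j)\<^sup>2" by (simp add: ennreal_le_iff)
    thus ?thesis by (rule power2_le_imp_le) auto
  qed
  have "(\<lambda>n. L2_norm M (\<lambda>x. W n x - F x)) \<longlonglongrightarrow> 0"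
  proof (rule LIMSEQ_I)
    fix e :: real assume "e > 0"
    then obtain j where "(1/2) ^ j < e" using real_arch_pow_inv[of e "1/2"] by auto
    thus "\<exists>N. \<forall>n\<ge>N. norm (L2_norm M (\<lambda>x. W n x - F x) - 0) < e"
      using small[of j] by (intro exI[of _ "R j"]) (auto intro: le_less_trans)
  qed
  with FL show ?thesis by (rule that)
qed

text \<open>A minimising sequence is Cauchy: midpoints lie in \<open>V\<close>, hence at distance at
  least \<open>d\<close> from \<open>F\<close>, and the parallelogram law bounds the mutual
  distances.\<close>

lemma L2_nearest_point:
  assumes sub: "V \<subseteq> L2 M" and zero: "(\<lambda>_. 0) \<in> V"
    and add: "\<And>F G. F \<in> V \<Longrightarrow> G \<in> V \<Longrightarrow> (\<lambda>x. F x + G x) \<in> V"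
    and scale: "\<And>c F. F \<in> V \<Longrightarrow> (\<lambda>x. c * F x) \<in> V"
    and closed: "\<And>W F. (\<And>n::nat. W n \<in> V) \<Longrightarrow> F \<in> L2 M \<Longrightarrow> (\<lambda>n. L2_norm M (\<lambda>x. W n x - F x)) \<longlonglongrightarrow> 0 \<Longrightarrow> F \<in> V"
    and F: "F \<in> L2 M"
  obtains W where "W \<in> V" "\<And>G. G \<in> V \<Longrightarrow> L2_norm M (\<lambda>x. F x - W x) \<le> L2_norm M (\<lambda>x. F x - G x)"
proof -
  define A where "A = (\<lambda>G. L2_norm M (\<lambda>x. F x - G x)) ` V"
  define d where "d = Inf A"
  have bdd: "bdd_below A" unfolding A_def by (rule bdd_belowI[of _ 0]) auto
  have ne: "A \<noteq> {}" using zero by (auto simp: A_def)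
  have dle: "d \<le> L2_norm M (\<lambda>x. F x - G x)" if "G \<in> V" for G
    unfolding d_def using that bdd by (intro cInf_lower) (auto simp: A_def)
  have d0: "d \<ge> 0" unfolding d_def using ne by (intro cInf_greatest) (auto simp: A_def)
  have "\<exists>G. G \<in> V \<and> L2_norm M (\<lambda>x. F x - G x) < d + inverse (real (Suc n))" for n
  proof -
    have "Inf A < d + inverse (real (Suc n))" by (simp add: d_def)
    then obtain a where "a \<in> A" "a < d + inverse (real (Suc n))" using cInf_less_iff[OF ne bdd] by blast
    thus ?thesis by (auto simp: A_def)
  qed
  then obtain W where W: "\<And>n. W n \<in> V" "\<And>n. L2_norm M (\<lambda>x. F x - W n x) < d + inverse (real (Suc n))" by metis
  have WL: "W n \<in> L2 M" for n using W sub by auto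
  have FW: "(\<lambda>x. F x - W n x) \<in> L2 M" for n by (intro L2_diff F WL)
  have lim: "(\<lambda>n. d + inverse (real (Suc n))) \<longlonglongrightarrow> d"
    using tendsto_add[OF tendsto_const LIMSEQ_inverse_real_of_nat, of d] by simp
  have est: "(L2_norm M (\<lambda>x. W m x - W n x))\<^sup>2 \<le> 2 * (d + inverse (real (Suc m)))\<^sup>2 + 2 * (d + inverse (real (Suc n)))\<^sup>2 - 4 * d\<^sup>2" for m n
  proof -
    have mid: "(\<lambda>x. (1/2) * (W m x + W n x)) \<in> V" by (intro scale add W)
    have "L2_norm M (\<lambda>x. (F x - W m x) + (F x - W n x)) = L2_norm M (\<lambda>x. 2 * (F x - (1/2) * (W m x + W n x)))"
      by (simp add: algebra_simps)
    also have "\<dots> = 2 * L2_norm M (\<lambda>x. F x - (1/2) * (W m x + W n x))" by (subst L2_norm_scale) simp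
    also have "\<dots> \<ge> 2 * d" using dle[OF mid] by simp
    finally have "(2 * d)\<^sup>2 \<le> (L2_norm M (\<lambda>x. (F x - W m x) + (F x - W n x)))\<^sup>2" using d0 by (intro power_mono) auto
    moreover have "L2_norm M (\<lambda>x. (F x - W m x) - (F x - W n x)) = L2_norm M (\<lambda>x. W m x - W n x)"
      using L2_norm_minus_commute[of M "W m" "W n"] by (simp add: algebra_simps)
    moreover have "(L2_norm M (\<lambda>x. F x - W i x))\<^sup>2 \<le> (d + inverse (real (Suc i)))\<^sup>2" for i
      using W(2)[of i] by (intro power_mono) auto
    from this[of m] this[of n] L2_norm_parallelogram[OF FW[of m] FW[of n]] calculation
    show ?thesis by (simp add: power_mult_distrib)
  qed
  have "\<exists>N. \<forall>m\<ge>N. \<forall>n\<ge>N. L2_norm M (\<lambda>x. W m x - W n x) < e" if e: "e > 0" for e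
  proof -
    have "(\<lambda>n. (d + inverse (real (Suc n)))\<^sup>2) \<longlonglongrightarrow> d\<^sup>2" by (intro tendsto_power lim)
    hence "eventually (\<lambda>n. (d + inverse (real (Suc n)))\<^sup>2 < d\<^sup>2 + e\<^sup>2 / 4) sequentially"
      using e by (intro order_tendstoD) auto
    then obtain N where N: "\<And>n. n \<ge> N \<Longrightarrow> (d + inverse (real (Suc n)))\<^sup>2 < d\<^sup>2 + e\<^sup>2 / 4"
      by (auto simp: eventually_sequentially)
    have "L2_norm M (\<lambda>x. W m x - W n x) < e" if "m \<ge> N" "n \<ge> N" for m n
    proof -
      have "(L2_norm M (\<lambda>x. W m x - W n x))\<^sup>2 < e\<^sup>2" using est[of m n] N[OF that(1)] N[OF that(2)] by linarith
      thus ?thesis using e by (intro power2_less_imp_less[of _ e]) auto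
    qed
    thus ?thesis by blast
  qed
  then obtain G where G: "G \<in> L2 M" "(\<lambda>n. L2_norm M (\<lambda>x. W n x - G x)) \<longlonglongrightarrow> 0"
    using L2_complete[of W] WL by blast
  have GV: "G \<in> V" using closed[of W G] W G by blast
  have "L2_norm M (\<lambda>x. F x - G x) \<le> d"
  proof (rule LIMSEQ_le_const)
    show "(\<lambda>n. (d + inverse (real (Suc n))) + L2_norm M (\<lambda>x. W n x - G x)) \<longlonglongrightarrow> d"
      using tendsto_add[OF lim G(2)] by simp
    have "L2_norm M (\<lambda>x. F x - G x) \<le> (d + inverse (real (Suc n))) + L2_norm M (\<lambda>x. W n x - G x)" for n
      using L2_norm_diff_triangle[OF F WL[of n] G(1)] W(2)[of n] by linarith
    thus "\<exists>N. \<forall>n\<ge>N. L2_norm M (\<lambda>x. F x - G x) \<le> (d + inverse (real (Suc n))) + L2_norm M (\<lambda>x. W n x - G x)" by blast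
  qed
  with GV dle show ?thesis by (intro that[of G]) (auto intro: order.trans)
qed

end

subsection \<open>Averages twisted by a character\<close>

context multiplicative_system
begin

lemma space_eq_UNIV [simp]: "space M = UNIV"
  using sets_eq_imp_space_eq[OF sets_eq_borel] by simp

lemma S_measurable: "n > 0 \<Longrightarrow> S n \<in> measurable M M"
  using invertible_mp[of n] by (simp add: invertible_measure_preserving_def)

lemma distr_S: "n > 0 \<Longrightarrow> distr M M (S n) = M"
  using invertible_mp[of n] by (simp add: invertible_measure_preserving_def)

lemma S_mult: "m > 0 \<Longrightarrow> n > 0 \<Longrightarrow> S (m * n) x = S m (S n x)"
  using multiplicative[of n m] by simp

text \<open>Multiplicativity only makes \<open>S 1\<close> idempotent; invertibility turns this into
  the identity.\<close>

lemma S_1: "S 1 x = x"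
proof -
  have "inj (S 1)" using invertible_mp[of 1] by (simp add: invertible_measure_preserving_def bij_betw_def)
  moreover have "S 1 (S 1 x) = S 1 x" using S_mult[of 1 1 x] by simp
  ultimately show ?thesis by (rule injD)
qed

lemma L2_comp_S:
  assumes "n > 0" "F \<in> L2 M"
  shows "(\<lambda>x. F (S n x)) \<in> L2 M"
proof -
  note [measurable] = S_measurable[OF assms(1)] L2_measurable[OF assms(2)]
  have "integrable (distr M M (S n)) (\<lambda>x. (cmod (F x))\<^sup>2)"
    using assms by (simp add: distr_S L2_integrable)
  hence "integrable M (\<lambda>x. (cmod (F (S n x)))\<^sup>2)" by (subst (asm) integrable_distr_eq) auto
  thus ?thesis by (simp add: L2_def)
qed

lemma integral_comp_S:
  fixes F :: "'a \<Rightarrow> 'b::{banach, second_countable_topology}"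
  assumes "n > 0" "F \<in> borel_measurable M"
  shows "(\<integral>x. F (S n x) \<partial>M) = (\<integral>x. F x \<partial>M)"
proof -
  have "(\<integral>x. F (S n x) \<partial>M) = (\<integral>x. F x \<partial>distr M M (S n))"
    by (rule integral_distr[symmetric, OF S_measurable[OF assms(1)] assms(2)])
  thus ?thesis by (simp only: distr_S[OF assms(1)])
qed

lemma L2_norm_comp_S:
  assumes "n > 0" "F \<in> L2 M"
  shows "L2_norm M (\<lambda>x. F (S n x)) = L2_norm M F"
proof -
  note [measurable] = L2_measurable[OF assms(2)]
  have "(\<integral>x. (cmod (F (S n x)))\<^sup>2 \<partial>M) = (\<integral>x. (cmod (F x))\<^sup>2 \<partial>M)"
    by (rule integral_comp_S[OF assms(1), of "\<lambda>x. (cmod (F x))\<^sup>2"]) measurable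
  thus ?thesis by (simp only: L2_norm_def)
qed

lemma AE_comp_S:
  assumes "n > 0" "AE x in M. P x" "Measurable.pred M P"
  shows "AE x in M. P (S n x)"
proof -
  have "AE x in distr M M (S n). P x" unfolding distr_S[OF assms(1)] by (rule assms(2))
  moreover have "{x \<in> space M. P x} \<in> sets M" using assms(3) by measurable
  ultimately show ?thesis by (subst (asm) AE_distr_iff[OF S_measurable[OF assms(1)]])
qed

end

lemma nat_upto_pos: "n \<in> nat_upto x \<Longrightarrow> 0 < n"
  by (simp add: nat_upto_def)

text \<open>Jump from \<open>i\<close> to the last index of the same colour at cost
  \<open>2 * e\<close>, then take one step at cost \<open>e\<close>; that colour never recurs. Each
  colour is paid for once, so the bound does not grow with the length \<open>m\<close>.\<close>

lemma chain_bound: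
  fixes D :: "nat \<Rightarrow> nat \<Rightarrow> real"
  assumes tri: "\<And>i j k. i \<le> m \<Longrightarrow> j \<le> m \<Longrightarrow> k \<le> m \<Longrightarrow> D i k \<le> D i j + D j k"
    and step: "\<And>i. i < m \<Longrightarrow> D i (Suc i) \<le> e"
    and col: "\<And>i j. i \<le> m \<Longrightarrow> j \<le> m \<Longrightarrow> c i = c j \<Longrightarrow> D i j \<le> 2 * e"
    and e: "e \<ge> 0" and i: "i \<le> m"
  shows "D i m \<le> 3 * e * real (card (c ` {i..m}))"
  using i
proof (induction "m - i" arbitrary: i rule: less_induct)
  case less
  define J where "J = {j\<in>{i..m}. c j = c i}"
  define j where "j = Max J"
  have J: "finite J" "i \<in> J" using less by (auto simp: J_def)
  hence "j \<in> J" unfolding j_def by (intro Max_in) auto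
  hence j: "j \<ge> i" "j \<le> m" "c j = c i" by (auto simp: J_def)
  have jmax: "j' \<le> j" if "j' \<in> J" for j' unfolding j_def using J that by simp
  have d1: "D i j \<le> 2 * e" using col[of i j] less.prems j by simp
  show ?case
  proof (cases "j = m")
    case True
    have "card (c ` {i..m}) \<ge> 1" using less.prems by (simp add: Suc_le_eq card_gt_0_iff)
    hence "3 * e * 1 \<le> 3 * e * real (card (c ` {i..m}))" using e by (intro mult_left_mono) auto
    thus ?thesis using d1 True e by simp
  next
    case False
    hence jm: "j < m" using j by simp
    have "D (Suc j) m \<le> 3 * e * real (card (c ` {Suc j..m}))" using jm j by (intro less.hyps) auto
    moreover have "D i m \<le> D i j + (D j (Suc j) + D (Suc j) m)"
      using tri[of i j m] tri[of j "Suc j" m] jm j less.prems by simp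
    moreover have "D j (Suc j) \<le> e" using step jm by simp
    moreover have "real (card (c ` {Suc j..m})) + 1 \<le> real (card (c ` {i..m}))"
    proof -
      have "c i \<notin> c ` {Suc j..m}"
      proof
        assume "c i \<in> c ` {Suc j..m}"
        then obtain l where "l \<in> {Suc j..m}" "c l = c i" by auto
        with jmax[of l] j show False by (auto simp: J_def)
      qed
      hence "card (insert (c i) (c ` {Suc j..m})) = card (c ` {Suc j..m}) + 1" by simp
      moreover have "insert (c i) (c ` {Suc j..m}) \<subseteq> c ` {i..m}" using j less.prems by auto
      hence "card (insert (c i) (c ` {Suc j..m})) \<le> card (c ` {i..m})" by (intro card_mono) auto
      ultimately show ?thesis by simp
    qed
    hence "3 * e * (real (card (c ` {Suc j..m})) + 1) \<le> 3 * e * real (card (c ` {i..m}))"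
      using e by (intro mult_left_mono) auto
    ultimately show ?thesis using d1 by (simp add: algebra_simps)
  qed
qed

locale twisted_system = multiplicative_system M S
  for M :: "'a::metric_space measure" and S :: "nat \<Rightarrow> 'a \<Rightarrow> 'a" +
  fixes k :: nat and chi :: "nat \<Rightarrow> complex"
  assumes chi: "dirichlet_character k chi"
begin

definition V :: "nat \<Rightarrow> ('a \<Rightarrow> complex) \<Rightarrow> 'a \<Rightarrow> complex" where
  "V n F = (\<lambda>x. chi n * F (S n x))"

definition Z :: "('a \<Rightarrow> complex) \<Rightarrow> real \<Rightarrow> 'a \<Rightarrow> complex" where
  "Z F t = (\<lambda>x. \<Sum>n\<in>nat_upto t. V n F x)"

definition A :: "('a \<Rightarrow> complex) \<Rightarrow> real \<Rightarrow> 'a \<Rightarrow> complex" where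
  "A F t = (\<lambda>x. of_real (1 / t) * Z F t x)"

lemma V_L2: "n > 0 \<Longrightarrow> F \<in> L2 M \<Longrightarrow> V n F \<in> L2 M"
  unfolding V_def by (intro L2_scale L2_comp_S)

lemma V_norm_eq: "n > 0 \<Longrightarrow> F \<in> L2 M \<Longrightarrow> L2_norm M (V n F) = cmod (chi n) * L2_norm M F"
  unfolding V_def by (simp add: L2_norm_scale L2_norm_comp_S)

lemma V_norm: "n > 0 \<Longrightarrow> F \<in> L2 M \<Longrightarrow> chi n \<noteq> 0 \<Longrightarrow> L2_norm M (V n F) = L2_norm M F"
  using norm_dirichlet_character[OF chi, of n] V_norm_eq[of n F] by (cases "coprime n k") simp_all

lemma V_norm_le: "n > 0 \<Longrightarrow> F \<in> L2 M \<Longrightarrow> L2_norm M (V n F) \<le> L2_norm M F"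
  using norm_dirichlet_character_le_1[OF chi, of n] by (simp add: V_norm_eq mult_left_le_one_le)

lemma V_mult: "m > 0 \<Longrightarrow> n > 0 \<Longrightarrow> V (m * n) F = V m (V n F)"
proof
  fix x assume mn: "m > 0" "n > 0"
  have "S (m * n) x = S n (S m x)" unfolding mult.commute[of m n] by (rule S_mult[OF mn(2,1)])
  thus "V (m * n) F x = V m (V n F) x"
    unfolding V_def dirichlet_character_mult[OF chi, of m n] by (simp only: mult.assoc)
qed

lemma V_commute: "m > 0 \<Longrightarrow> n > 0 \<Longrightarrow> V m (V n F) = V n (V m F)"
  unfolding V_mult[symmetric] by (simp only: mult.commute)

lemma V_scale: "V n (\<lambda>x. c * F x) = (\<lambda>x. c * V n F x)"
  by (simp add: V_def mult_ac)

lemma V_diff: "V n (\<lambda>x. F x - G x) = (\<lambda>x. V n F x - V n G x)"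
  by (simp add: V_def algebra_simps)

lemma V_sum: "V n (\<lambda>x. \<Sum>i\<in>I. F i x) = (\<lambda>x. \<Sum>i\<in>I. V n (F i) x)"
  by (simp add: V_def sum_distrib_left)

lemma Z_L2: "F \<in> L2 M \<Longrightarrow> Z F t \<in> L2 M"
  unfolding Z_def by (rule L2_sum, rule V_L2[OF nat_upto_pos])

lemma A_L2: "F \<in> L2 M \<Longrightarrow> A F t \<in> L2 M"
  unfolding A_def by (intro L2_scale Z_L2)

lemma weighted_sum_norm_le:
  assumes "F \<in> L2 M" "finite I" "\<And>n. n \<in> I \<Longrightarrow> n > 0"
  shows "L2_norm M (\<lambda>x. \<Sum>n\<in>I. of_real (w n) * V n F x) \<le> (\<Sum>n\<in>I. \<bar>w n\<bar>) * L2_norm M F"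
proof -
  have VL: "V n F \<in> L2 M" if "n \<in> I" for n by (rule V_L2[OF assms(3)[OF that] assms(1)])
  have "L2_norm M (\<lambda>x. \<Sum>n\<in>I. of_real (w n) * V n F x) \<le> (\<Sum>n\<in>I. L2_norm M (\<lambda>x. of_real (w n) * V n F x))"
    by (rule L2_norm_sum_le) (rule L2_scale, rule VL)
  also have "\<dots> \<le> (\<Sum>n\<in>I. \<bar>w n\<bar> * L2_norm M F)"
  proof (rule sum_mono)
    fix n assume n: "n \<in> I"
    have "\<bar>w n\<bar> * L2_norm M (V n F) \<le> \<bar>w n\<bar> * L2_norm M F"
      by (rule mult_left_mono[OF V_norm_le[OF assms(3)[OF n] assms(1)] abs_ge_zero])
    thus "L2_norm M (\<lambda>x. of_real (w n) * V n F x) \<le> \<bar>w n\<bar> * L2_norm M F"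
      by (simp only: L2_norm_scale norm_of_real real_norm_def)
  qed
  finally show ?thesis by (simp only: sum_distrib_right)
qed

lemma A_norm_le:
  assumes "F \<in> L2 M" "t > 0"
  shows "L2_norm M (A F t) \<le> L2_norm M F"
proof -
  have 1: "L2_norm M (A F t) = (1 / t) * L2_norm M (Z F t)"
    unfolding A_def using assms by (subst L2_norm_scale) (simp add: norm_divide)
  have "L2_norm M (Z F t) \<le> (\<Sum>n\<in>nat_upto t. \<bar>1\<bar>) * L2_norm M F"
    using weighted_sum_norm_le[OF assms(1) finite_nat_upto nat_upto_pos, where w = "\<lambda>_. 1"]
    by (simp only: Z_def of_real_1 mult_1)
  also have "\<dots> \<le> t * L2_norm M F" using card_nat_upto_bounds[of t] assms by (intro mult_right_mono) auto
  finally have "(1 / t) * L2_norm M (Z F t) \<le> (1 / t) * (t * L2_norm M F)"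
    using assms by (intro mult_left_mono) auto
  thus ?thesis unfolding 1 using assms by simp
qed

text \<open>For \<open>s \<le> t\<close> the coefficients differ by \<open>1/s - 1/t\<close> up to
  \<open>s\<close> and by \<open>1/t\<close> beyond it, in total about
  \<open>2 * (1 - s / t)\<close>, and \<open>1 - s / t \<le> ln t - ln s\<close>. The term
  \<open>1 / B\<close> is the rounding error in counting integers.\<close>

lemma A_close:
  assumes F: "F \<in> L2 M" and B: "B > 0" "s \<ge> B" "t \<ge> B" and close: "\<bar>ln s - ln t\<bar> \<le> \<theta>"
  shows "L2_norm M (\<lambda>x. A F s x - A F t x) \<le> (2 * \<theta> + 1 / B) * L2_norm M F"
proof -
  have main: "L2_norm M (\<lambda>x. A F t x - A F s x) \<le> (2 * \<theta> + 1 / B) * L2_norm M F"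
    if st: "s \<ge> B" "t \<ge> s" "\<bar>ln s - ln t\<bar> \<le> \<theta>" for s t
  proof -
    have pos: "s > 0" "t > 0" using st B by auto
    have sub: "nat_upto s \<subseteq> nat_upto t" using st by (intro nat_upto_mono) auto
    define w where "w = (\<lambda>n. if n \<in> nat_upto s then 1 / t - 1 / s else 1 / t)"
    have "(\<lambda>x. A F t x - A F s x) = (\<lambda>x. \<Sum>n\<in>nat_upto t. of_real (w n) * V n F x)"
    proof
      fix x
      have "A F s x = (\<Sum>n\<in>nat_upto t. of_real (if n \<in> nat_upto s then 1 / s else 0) * V n F x)"
        unfolding A_def Z_def sum_distrib_left using sub by (intro sum.mono_neutral_cong_left) auto
      thus "A F t x - A F s x = (\<Sum>n\<in>nat_upto t. of_real (w n) * V n F x)"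
        unfolding A_def[of F t] Z_def sum_distrib_left
        by (simp only: sum_subtractf[symmetric], intro sum.cong) (auto simp: w_def algebra_simps)
    qed
    hence "L2_norm M (\<lambda>x. A F t x - A F s x) \<le> (\<Sum>n\<in>nat_upto t. \<bar>w n\<bar>) * L2_norm M F"
      using weighted_sum_norm_le[OF F finite_nat_upto nat_upto_pos, where w = w] by (simp only:)
    also have "(\<Sum>n\<in>nat_upto t. \<bar>w n\<bar>) \<le> 2 * \<theta> + 1 / B"
    proof -
      have "(\<Sum>n\<in>nat_upto t. \<bar>w n\<bar>) = (\<Sum>n\<in>nat_upto s. \<bar>w n\<bar>) + (\<Sum>n\<in>nat_upto t - nat_upto s. \<bar>w n\<bar>)"
        using sub by (subst sum.subset_diff[of "nat_upto s"]) auto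
      also have "(\<Sum>n\<in>nat_upto s. \<bar>w n\<bar>) = real (card (nat_upto s)) * (1 / s - 1 / t)"
        using pos st by (simp add: w_def abs_if field_simps)
      also have "(\<Sum>n\<in>nat_upto t - nat_upto s. \<bar>w n\<bar>) = (real (card (nat_upto t)) - real (card (nat_upto s))) * (1 / t)"
        using pos sub by (simp add: w_def card_Diff_subset card_mono of_nat_diff)
      also have "real (card (nat_upto s)) * (1 / s - 1 / t) \<le> s * (1 / s - 1 / t)"
        using card_nat_upto_bounds[of s] pos st by (intro mult_right_mono) (auto simp: field_simps)
      also have "(real (card (nat_upto t)) - real (card (nat_upto s))) * (1 / t) \<le> (t - (s - 1)) * (1 / t)"
        using card_nat_upto_bounds[of s] card_nat_upto_bounds[of t] pos by (intro mult_right_mono) auto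
      also have "s * (1 / s - 1 / t) + (t - (s - 1)) * (1 / t) = 2 * (1 - s / t) + 1 / t"
        using pos by (simp add: field_simps)
      also have "1 - s / t \<le> \<theta>"
      proof -
        have "ln (t / s) \<le> \<theta>" using st pos by (simp add: ln_div)
        moreover have "ln (s / t) \<le> s / t - 1" using pos by (intro ln_le_minus_one) auto
        moreover have "1 - s / t \<le> ln t - ln s"
          using pos ln_le_minus_one[of "s / t"] by (simp add: ln_div)
        ultimately show ?thesis using pos by (simp add: ln_div)
      qed
      also have "1 / t \<le> 1 / B" using B st by (intro divide_left_mono) auto
      finally show ?thesis by simp
    qed
    finally show ?thesis by (simp add: mult_right_mono)
  qed
  show ?thesis
  proof (cases "s \<le> t")
    case True
    thus ?thesis using main[of s t] B close by (subst L2_norm_minus_commute) auto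
  next
    case False
    thus ?thesis using main[of t s] B close by auto
  qed
qed

lemma dilation_sum:
  assumes "d > 0"
  shows "V d (Z F t) = (\<lambda>x. \<Sum>m\<in>nat_upto t. V (d * m) F x)"
proof -
  have "V d (Z F t) = (\<lambda>x. \<Sum>m\<in>nat_upto t. V d (V m F) x)" unfolding Z_def by (rule V_sum)
  also have "\<dots> = (\<lambda>x. \<Sum>m\<in>nat_upto t. V (d * m) F x)"
    using assms by (intro ext sum.cong) (auto simp: V_mult nat_upto_def)
  finally show ?thesis .
qed

lemma convolution_sum:
  "(\<Sum>n\<in>nat_upto t. of_real (\<Sum>d | d dvd n. g d) * V n F x) =
   (\<Sum>d\<in>nat_upto t. of_real (g d) * V d (Z F (t / real d)) x)"
proof -
  have "(\<Sum>n\<in>nat_upto t. of_real (\<Sum>d | d dvd n. g d) * V n F x) =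
        (\<Sum>n\<in>nat_upto t. \<Sum>d | d dvd n. of_real (g d) * V (d * (n div d)) F x)"
    by (intro sum.cong) (auto simp: sum_distrib_right)
  also have "\<dots> = (\<Sum>d\<in>nat_upto t. \<Sum>m\<in>nat_upto (t / real d). of_real (g d) * V (d * m) F x)"
    by (rule sum_divisors_nat_upto)
  also have "\<dots> = (\<Sum>d\<in>nat_upto t. of_real (g d) * V d (Z F (t / real d)) x)"
    by (intro sum.cong) (auto simp: dilation_sum nat_upto_def[of t] sum_distrib_left)
  finally show ?thesis .
qed

text \<open>Up to \<open>O(1 / ln x)\<close>, \<open>A F x\<close> is the mean \<open>Y\<close> of
  the vectors \<open>X d\<close> with weights \<open>w d\<close> of total mass close to 1. Nearly
  all \<open>X d\<close> have norm at most \<open>L + \<epsilon>\<close> while the mean has norm at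
  least about \<open>L - \<epsilon>\<close>, so \<open>L2_norm_variance\<close> forces a small
  spread.\<close>

lemma convexity:
  fixes L \<eta> :: real
  assumes F: "F \<in> L2 M" and L: "L \<ge> 0" and \<eta>: "\<eta> > 0"
    and up: "\<And>\<epsilon>. \<epsilon> > 0 \<Longrightarrow> eventually (\<lambda>t. L2_norm M (A F t) \<le> L + \<epsilon>) at_top"
  obtains X0 \<epsilon> where "\<epsilon> > 0" "\<And>x. x \<ge> X0 \<Longrightarrow> L2_norm M (A F x) \<ge> L - \<epsilon> \<Longrightarrow>
     (\<Sum>d\<in>nat_upto x. \<Lambda>\<^sub>2 d / real d * (L2_norm M (\<lambda>y. V d (A F (x / real d)) y - A F x y))\<^sup>2) \<le> \<eta> * (ln x)\<^sup>2"
proof -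
  define K where "K = L2_norm M F"
  have K0: "K \<ge> 0" by (simp add: K_def)
  \<comment> \<open>Half of \<open>\<eta>\<close> is reserved for the norm gap, which the final
    computation finds to be \<open>\<epsilon> * (4 * L + \<epsilon>)\<close>.\<close>
  define \<epsilon> where "\<epsilon> = min 1 (\<eta> / (2 * (4 * L + 1)))"
  have eps: "\<epsilon> > 0" "\<epsilon> \<le> 1" "\<epsilon> * (4 * L + 1) \<le> \<eta> / 2"
  proof -
    have "\<epsilon> * (4 * L + 1) \<le> \<eta> / (2 * (4 * L + 1)) * (4 * L + 1)"
      using L by (intro mult_right_mono) (auto simp: \<epsilon>_def)
    also have "\<dots> = \<eta> / 2" using L by (simp add: field_simps)
    finally show "\<epsilon> * (4 * L + 1) \<le> \<eta> / 2" .
  qed (use L \<eta> in \<open>auto simp: \<epsilon>_def\<close>)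
  obtain T0 where T0: "\<And>t. t \<ge> T0 \<Longrightarrow> L2_norm M (A F t) \<le> L + \<epsilon>"
    using up[OF eps(1)] by (auto simp: eventually_at_top_linorder)
  define T where "T = max T0 1"
  have T: "T \<ge> 1" "\<And>t. t \<ge> T \<Longrightarrow> L2_norm M (A F t) \<le> L + \<epsilon>" using T0 by (auto simp: T_def)
  obtain C1 where C1: "C1 \<ge> 0" "\<And>x. x \<ge> 1 \<Longrightarrow> \<bar>(\<Sum>n\<in>nat_upto x. \<Lambda>\<^sub>2 n) - 2 * x * ln x\<bar> \<le> C1 * x"
    using sum_Lam2_bounds by blast
  obtain C2 where C2: "C2 \<ge> 0" "\<And>x. x \<ge> 1 \<Longrightarrow> \<bar>(\<Sum>d\<in>nat_upto x. \<Lambda>\<^sub>2 d / real d) - (ln x)\<^sup>2\<bar> \<le> C2 + 11 * ln x"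
    using sum_Lam2_over_bounds by blast
  \<comment> \<open>The five summands are the errors of order \<open>1 / ln x\<close>: total mass of
    the weights, scales below \<open>T\<close>, distance from \<open>Y\<close> to
    \<open>A F x\<close> squared, loss in the norm of \<open>Y\<close>, and mass again at the
    centre. The threshold \<open>exp (2 * C / \<eta>)\<close> makes their sum at most
    \<open>\<eta> / 2\<close>.\<close>
  define C where "C = (C2 + 11) * (L + 1)\<^sup>2 + K\<^sup>2 * T * (2 + C1) + 64 * K\<^sup>2 + 16 * K\<^sup>2 + (C2 + 11) * K\<^sup>2"
  have C0: "C \<ge> 0" using C1 C2 T by (simp add: C_def)
  show ?thesis
  proof (rule that[OF eps(1)])
    fix x assume x: "x \<ge> max (exp 1) (exp (2 * C / \<eta>))" and lo: "L2_norm M (A F x) \<ge> L - \<epsilon>"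
    have x1: "x \<ge> exp 1" "x > 0" "x \<ge> 1" using x exp_ge_add_one_self[of 1] by (auto intro: less_le_trans[of _ "exp 1"])
    have l1: "ln x \<ge> 1" using x1 by (simp add: ln_ge_iff)
    have lC: "ln x \<ge> 2 * C / \<eta>" using x x1 by (simp add: ln_ge_iff)
    define l where "l = ln x"
    define w where "w = (\<lambda>d. \<Lambda>\<^sub>2 d / real d / l\<^sup>2)"
    define W where "W = (\<Sum>d\<in>nat_upto x. w d)"
    define X where "X = (\<lambda>d. V d (A F (x / real d)))"
    define G where "G = A F x"
    define Y where "Y = (\<lambda>y. \<Sum>d\<in>nat_upto x. of_real (w d) * X d y)"
    have l: "l \<ge> 1" using l1 by (simp add: l_def)
    have w0: "w d \<ge> 0" for d by (simp add: w_def Lam2_nonneg)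
    have dpos: "d > 0" if "d \<in> nat_upto x" for d using that by (simp add: nat_upto_def)
    have XL: "X d \<in> L2 M" if "d \<in> nat_upto x" for d
      unfolding X_def using dpos[OF that] by (intro V_L2 A_L2 F)
    have GL: "G \<in> L2 M" unfolding G_def by (rule A_L2[OF F])
    have YL: "Y \<in> L2 M" unfolding Y_def by (intro L2_sum L2_scale XL)
    have GK: "L2_norm M G \<le> K" unfolding G_def K_def by (rule A_norm_le[OF F x1(2)])
    have W1: "\<bar>W - 1\<bar> \<le> (C2 + 11) / l"
    proof -
      have "W = (\<Sum>d\<in>nat_upto x. \<Lambda>\<^sub>2 d / real d) / l\<^sup>2" by (simp add: W_def w_def sum_divide_distrib)
      hence "W - 1 = ((\<Sum>d\<in>nat_upto x. \<Lambda>\<^sub>2 d / real d) - l\<^sup>2) / l\<^sup>2"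
        using l by (simp add: diff_divide_distrib)
      hence "\<bar>W - 1\<bar> = \<bar>(\<Sum>d\<in>nat_upto x. \<Lambda>\<^sub>2 d / real d) - l\<^sup>2\<bar> / l\<^sup>2"
        by (simp add: abs_divide)
      also have "\<dots> \<le> (C2 + 11 * l) / l\<^sup>2" using C2(2)[OF x1(3)] by (intro divide_right_mono) (auto simp: l_def)
      also have "\<dots> \<le> (C2 * l + 11 * l) / l\<^sup>2"
        using C2(1) l mult_left_mono[of 1 l C2] by (intro divide_right_mono) auto
      also have "\<dots> = (C2 + 11) / l" using l by (simp add: power2_eq_square field_simps)
      finally show ?thesis .
    qed
    \<comment> \<open>By \<open>sum_divisors_Lam2\<close>, \<open>Y\<close> is exactly the average
      of \<open>V n F\<close> weighted by the squared logarithm of \<open>n\<close>;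
      \<open>sum_ln_squared_defect\<close> compares it with the plain average.\<close>
    have YG: "L2_norm M (\<lambda>y. Y y - G y) \<le> 8 / l * K"
    proof -
      have Yeq: "Y y = (\<Sum>n\<in>nat_upto x. of_real ((ln (real n))\<^sup>2 / (x * l\<^sup>2)) * V n F y)" for y
      proof -
        have "Y y = (\<Sum>d\<in>nat_upto x. of_real (1 / (x * l\<^sup>2)) * (of_real (\<Lambda>\<^sub>2 d) * V d (Z F (x / real d)) y))"
          unfolding Y_def
        proof (intro sum.cong refl)
          fix d assume "d \<in> nat_upto x"
          hence "d > 0" by (rule dpos)
          hence "w d * (1 / (x / real d)) = 1 / (x * l\<^sup>2) * \<Lambda>\<^sub>2 d" using x1(2) l by (simp add: w_def)
          hence "of_real (w d * (1 / (x / real d))) * V d (Z F (x / real d)) y =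
                 of_real (1 / (x * l\<^sup>2) * \<Lambda>\<^sub>2 d) * V d (Z F (x / real d)) y" by (simp only:)
          thus "of_real (w d) * X d y = of_real (1 / (x * l\<^sup>2)) * (of_real (\<Lambda>\<^sub>2 d) * V d (Z F (x / real d)) y)"
            by (simp only: X_def A_def V_scale of_real_mult mult.assoc)
        qed
        also have "\<dots> = of_real (1 / (x * l\<^sup>2)) * (\<Sum>n\<in>nat_upto x. of_real (\<Sum>d | d dvd n. \<Lambda>\<^sub>2 d) * V n F y)"
          by (simp only: sum_distrib_left[symmetric] convolution_sum)
        also have "\<dots> = (\<Sum>n\<in>nat_upto x. of_real (1 / (x * l\<^sup>2)) * (of_real ((ln (real n))\<^sup>2) * V n F y))"
          unfolding sum_distrib_left using dpos by (intro sum.cong) (auto simp: sum_divisors_Lam2)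
        finally show ?thesis by (simp add: mult_ac)
      qed
      define v where "v = (\<lambda>n. ((ln (real n))\<^sup>2 - l\<^sup>2) / (x * l\<^sup>2))"
      have "(\<lambda>y. Y y - G y) = (\<lambda>y. \<Sum>n\<in>nat_upto x. of_real (v n) * V n F y)"
        unfolding Yeq G_def A_def Z_def sum_distrib_left sum_subtractf[symmetric] v_def
        using l x1 by (intro ext sum.cong) (auto simp: field_simps)
      hence "L2_norm M (\<lambda>y. Y y - G y) \<le> (\<Sum>n\<in>nat_upto x. \<bar>v n\<bar>) * K"
        unfolding K_def using weighted_sum_norm_le[OF F finite_nat_upto nat_upto_pos, where w = v] by (simp only:)
      also have "(\<Sum>n\<in>nat_upto x. \<bar>v n\<bar>) \<le> 8 / l"
      proof -
        have "(\<Sum>n\<in>nat_upto x. \<bar>v n\<bar>) = (\<Sum>n\<in>nat_upto x. (l\<^sup>2 - (ln (real n))\<^sup>2) / (x * l\<^sup>2))"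
        proof (intro sum.cong refl)
          fix n assume n: "n \<in> nat_upto x"
          hence "(ln (real n))\<^sup>2 \<le> l\<^sup>2" unfolding l_def by (intro power_mono) (auto simp: nat_upto_def)
          thus "\<bar>v n\<bar> = (l\<^sup>2 - (ln (real n))\<^sup>2) / (x * l\<^sup>2)" using x1 by (simp add: v_def abs_div)
        qed
        also have "\<dots> = (\<Sum>n\<in>nat_upto x. l\<^sup>2 - (ln (real n))\<^sup>2) / (x * l\<^sup>2)" by (simp add: sum_divide_distrib)
        also have "\<dots> \<le> (8 * x * l) / (x * l\<^sup>2)"
          unfolding l_def using x1 by (intro divide_right_mono sum_ln_squared_defect) auto
        also have "\<dots> = 8 / l" using x1 l by (simp add: power2_eq_square)
        finally show ?thesis .
      qed
      finally show ?thesis using K0 by (simp add: mult_right_mono)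
    qed
    \<comment> \<open>Where \<open>x / d < T\<close> only the trivial norm bound \<open>K\<close> is
      available, but there \<open>1 / d \<le> T / x\<close>, so these divisors carry relative weight
      \<open>O(1 / l)\<close>.\<close>
    have sumX: "(\<Sum>d\<in>nat_upto x. w d * (L2_norm M (X d))\<^sup>2) \<le> W * (L + \<epsilon>)\<^sup>2 + K\<^sup>2 * (T * (2 + C1) / l)"
    proof -
      have "(\<Sum>d\<in>nat_upto x. w d * (L2_norm M (X d))\<^sup>2) \<le> (\<Sum>d\<in>nat_upto x. w d * (L + \<epsilon>)\<^sup>2 + \<Lambda>\<^sub>2 d * (T / x / l\<^sup>2 * K\<^sup>2))"
      proof (rule sum_mono)
        fix d assume d: "d \<in> nat_upto x"
        hence d0: "d > 0" "real d > 0" "x / real d > 0" using x1 by (auto simp: nat_upto_def)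
        have b: "L2_norm M (X d) \<le> L2_norm M (A F (x / real d))" unfolding X_def using d0 by (intro V_norm_le A_L2 F) auto
        show "w d * (L2_norm M (X d))\<^sup>2 \<le> w d * (L + \<epsilon>)\<^sup>2 + \<Lambda>\<^sub>2 d * (T / x / l\<^sup>2 * K\<^sup>2)"
        proof (cases "x / real d \<ge> T")
          case True
          hence "(L2_norm M (X d))\<^sup>2 \<le> (L + \<epsilon>)\<^sup>2" using b T(2)[OF True] by (intro power_mono) auto
          hence "w d * (L2_norm M (X d))\<^sup>2 \<le> w d * (L + \<epsilon>)\<^sup>2" by (intro mult_left_mono w0)
          moreover have "\<Lambda>\<^sub>2 d * (T / x / l\<^sup>2 * K\<^sup>2) \<ge> 0" using T(1) x1 by (intro mult_nonneg_nonneg Lam2_nonneg) auto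
          ultimately show ?thesis by linarith
        next
          case False
          hence "1 / real d \<le> T / x" using x1 d0 by (simp add: field_simps)
          hence wd: "w d \<le> \<Lambda>\<^sub>2 d * (T / x / l\<^sup>2)"
            using divide_right_mono[OF mult_left_mono[OF _ Lam2_nonneg[of d], of "1 / real d" "T / x"], of "l\<^sup>2"]
            by (simp add: w_def)
          have "L2_norm M (X d) \<le> K" using b A_norm_le[OF F d0(3)] by (simp add: K_def)
          hence "(L2_norm M (X d))\<^sup>2 \<le> K\<^sup>2" by (intro power_mono) auto
          hence "w d * (L2_norm M (X d))\<^sup>2 \<le> \<Lambda>\<^sub>2 d * (T / x / l\<^sup>2) * K\<^sup>2" using wd w0[of d] by (intro mult_mono) auto
          moreover have "w d * (L + \<epsilon>)\<^sup>2 \<ge> 0" using w0 by simp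
          ultimately show ?thesis by (simp add: mult.assoc)
        qed
      qed
      also have "\<dots> = W * (L + \<epsilon>)\<^sup>2 + (\<Sum>d\<in>nat_upto x. \<Lambda>\<^sub>2 d) * (T / x / l\<^sup>2 * K\<^sup>2)"
        by (simp only: sum.distrib W_def sum_distrib_right)
      also have "(\<Sum>d\<in>nat_upto x. \<Lambda>\<^sub>2 d) * (T / x / l\<^sup>2 * K\<^sup>2) \<le> ((2 + C1) * x * l) * (T / x / l\<^sup>2 * K\<^sup>2)"
      proof (rule mult_right_mono)
        have "C1 * x \<le> C1 * x * l" using C1 x1 l mult_left_mono[of 1 l "C1 * x"] by simp
        thus "(\<Sum>d\<in>nat_upto x. \<Lambda>\<^sub>2 d) \<le> (2 + C1) * x * l"
          using C1(2)[OF x1(3)] by (simp add: l_def algebra_simps)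
      qed (use T x1 in auto)
      also have "((2 + C1) * x * l) * (T / x / l\<^sup>2 * K\<^sup>2) = K\<^sup>2 * (T * (2 + C1) / l)"
        using x1 l by (simp add: power2_eq_square field_simps)
      finally show ?thesis by simp
    qed
    have a: "8 / l * K \<ge> 0" using l K0 by simp
    have Ylow: "(L2_norm M Y)\<^sup>2 \<ge> (L2_norm M G)\<^sup>2 - 2 * (8 / l * K) * K"
    proof -
      have n: "L2_norm M G \<le> L2_norm M Y + 8 / l * K"
        using L2_norm_reverse_triangle[OF GL YL] YG L2_norm_minus_commute[of M Y G] by linarith
      have "(L2_norm M G)\<^sup>2 - (L2_norm M Y)\<^sup>2 = (L2_norm M G - L2_norm M Y) * (L2_norm M G + L2_norm M Y)"
        by (simp add: power2_eq_square algebra_simps)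
      also have "\<dots> \<le> 2 * (8 / l * K) * K"
      proof (cases "L2_norm M G \<ge> L2_norm M Y")
        case True
        hence "(L2_norm M G - L2_norm M Y) * (L2_norm M G + L2_norm M Y) \<le> (8 / l * K) * (K + K)"
          using n GK a by (intro mult_mono) auto
        thus ?thesis by (simp add: algebra_simps)
      next
        case False
        hence "(L2_norm M G - L2_norm M Y) * (L2_norm M G + L2_norm M Y) \<le> 0"
          by (intro mult_nonpos_nonneg) auto
        also have "0 \<le> 2 * (8 / l * K) * K" by (rule mult_nonneg_nonneg[OF mult_nonneg_nonneg[OF _ a] K0]) simp
        finally show ?thesis .
      qed
      finally show ?thesis by linarith
    qed
    have Glow: "(L2_norm M G)\<^sup>2 \<ge> L\<^sup>2 - 2 * \<epsilon> * L"
    proof (cases "L \<ge> \<epsilon>")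
      case True
      hence "(L - \<epsilon>)\<^sup>2 \<le> (L2_norm M G)\<^sup>2" using lo by (intro power_mono) (auto simp: G_def)
      moreover have "(L - \<epsilon>)\<^sup>2 = L\<^sup>2 - 2 * \<epsilon> * L + \<epsilon>\<^sup>2" by (simp add: power2_diff)
      ultimately show ?thesis using zero_le_power2[of \<epsilon>] by linarith
    next
      case False
      hence "L \<le> \<epsilon>" by simp
      from mult_right_mono[OF this L] have "L\<^sup>2 \<le> \<epsilon> * L" by (simp only: power2_eq_square)
      moreover have "\<epsilon> * L \<ge> 0" using eps(1) L by simp
      ultimately have "L\<^sup>2 - 2 * \<epsilon> * L \<le> 0" by linarith
      thus ?thesis using zero_le_power2[of "L2_norm M G"] by linarith
    qed
    have "(8 / l * K)\<^sup>2 \<le> 64 * K\<^sup>2 / l"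
    proof -
      have "l * 1 \<le> l * l" using l by (intro mult_left_mono) auto
      hence "64 * K\<^sup>2 / (l * l) \<le> 64 * K\<^sup>2 / l" using l by (intro divide_left_mono) auto
      thus ?thesis by (simp add: power_mult_distrib power_divide power2_eq_square)
    qed
    hence YG2: "(L2_norm M (\<lambda>y. Y y - G y))\<^sup>2 \<le> 64 * K\<^sup>2 / l"
      using power_mono[OF YG L2_norm_nonneg, of 2] by linarith
    have WG: "(W - 1) * (L2_norm M G)\<^sup>2 \<le> (C2 + 11) / l * K\<^sup>2"
      using W1 GK C2 l by (intro mult_mono power_mono) auto
    have WL: "(W - 1) * (L + \<epsilon>)\<^sup>2 \<le> (C2 + 11) / l * (L + 1)\<^sup>2"
      using W1 L eps C2 l by (intro mult_mono power_mono) auto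
    have "(\<Sum>d\<in>nat_upto x. w d * (L2_norm M (\<lambda>y. X d y - G y))\<^sup>2) =
       (\<Sum>d\<in>nat_upto x. w d * (L2_norm M (X d))\<^sup>2) + (L2_norm M (\<lambda>y. Y y - G y))\<^sup>2 - (L2_norm M Y)\<^sup>2
      + (W - 1) * (L2_norm M G)\<^sup>2"
      unfolding Y_def W_def by (rule L2_norm_variance[OF finite_nat_upto XL GL])
    also have "\<dots> \<le> ((L + \<epsilon>)\<^sup>2 - L\<^sup>2 + 2 * \<epsilon> * L) + C / l"
    proof -
      define a1 where "a1 = (C2 + 11) / l * (L + 1)\<^sup>2"
      define a2 where "a2 = K\<^sup>2 * (T * (2 + C1) / l)"
      define a3 where "a3 = 64 * K\<^sup>2 / l"
      define a4 where "a4 = 2 * (8 / l * K) * K"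
      define a5 where "a5 = (C2 + 11) / l * K\<^sup>2"
      define b1 where "b1 = W * (L + \<epsilon>)\<^sup>2"
      define b2 where "b2 = (L + \<epsilon>)\<^sup>2"
      define b3 where "b3 = (W - 1) * (L + \<epsilon>)\<^sup>2"
      have C: "C / l = a1 + a2 + a3 + a4 + a5"
        using l by (simp add: C_def a1_def a2_def a3_def a4_def a5_def field_simps power2_eq_square)
      have b: "b1 = b2 + b3" unfolding b1_def b2_def b3_def by (simp only: left_diff_distrib)
      have c: "b3 \<le> a1" unfolding b3_def a1_def by (rule WL)
      have lin: "s + t - u + v \<le> (b2 - p + r) + (a1 + a2 + a3 + a4 + a5)"
        if "s \<le> b1 + a2" "t \<le> a3" "q - a4 \<le> u" "p - r \<le> q" "v \<le> a5" for s t u v p q r :: real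
        using that b c by linarith
      show ?thesis
        unfolding C b2_def[symmetric]
        by (rule lin[OF sumX[folded b1_def a2_def] YG2[folded a3_def] Ylow[folded a4_def] Glow WG[folded a5_def]])
    qed
    also have "(L + \<epsilon>)\<^sup>2 - L\<^sup>2 + 2 * \<epsilon> * L = \<epsilon> * (4 * L + \<epsilon>)" by (simp add: power2_eq_square algebra_simps)
    also have "\<dots> \<le> \<epsilon> * (4 * L + 1)" using eps by (intro mult_left_mono) auto
    also have "C / l \<le> \<eta> / 2" using lC l \<eta> by (simp add: l_def field_simps)
    finally have fin: "(\<Sum>d\<in>nat_upto x. w d * (L2_norm M (\<lambda>y. X d y - G y))\<^sup>2) \<le> \<eta>" using eps(3) by linarith
    have "(\<Sum>d\<in>nat_upto x. \<Lambda>\<^sub>2 d / real d * (L2_norm M (\<lambda>y. X d y - G y))\<^sup>2) =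
       l\<^sup>2 * (\<Sum>d\<in>nat_upto x. w d * (L2_norm M (\<lambda>y. X d y - G y))\<^sup>2)"
      using l by (simp add: w_def sum_distrib_left)
    also have "\<dots> \<le> l\<^sup>2 * \<eta>" by (intro mult_left_mono fin) auto
    finally show "(\<Sum>d\<in>nat_upto x. \<Lambda>\<^sub>2 d / real d * (L2_norm M (\<lambda>y. V d (A F (x / real d)) y - A F x y))\<^sup>2) \<le> \<eta> * (ln x)\<^sup>2"
      by (simp add: X_def G_def l_def mult.commute)
  qed
qed

end

subsection \<open>Slow variation of extremal averages\<close>

context twisted_system
begin

text \<open>These pairs are the colours of \<open>chain_bound\<close>: equal pairs give equal
  operators \<open>V d\<close>.\<close>

lemma finite_almost_prime_actions:
  assumes "finitely_generated S"
  shows "finite ((\<lambda>d. (S d, chi d)) ` {d. almost_prime d})"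
proof -
  define G where "G = S ` {p. prime p}"
  have G: "finite G" using assms by (simp add: G_def finitely_generated_def)
  have "S d \<in> G \<union> (\<lambda>(f,g). f \<circ> g) ` (G \<times> G)" if d: "almost_prime d" for d
  proof (cases "prime d")
    case False
    then obtain p q where pq: "prime p" "prime q" "d = p * q" using d by (auto simp: almost_prime_def)
    have "p > 0" "q > 0" using pq(1,2) by (auto intro: prime_gt_0_nat)
    hence "S d = (\<lambda>(f,g). f \<circ> g) (S p, S q)" using S_mult[of p q] by (simp add: pq(3) fun_eq_iff)
    moreover have "(S p, S q) \<in> G \<times> G" using pq(1,2) unfolding G_def by (intro SigmaI imageI CollectI)
    ultimately have "S d \<in> (\<lambda>(f,g). f \<circ> g) ` (G \<times> G)" by (rule image_eqI)
    thus ?thesis by (rule UnI2)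
  next
    case True
    hence "S d \<in> G" unfolding G_def by (intro imageI CollectI)
    thus ?thesis by (rule UnI1)
  qed
  hence "(\<lambda>d. (S d, chi d)) ` {d. almost_prime d} \<subseteq> (G \<union> (\<lambda>(f,g). f \<circ> g) ` (G \<times> G)) \<times> range chi"
    by (intro image_subsetI SigmaI rangeI) simp
  moreover have "finite ((G \<union> (\<lambda>(f,g). f \<circ> g) ` (G \<times> G)) \<times> range chi)"
    by (rule finite_cartesian_product[OF finite_UnI[OF G finite_imageI[OF finite_cartesian_product[OF G G]]]
          finite_range_dirichlet_character[OF chi]])
  ultimately show ?thesis by (rule finite_subset)
qed

text \<open>
  Along a scale \<open>x\<close> where \<open>A F x\<close> almost has maximal norm, convexity forces
  \<open>V d (A F (x / d))\<close> to be close to \<open>A F x\<close> for most almost primes \<open>d\<close>. The operators \<open>V d\<close> take only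
  finitely many values there, so \<open>A F (x / d)\<close> stays near finitely many points, and being a slowly
  varying function of \<open>d\<close> it is nearly constant on some long window.
\<close>

lemma slow_variation:
  fixes L \<epsilon> R T :: real
  assumes fg: "finitely_generated S" and F: "F \<in> L2 M" and L: "L > 0"
    and up: "\<And>\<epsilon>. \<epsilon> > 0 \<Longrightarrow> eventually (\<lambda>t. L2_norm M (A F t) \<le> L + \<epsilon>) at_top"
    and freq: "\<And>\<epsilon> T. \<epsilon> > 0 \<Longrightarrow> \<exists>t\<ge>T. L2_norm M (A F t) \<ge> L - \<epsilon>"
    and \<epsilon>: "\<epsilon> > 0" and R: "R \<ge> 1"
  obtains y where "y \<ge> T" "L2_norm M (A F y) \<ge> L - \<epsilon>"
    "\<And>z. y / R \<le> z \<Longrightarrow> z \<le> y \<Longrightarrow> L2_norm M (\<lambda>x. A F z x - A F y x) \<le> \<epsilon>"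
proof -
  define K where "K = L2_norm M F + 1"
  have K: "K > 0" "L2_norm M F \<le> K" by (auto simp: K_def add_nonneg_pos)
  define col where "col = (\<lambda>d. (S d, chi d))"
  define n0 where "n0 = card (col ` {d. almost_prime d})"
  have fincol: "finite (col ` {d. almost_prime d})"
    unfolding col_def by (rule finite_almost_prime_actions[OF fg])
  \<comment> \<open>The chain costs \<open>3 * e\<close> per colour, and the remaining
    \<open>5 * e\<close> covers the individual comparisons. The cap \<open>L / 4\<close> keeps
    \<open>L - 2 * e\<close> positive, which rules out \<open>chi (d s) = 0\<close>.\<close>
  define e where "e = min (L / 4) (\<epsilon> / (3 * real n0 + 5))"
  have e: "e > 0" "e \<le> L / 4" "(3 * real n0 + 5) * e \<le> \<epsilon>"
  proof -
    have "(3 * real n0 + 5) * e \<le> (3 * real n0 + 5) * (\<epsilon> / (3 * real n0 + 5))"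
      by (intro mult_left_mono) (auto simp: e_def)
    thus "(3 * real n0 + 5) * e \<le> \<epsilon>" by simp
    have "3 * real n0 + 5 > 0" by (simp add: add_nonneg_pos)
    thus "e > 0" using L \<epsilon> by (simp add: e_def)
    show "e \<le> L / 4" unfolding e_def by (rule min.cobounded1)
  qed
  have "2 * e \<le> (3 * real n0 + 5) * e" by (rule mult_right_mono) (use e(1) in simp_all)
  hence e2: "2 * e \<le> \<epsilon>" using e(3) by (rule order.trans)
  \<comment> \<open>A logarithmic distance of \<open>2 * \<delta>\<close> costs
    \<open>4 * K * \<delta> \<le> e / 2\<close> in \<open>A_close\<close>; the rounding term takes
    the other half through \<open>B \<ge> 2 * K / e\<close>.\<close>
  define \<delta> where "\<delta> = min (1/2) (e / (8 * K))"
  have \<delta>: "\<delta> > 0" "\<delta> \<le> 1" "8 * K * \<delta> \<le> e"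
  proof -
    have "8 * K * \<delta> \<le> 8 * K * (e / (8 * K))" using K by (intro mult_left_mono) (auto simp: \<delta>_def)
    thus "8 * K * \<delta> \<le> e" using K by simp
  qed (use e K in \<open>auto simp: \<delta>_def\<close>)
  obtain m :: nat where m: "real m * \<delta> \<ge> ln R + \<delta>"
    using real_arch_simple[of "(ln R + \<delta>) / \<delta>"] \<delta> by (auto simp: field_simps)
  have lnR: "ln R \<ge> 0" using R by simp
  have m0: "m > 0" using m \<delta> lnR by (cases m) auto
  obtain Y0 where Y0: "Y0 \<ge> 1" "\<And>y. y \<ge> Y0 \<Longrightarrow>
     (\<Sum>d | almost_prime d \<and> y < real d \<and> real d \<le> y * exp \<delta>. \<Lambda>\<^sub>2 d / real d) \<ge> \<delta> / 3 * ln y"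
    using almost_prime_short_interval[OF \<delta>(1,2)] by blast
  \<comment> \<open>It bounds the mass of the bad divisors by \<open>l^2 / (96 m)\<close>, half of
    what one fully bad cell in each of \<open>I\<close> blocks would carry:
    \<open>I \<ge> l / (8 m \<delta>)\<close> cells of mass \<open>\<delta> l / 6\<close> each give
    \<open>l^2 / (48 m)\<close>.\<close>
  define \<eta> where "\<eta> = e\<^sup>2 / (96 * real m)"
  have \<eta>: "\<eta> > 0" using e m0 by (simp add: \<eta>_def)
  have L0: "L \<ge> 0" using L by simp
  obtain X0 \<epsilon>1 where X0: "\<epsilon>1 > 0" "\<And>x. x \<ge> X0 \<Longrightarrow> L2_norm M (A F x) \<ge> L - \<epsilon>1 \<Longrightarrow>
     (\<Sum>d\<in>nat_upto x. \<Lambda>\<^sub>2 d / real d * (L2_norm M (\<lambda>y. V d (A F (x / real d)) y - A F x y))\<^sup>2) \<le> \<eta> * (ln x)\<^sup>2"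
    using convexity[OF F L0 \<eta> up] by blast
  define B where "B = max 1 (max T (2 * K / e))"
  have B: "B \<ge> 1" "B \<ge> T" "B \<ge> 2 * K / e" by (auto simp: B_def)
  \<comment> \<open>The four lower bounds serve, in order, the convexity estimate,
    \<open>sqrt x \<ge> Y0\<close>, \<open>q \<ge> 2\<close>, and scales
    \<open>x / d \<ge> B\<close>.\<close>
  define x0 where "x0 = max (max X0 (Y0\<^sup>2)) (max (exp (8 * real m * \<delta>)) (exp (4 * ln B)))"
  obtain x where x: "x \<ge> x0" "L2_norm M (A F x) \<ge> L - min \<epsilon>1 e"
    using freq[of "min \<epsilon>1 e" x0] X0(1) e(1) by auto
  have xX: "x \<ge> X0" "x \<ge> Y0\<^sup>2" "x \<ge> exp (8 * real m * \<delta>)" "x \<ge> exp (4 * ln B)"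
    using x(1) by (auto simp: x0_def)
  have x1: "x > 0" using xX(3) exp_gt_zero[of "8 * real m * \<delta>"] by linarith
  define l where "l = ln x"
  have l: "l \<ge> 8 * real m * \<delta>" "l \<ge> 4 * ln B" using xX x1 by (auto simp: l_def ln_ge_iff)
  have md: "real m * \<delta> > 0" using m0 \<delta> by simp
  have l0: "l > 0" using l(1) md by linarith
  define N where "N = (\<lambda>d. L2_norm M (\<lambda>y. V d (A F (x / real d)) y - A F x y))"
  define bad where "bad = {d\<in>nat_upto x. N d \<ge> e}"
  have finbad: "finite bad" by (simp add: bad_def)
  have badmass: "(\<Sum>d\<in>bad. \<Lambda>\<^sub>2 d / real d) \<le> l\<^sup>2 / (96 * real m)"
  proof -
    have "e\<^sup>2 * (\<Sum>d\<in>bad. \<Lambda>\<^sub>2 d / real d) = (\<Sum>d\<in>bad. \<Lambda>\<^sub>2 d / real d * e\<^sup>2)"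
      by (simp add: sum_distrib_left mult.commute)
    also have "\<dots> \<le> (\<Sum>d\<in>bad. \<Lambda>\<^sub>2 d / real d * (N d)\<^sup>2)"
      using e by (intro sum_mono mult_left_mono power_mono) (auto simp: bad_def Lam2_nonneg)
    also have "\<dots> \<le> (\<Sum>d\<in>nat_upto x. \<Lambda>\<^sub>2 d / real d * (N d)\<^sup>2)"
      by (intro sum_mono2) (auto simp: bad_def Lam2_nonneg)
    also have "\<dots> \<le> \<eta> * l\<^sup>2" unfolding N_def l_def using x(2) by (intro X0(2) xX(1)) auto
    also have "\<dots> = e\<^sup>2 * (l\<^sup>2 / (96 * real m))" by (simp add: \<eta>_def)
    finally show ?thesis by (rule mult_left_le_imp_le) (use e(1) in simp)
  qed
  \<comment> \<open>Cells of logarithmic length \<open>\<delta>\<close> starting at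
    \<open>sqrt x\<close>; a window consists of \<open>m\<close> consecutive cells.\<close>
  define J where "J = (\<lambda>j::nat. {d. almost_prime d \<and> sqrt x * exp (real j * \<delta>) < real d \<and> real d \<le> sqrt x * exp (real (Suc j) * \<delta>)})"
  \<comment> \<open>The \<open>I\<close> blocks of \<open>m\<close> cells span at most a quarter of
    \<open>ln x\<close>, so all divisors stay below \<open>x\<close> to the power \<open>3/4\<close>
    and the scales \<open>x / d\<close> remain large.\<close>
  define q where "q = l / (4 * real m * \<delta>)"
  have q0: "q \<ge> 0" unfolding q_def using l0 md by (intro divide_nonneg_nonneg) (auto simp: mult.assoc)
  have ql: "q * (4 * real m * \<delta>) = l" using m0 \<delta>(1) by (simp add: q_def)
  define I where "I = nat \<lfloor>q\<rfloor>"
  have Iq: "real I \<le> q" "real I > q - 1" unfolding I_def using q0 by linarith+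
  have Iub: "real I * (4 * real m * \<delta>) \<le> l"
    unfolding ql[symmetric] using md by (intro mult_right_mono Iq) (auto simp: mult.assoc)
  have q2: "q \<ge> 2"
  proof (rule ccontr)
    assume "\<not> q \<ge> 2"
    hence "q * (4 * real m * \<delta>) < 2 * (4 * real m * \<delta>)" using md by (intro mult_strict_right_mono) (auto simp: mult.assoc)
    with l(1) ql show False by linarith
  qed
  have Ilb: "real I \<ge> q / 2" using Iq q2 by linarith
  have sq: "sqrt x = exp (l / 2)" using x1 by (simp add: l_def ln_sqrt[symmetric])
  have Jmem: "d \<in> J j \<longleftrightarrow> almost_prime d \<and> d > 0 \<and> l / 2 + real j * \<delta> < ln (real d) \<and> ln (real d) \<le> l / 2 + real (Suc j) * \<delta>" for d j
  proof (cases "d > 0")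
    case True
    hence "real d = exp (ln (real d))" by simp
    hence "sqrt x * exp (real j * \<delta>) < real d \<longleftrightarrow> l / 2 + real j * \<delta> < ln (real d)"
      "real d \<le> sqrt x * exp (real (Suc j) * \<delta>) \<longleftrightarrow> ln (real d) \<le> l / 2 + real (Suc j) * \<delta>"
      unfolding sq exp_add[symmetric] by (metis exp_less_cancel_iff, metis exp_le_cancel_iff)
    with True show ?thesis by (simp add: J_def)
  next
    case False
    moreover have "sqrt x * exp (real j * \<delta>) \<ge> 0" using x1 by simp
    ultimately show ?thesis by (auto simp: J_def)
  qed
  have finJ: "finite (J j)" for j
  proof (rule finite_subset)
    show "J j \<subseteq> nat_upto (sqrt x * exp (real (Suc j) * \<delta>))"
    proof
      fix d assume d: "d \<in> J j"
      hence "d > 0" by (simp only: Jmem)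
      with d show "d \<in> nat_upto (sqrt x * exp (real (Suc j) * \<delta>))" unfolding J_def nat_upto_def by simp
    qed
  qed simp
  have Jmass: "(\<Sum>d\<in>J j. \<Lambda>\<^sub>2 d / real d) \<ge> \<delta> / 6 * l" for j
  proof -
    define y where "y = sqrt x * exp (real j * \<delta>)"
    have "exp (real j * \<delta>) \<ge> 1" using \<delta> by simp
    hence ys: "y \<ge> sqrt x" unfolding y_def using x1 mult_left_mono[of 1 "exp (real j * \<delta>)" "sqrt x"] by simp
    have "sqrt x \<ge> Y0" using xX(2) Y0(1) by (intro real_le_rsqrt)
    hence yY: "y \<ge> Y0" using ys by simp
    have "J j = {d. almost_prime d \<and> y < real d \<and> real d \<le> y * exp \<delta>}"
      unfolding J_def y_def by (simp add: exp_add[symmetric] mult.assoc algebra_simps)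
    hence "(\<Sum>d\<in>J j. \<Lambda>\<^sub>2 d / real d) \<ge> \<delta> / 3 * ln y" using Y0(2)[OF yY] by simp
    moreover have "ln y \<ge> l / 2"
      using \<delta> by (simp add: y_def sq exp_add[symmetric])
    hence "\<delta> / 3 * ln y \<ge> \<delta> / 3 * (l / 2)" using \<delta> by (intro mult_left_mono) auto
    ultimately show ?thesis by simp
  qed
  have Jx: "d \<in> nat_upto x \<and> ln (real d) \<le> 3 / 4 * l" if d: "d \<in> J j" and j: "j < I * m" for d j
  proof -
    have "real (Suc j) \<le> real (I * m)" using j by linarith
    hence "real (Suc j) * \<delta> \<le> real (I * m) * \<delta>" using \<delta> by (intro mult_right_mono) auto
    also have "\<dots> = real I * (4 * real m * \<delta>) / 4" by simp
    also have "\<dots> \<le> l / 4" using Iub by simp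
    finally have "ln (real d) \<le> 3 / 4 * l" using d by (auto simp: Jmem)
    moreover from this have "ln (real d) \<le> ln x" using l0 unfolding l_def[symmetric] by linarith
    moreover have "d > 0" using d by (simp add: Jmem)
    ultimately show ?thesis using x1 by (simp add: nat_upto_def)
  qed
  have Jdisj: "j = j'" if "d \<in> J j" "d \<in> J j'" for d j j'
  proof (rule ccontr)
    have less: False if "d \<in> J a" "d \<in> J b" "a < b" for a b
    proof -
      have "real (Suc a) * \<delta> \<le> real b * \<delta>" using that \<delta> by (intro mult_right_mono) auto
      thus False using that(1,2) by (auto simp: Jmem)
    qed
    assume "j \<noteq> j'"
    thus False using less[of j j'] less[of j' j] that by linarith
  qed
  \<comment> \<open>Pigeonhole: otherwise every block contains an entirely bad cell, and these
    disjoint cells together exceed the mass allowed for \<open>bad\<close>.\<close>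
  have "\<exists>i<I. \<forall>s<m. \<not> J (i * m + s) \<subseteq> bad"
  proof (rule ccontr)
    assume "\<not> (\<exists>i<I. \<forall>s<m. \<not> J (i * m + s) \<subseteq> bad)"
    hence "\<forall>i. \<exists>s. i < I \<longrightarrow> s < m \<and> J (i * m + s) \<subseteq> bad" by blast
    then obtain s where s: "\<And>i. i < I \<Longrightarrow> s i < m" "\<And>i. i < I \<Longrightarrow> J (i * m + s i) \<subseteq> bad" by metis
    have inj: "i = i'" if "i < I" "i' < I" "i * m + s i = i' * m + s i'" for i i'
    proof -
      have "(i * m + s i) div m = i" "(i' * m + s i') div m = i'" using s(1)[OF that(1)] s(1)[OF that(2)] by simp_all
      with that(3) show ?thesis by metis
    qed
    have "real I * (\<delta> / 6 * l) = (\<Sum>i<I. \<delta> / 6 * l)" by simp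
    also have "\<dots> \<le> (\<Sum>i<I. \<Sum>d\<in>J (i * m + s i). \<Lambda>\<^sub>2 d / real d)" by (intro sum_mono Jmass)
    also have "\<dots> = (\<Sum>d\<in>(\<Union>i\<in>{..<I}. J (i * m + s i)). \<Lambda>\<^sub>2 d / real d)"
    proof (rule sum.UNION_disjoint[symmetric])
      show "\<forall>i\<in>{..<I}. \<forall>i'\<in>{..<I}. i \<noteq> i' \<longrightarrow> J (i * m + s i) \<inter> J (i' * m + s i') = {}"
        using Jdisj inj by (metis disjoint_iff lessThan_iff)
    qed (use finJ in auto)
    also have "\<dots> \<le> (\<Sum>d\<in>bad. \<Lambda>\<^sub>2 d / real d)"
      using s(2) finbad by (intro sum_mono2) (auto simp: Lam2_nonneg)
    also have "\<dots> \<le> l\<^sup>2 / (96 * real m)" by (rule badmass)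
    finally have u: "real I * (\<delta> / 6 * l) \<le> l\<^sup>2 / (96 * real m)" .
    have "l\<^sup>2 / (48 * real m) = q / 2 * (\<delta> / 6 * l)"
      using \<delta>(1) m0 by (simp add: q_def power2_eq_square)
    also have "\<dots> \<le> real I * (\<delta> / 6 * l)" using Ilb \<delta> l0 by (intro mult_right_mono) auto
    finally have "l\<^sup>2 / (48 * real m) \<le> l\<^sup>2 / (96 * real m)" using u by simp
    moreover have "l\<^sup>2 / (48 * real m) = 2 * (l\<^sup>2 / (96 * real m))" by simp
    moreover have "l\<^sup>2 / (96 * real m) > 0" using l0 m0 by simp
    ultimately show False by linarith
  qed
  then obtain i where i: "i < I" "\<And>s. s < m \<Longrightarrow> \<not> J (i * m + s) \<subseteq> bad" by blast
  have "\<forall>s. \<exists>d. s < m \<longrightarrow> d \<in> J (i * m + s) \<and> d \<notin> bad" using i(2) by blast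
  then obtain d where d: "\<And>s. s < m \<Longrightarrow> d s \<in> J (i * m + s)" "\<And>s. s < m \<Longrightarrow> d s \<notin> bad" by metis
  have ims: "i * m + s < I * m" if "s < m" for s
  proof -
    have "i * m + s < Suc i * m" using that by simp
    also have "\<dots> \<le> I * m" using i(1) by (intro mult_right_mono) auto
    finally show ?thesis .
  qed
  define t where "t = (\<lambda>s. x / real (d s))"
  have dp: "d s > 0" "almost_prime (d s)" "d s \<in> nat_upto x" "ln (real (d s)) \<le> 3 / 4 * l" if "s < m" for s
    using d(1)[OF that] Jx[OF d(1)[OF that] ims[OF that]] by (auto simp: Jmem)
  have good: "N (d s) < e" if "s < m" for s using d(2)[OF that] dp(3)[OF that] by (auto simp: bad_def)
  have big: "u \<ge> B" if "ln u \<ge> l / 4" "u > 0" for u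
  proof -
    have "ln B \<le> ln u" using that(1) l(2) by linarith
    thus ?thesis using B(1) that(2) by simp
  qed
  have lnt: "ln (t s) = l - ln (real (d s))" if "s < m" for s
    using dp(1)[OF that] x1 by (simp add: t_def ln_div l_def)
  have tpos: "t s > 0" if "s < m" for s using dp(1)[OF that] x1 by (simp add: t_def)
  have tB: "t s \<ge> B" if "s < m" for s using lnt[OF that] dp(4)[OF that] tpos[OF that] by (intro big) linarith+
  have AL: "A F u \<in> L2 M" for u by (rule A_L2[OF F])
  have close: "L2_norm M (\<lambda>x. A F u x - A F v x) \<le> e" if "u \<ge> B" "v \<ge> B" "\<bar>ln u - ln v\<bar> \<le> 2 * \<delta>" for u v
  proof -
    have "L2_norm M (\<lambda>x. A F u x - A F v x) \<le> (2 * (2 * \<delta>) + 1 / B) * L2_norm M F"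
      using that B(1) by (intro A_close F) auto
    also have "\<dots> \<le> (2 * (2 * \<delta>) + 1 / B) * K" using K \<delta> B by (intro mult_left_mono) auto
    also have "\<dots> = 4 * K * \<delta> + K / B" by (simp add: algebra_simps)
    also have "K / B \<le> e / 2"
      using B e K by (simp add: pos_divide_le_eq field_simps)
    finally show ?thesis using \<delta>(3) by simp
  qed
  have Alo: "L2_norm M (A F x) \<ge> L - e" using x(2) by auto
  have Alow: "L2_norm M (A F (t s)) \<ge> L - 2 * e \<and> chi (d s) \<noteq> 0" if s: "s < m" for s
  proof -
    have VL: "V (d s) (A F (t s)) \<in> L2 M" by (intro V_L2 AL dp(1)[OF s])
    have "L2_norm M (A F x) \<le> L2_norm M (V (d s) (A F (t s))) + N (d s)"
      using L2_norm_reverse_triangle[OF AL VL, of x] L2_norm_minus_commute[of M "A F x" "V (d s) (A F (t s))"]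
      by (simp add: N_def t_def)
    hence b: "L2_norm M (V (d s) (A F (t s))) \<ge> L - 2 * e" using good[OF s] Alo by linarith
    have "chi (d s) \<noteq> 0"
    proof
      assume "chi (d s) = 0"
      hence "L2_norm M (V (d s) (A F (t s))) = 0" using V_norm_eq[OF dp(1)[OF s] AL] by simp
      with b e L show False by linarith
    qed
    with b V_norm_le[OF dp(1)[OF s] AL, of "t s"] show ?thesis by linarith
  qed
  define D where "D = (\<lambda>a b. L2_norm M (\<lambda>x. A F (t a) x - A F (t b) x))"
  have chain0: "D a b \<le> 3 * e * real n0" if ab: "a \<le> b" "b < m" for a b
  proof -
    have "D a b \<le> 3 * e * real (card ((\<lambda>s. col (d s)) ` {a..b}))"
    proof (rule chain_bound[where c = "\<lambda>s. col (d s)"])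
      show "D u w \<le> D u v + D v w" for u v w unfolding D_def by (intro L2_norm_diff_triangle AL)
      show "D u (Suc u) \<le> e" if "u < b" for u
      proof -
        have um: "u < m" "Suc u < m" using that ab by auto
        have "l / 2 + real (i * m + u) * \<delta> < ln (real (d u))" "ln (real (d u)) \<le> l / 2 + real (Suc (i * m + u)) * \<delta>"
          using d(1)[OF um(1)] by (auto simp: Jmem)
        moreover have "l / 2 + real (i * m + Suc u) * \<delta> < ln (real (d (Suc u)))"
          "ln (real (d (Suc u))) \<le> l / 2 + real (Suc (i * m + Suc u)) * \<delta>"
          using d(1)[OF um(2)] by (auto simp: Jmem)
        ultimately have "\<bar>ln (real (d u)) - ln (real (d (Suc u)))\<bar> \<le> 2 * \<delta>"
          by (simp add: abs_le_iff algebra_simps)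
        thus ?thesis unfolding D_def using um by (intro close tB) (auto simp: lnt abs_minus_commute)
      qed
      show "D u v \<le> 2 * e" if uv: "u \<le> b" "v \<le> b" "col (d u) = col (d v)" for u v
      proof -
        have m': "u < m" "v < m" using uv ab by auto
        have VV: "V (d u) = V (d v)" using uv(3) by (simp add: V_def col_def fun_eq_iff)
        \<comment> \<open>Equal colours give the same isometry \<open>V (d u)\<close>, so the
          distance may be measured after applying it, where both vectors lie within \<open>e\<close>
          of \<open>A F x\<close>.\<close>
        have "D u v = L2_norm M (V (d u) (\<lambda>x. A F (t u) x - A F (t v) x))"
          unfolding D_def using Alow[OF m'(1)] by (intro V_norm[symmetric] dp(1) m' L2_diff AL) auto
        also have "\<dots> = L2_norm M (\<lambda>x. V (d u) (A F (t u)) x - V (d v) (A F (t v)) x)"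
          by (simp add: V_diff VV)
        also have "\<dots> \<le> N (d u) + L2_norm M (\<lambda>y. A F x y - V (d v) (A F (t v)) y)"
          unfolding N_def t_def
          by (rule L2_norm_diff_triangle[OF V_L2[OF dp(1)[OF m'(1)] AL] AL V_L2[OF dp(1)[OF m'(2)] AL]])
        also have "L2_norm M (\<lambda>y. A F x y - V (d v) (A F (t v)) y) = N (d v)"
          by (subst L2_norm_minus_commute) (simp add: N_def t_def)
        finally show ?thesis using good[OF m'(1)] good[OF m'(2)] by linarith
      qed
    qed (use e ab in auto)
    also have "\<dots> \<le> 3 * e * real n0"
    proof -
      have "(\<lambda>s. col (d s)) ` {a..b} \<subseteq> col ` {d. almost_prime d}" using ab dp(2) by auto
      hence "card ((\<lambda>s. col (d s)) ` {a..b}) \<le> n0" unfolding n0_def by (intro card_mono fincol)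
      thus ?thesis using e by (intro mult_left_mono) auto
    qed
    finally show ?thesis .
  qed
  show ?thesis
  proof (rule that[of "t 0"])
    show "t 0 \<ge> T" using tB[OF m0] B(2) by linarith
    show "L2_norm M (A F (t 0)) \<ge> L - \<epsilon>" using Alow[OF m0] e2 by linarith
    fix z assume z: "t 0 / R \<le> z" "z \<le> t 0"
    have z0: "z > 0" using z(1) tpos[OF m0] R by (auto intro: less_le_trans[rotated])
    \<comment> \<open>The logarithm of the virtual divisor \<open>x / z\<close>. It stays inside the
      chosen window because \<open>m\<close> leaves room for \<open>ln R\<close> and one extra
      cell.\<close>
    define u where "u = l - ln z"
    have "ln z \<le> ln (t 0)" using z(2) z0 tpos[OF m0] by (subst ln_le_cancel_iff)
    hence u1: "u \<ge> ln (real (d 0))" using lnt[OF m0] unfolding u_def by linarith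
    have "ln (t 0 / R) \<le> ln z" using z(1) z0 tpos[OF m0] R by simp
    hence u2: "u \<le> ln (real (d 0)) + ln R" using lnt[OF m0] tpos[OF m0] R by (simp add: u_def ln_div)
    define v where "v = (u - l / 2) / \<delta> - real (i * m)"
    have dz: "l / 2 + real (i * m) * \<delta> < ln (real (d 0))" "ln (real (d 0)) \<le> l / 2 + real (Suc (i * m)) * \<delta>"
      using d(1)[OF m0] by (auto simp: Jmem)
    have uv: "u = l / 2 + (real (i * m) + v) * \<delta>" using \<delta> by (simp add: v_def)
    have v0: "v > 0" 
    proof -
      have "(real (i * m) + v) * \<delta> > real (i * m) * \<delta>" using u1 dz(1) uv by linarith
      thus ?thesis using \<delta> by simp
    qed
    have vm: "v \<le> real m"
    proof -
      have "(real (i * m) + v) * \<delta> \<le> (real (i * m) + real m) * \<delta>"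
        using u2 dz(2) uv m by (simp add: algebra_simps)
      thus ?thesis using \<delta> by simp
    qed
    \<comment> \<open>Cells are open on the left, so the cell containing \<open>u\<close> has index
      \<open>\<lceil>v\<rceil> - 1\<close> rather than \<open>\<lfloor>v\<rfloor>\<close>.\<close>
    define s where "s = nat (\<lceil>v\<rceil> - 1)"
    have s: "s < m" "real s < v" "v \<le> real s + 1" using v0 vm unfolding s_def by linarith+
    have us: "l / 2 + real (i * m + s) * \<delta> \<le> u" "u \<le> l / 2 + real (Suc (i * m + s)) * \<delta>"
    proof -
      have "real s * \<delta> \<le> v * \<delta>" "v * \<delta> \<le> (real s + 1) * \<delta>" using s \<delta> by (auto intro!: mult_right_mono)
      thus "l / 2 + real (i * m + s) * \<delta> \<le> u" "u \<le> l / 2 + real (Suc (i * m + s)) * \<delta>"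
        by (simp_all add: uv algebra_simps)
    qed
    have ds: "l / 2 + real (i * m + s) * \<delta> < ln (real (d s))" "ln (real (d s)) \<le> l / 2 + real (Suc (i * m + s)) * \<delta>"
      using d(1)[OF s(1)] by (auto simp: Jmem)
    have "\<bar>ln z - ln (t s)\<bar> \<le> 2 * \<delta>"
      using us ds lnt[OF s(1)] \<delta>(1) by (simp add: u_def abs_le_iff algebra_simps)
    moreover have "ln z \<ge> l / 4"
    proof -
      have "real (Suc (i * m + s)) \<le> real (I * m)" using ims[OF s(1)] by linarith
      hence "real (Suc (i * m + s)) * \<delta> \<le> real (I * m) * \<delta>" using \<delta> by (intro mult_right_mono) auto
      also have "\<dots> = real I * (4 * real m * \<delta>) / 4" by simp
      also have "\<dots> \<le> l / 4" using Iub by simp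
      finally show ?thesis using us(2) by (simp add: u_def)
    qed
    ultimately have c1: "L2_norm M (\<lambda>x. A F z x - A F (t s) x) \<le> e"
      using z0 by (intro close tB s(1) big)
    have "L2_norm M (\<lambda>x. A F z x - A F (t 0) x) \<le> L2_norm M (\<lambda>x. A F z x - A F (t s) x) + D 0 s"
      unfolding D_def L2_norm_minus_commute[of M "A F (t 0)" "A F (t s)"]
      by (rule L2_norm_diff_triangle[OF AL AL AL])
    also have "\<dots> \<le> e + 3 * e * real n0" by (intro add_mono c1 chain0 s(1)) auto
    also have "\<dots> \<le> (3 * real n0 + 5) * e" using e(1) by (simp add: algebra_simps)
    finally show "L2_norm M (\<lambda>x. A F z x - A F (t 0) x) \<le> \<epsilon>" using e(3) by linarith
  qed
qed

end

subsection \<open>Coboundaries\<close>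

context twisted_system
begin

text \<open>Grouping by \<open>n = q * m\<close>, the sum over \<open>B\<close> becomes the average
  of \<open>V n F\<close> weighted by the number of primes of \<open>B\<close> dividing
  \<open>n\<close>. By \<open>turan_kubilius_L1\<close> this number is \<open>L\<close> on average
  up to a square root, and the common value \<open>V q = V p\<close> leaves a single
  operator.\<close>

lemma turan_kubilius_average:
  assumes F: "F \<in> L2 M" and B: "finite B" "\<And>q. q \<in> B \<Longrightarrow> prime q"
    and cls: "\<And>q. q \<in> B \<Longrightarrow> V q = V p" and t: "t > 0"
  defines "L \<equiv> \<Sum>q\<in>B. 1 / real q"
  shows "L2_norm M (\<lambda>x. of_real L * A F t x - (\<Sum>q\<in>B. of_real (1 / real q) * V p (A F (t / real q)) x))
      \<le> sqrt (L + 2 * L * real (card B) / t) * L2_norm M F"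
proof -
  define w where "w = (\<lambda>n. real (card {q\<in>B. q dvd n}))"
  have qpos: "q > 0" if "q \<in> B" for q using B(2)[OF that] by (rule prime_gt_0_nat)
  have L0: "L \<ge> 0" unfolding L_def by (intro sum_nonneg) auto
  have "(\<Sum>q\<in>B. of_real (1 / real q) * V p (A F (t / real q)) x) = of_real (1 / t) * (\<Sum>n\<in>nat_upto t. of_real (w n) * V n F x)" for x
  proof -
    have "(\<Sum>n\<in>nat_upto t. of_real (w n) * V n F x) = (\<Sum>n\<in>nat_upto t. \<Sum>q\<in>B. if q dvd n then V n F x else 0)"
      using B(1) by (intro sum.cong) (simp_all add: w_def sum.If_cases Int_def conj_commute)
    also have "\<dots> = (\<Sum>q\<in>B. \<Sum>n\<in>nat_upto t. if q dvd n then V n F x else 0)" by (rule sum.swap)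
    also have "\<dots> = (\<Sum>q\<in>B. V p (Z F (t / real q)) x)"
    proof (rule sum.cong[OF refl])
      fix q assume q: "q \<in> B"
      have "(\<Sum>n\<in>nat_upto t. if q dvd n then V n F x else 0) = (\<Sum>n\<in>{n\<in>nat_upto t. q dvd n}. V n F x)"
        by (simp add: sum.If_cases Int_def conj_commute)
      also have "{n\<in>nat_upto t. q dvd n} = (\<lambda>m. q * m) ` nat_upto (t / real q)"
        using qpos[OF q] by (auto simp: nat_upto_def field_simps elim!: dvdE)
      also have "(\<Sum>n\<in>(\<lambda>m. q * m) ` nat_upto (t / real q). V n F x) = (\<Sum>m\<in>nat_upto (t / real q). V (q * m) F x)"
        using qpos[OF q] by (subst sum.reindex) (auto simp: inj_on_def)
      also have "\<dots> = V q (Z F (t / real q)) x" by (simp only: dilation_sum[OF qpos[OF q]])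
      finally show "(\<Sum>n\<in>nat_upto t. if q dvd n then V n F x else 0) = V p (Z F (t / real q)) x"
        by (simp only: cls[OF q])
    qed
    finally have "of_real (1 / t) * (\<Sum>n\<in>nat_upto t. of_real (w n) * V n F x) = (\<Sum>q\<in>B. of_real (1 / t) * V p (Z F (t / real q)) x)"
      by (simp only: sum_distrib_left)
    also have "\<dots> = (\<Sum>q\<in>B. of_real (1 / real q) * V p (A F (t / real q)) x)"
    proof (rule sum.cong[OF refl])
      fix q assume q: "q \<in> B"
      have "1 / t = 1 / real q * (1 / (t / real q))" using qpos[OF q] t by simp
      hence "of_real (1 / t) = (of_real (1 / real q) * of_real (1 / (t / real q)) :: complex)" by (simp only: of_real_mult)
      thus "of_real (1 / t) * V p (Z F (t / real q)) x = of_real (1 / real q) * V p (A F (t / real q)) x"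
        by (simp only: A_def V_scale mult.assoc)
    qed
    finally show ?thesis by simp
  qed
  hence "(\<lambda>x. of_real L * A F t x - (\<Sum>q\<in>B. of_real (1 / real q) * V p (A F (t / real q)) x)) =
         (\<lambda>x. of_real (1 / t) * (\<Sum>n\<in>nat_upto t. of_real (L - w n) * V n F x))"
    by (simp add: A_def Z_def sum_subtractf sum_distrib_left algebra_simps)
  hence "L2_norm M (\<lambda>x. of_real L * A F t x - (\<Sum>q\<in>B. of_real (1 / real q) * V p (A F (t / real q)) x)) =
         1 / t * L2_norm M (\<lambda>x. \<Sum>n\<in>nat_upto t. of_real (L - w n) * V n F x)"
    using t by (simp only: L2_norm_scale norm_of_real) simp
  also have "\<dots> \<le> 1 / t * (sqrt (t * (t * L + 2 * L * real (card B))) * L2_norm M F)"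
  proof (rule mult_left_mono)
    have "L2_norm M (\<lambda>x. \<Sum>n\<in>nat_upto t. of_real (L - w n) * V n F x) \<le> (\<Sum>n\<in>nat_upto t. \<bar>L - w n\<bar>) * L2_norm M F"
      by (rule weighted_sum_norm_le[OF F finite_nat_upto nat_upto_pos])
    also have "(\<Sum>n\<in>nat_upto t. \<bar>L - w n\<bar>) = (\<Sum>n\<in>nat_upto t. \<bar>w n - L\<bar>)" by (simp only: abs_minus_commute)
    also have "(\<Sum>n\<in>nat_upto t. \<bar>w n - L\<bar>) * L2_norm M F \<le> sqrt (t * (t * L + 2 * L * real (card B))) * L2_norm M F"
      unfolding w_def L_def using B t by (intro mult_right_mono turan_kubilius_L1) auto
    finally show "L2_norm M (\<lambda>x. \<Sum>n\<in>nat_upto t. of_real (L - w n) * V n F x) \<le>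
      sqrt (t * (t * L + 2 * L * real (card B))) * L2_norm M F" .
  qed (use t in simp)
  also have "\<dots> = sqrt (L + 2 * L * real (card B) / t) * L2_norm M F"
  proof -
    have "t * (t * L + 2 * L * real (card B)) = t\<^sup>2 * (L + 2 * L * real (card B) / t)"
      using t by (simp add: power2_eq_square field_simps)
    hence "sqrt (t * (t * L + 2 * L * real (card B))) = t * sqrt (L + 2 * L * real (card B) / t)"
      using t by (simp add: real_sqrt_mult)
    thus ?thesis using t by simp
  qed
  finally show ?thesis .
qed

lemma funpow_V_L2: "p > 0 \<Longrightarrow> F \<in> L2 M \<Longrightarrow> (V p ^^ i) F \<in> L2 M"
  by (induction i) (auto intro: V_L2)

lemma almost_invariant_iterates:
  assumes p: "p > 0" and F: "F \<in> L2 M" and e: "L2_norm M (\<lambda>x. V p F x - F x) \<le> e"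
  shows "L2_norm M (\<lambda>x. (V p ^^ i) F x - F x) \<le> real i * e"
proof (induction i)
  case (Suc i)
  have L: "(V p ^^ i) F \<in> L2 M" by (rule funpow_V_L2[OF p F])
  have "L2_norm M (\<lambda>x. (V p ^^ Suc i) F x - F x) \<le>
     L2_norm M (\<lambda>x. V p ((V p ^^ i) F) x - V p F x) + L2_norm M (\<lambda>x. V p F x - F x)"
    using L2_norm_diff_triangle[OF V_L2[OF p L] V_L2[OF p F] F] by simp
  also have "L2_norm M (\<lambda>x. V p ((V p ^^ i) F) x - V p F x) = L2_norm M (V p (\<lambda>x. (V p ^^ i) F x - F x))"
    by (simp only: V_diff)
  also have "\<dots> \<le> L2_norm M (\<lambda>x. (V p ^^ i) F x - F x)" by (rule V_norm_le[OF p L2_diff[OF L F]])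
  finally show ?case using Suc e by (simp add: algebra_simps)
qed simp

text \<open>The sum of the iterates of \<open>V p\<close> on the coboundary \<open>H\<close> telescopes.\<close>

lemma coboundary_norm_le:
  fixes n :: nat
  assumes p: "p > 0" and G: "G \<in> L2 M" and H: "H = (\<lambda>x. V p G x - G x)"
    and e: "L2_norm M (\<lambda>x. V p H x - H x) \<le> e"
  shows "real n * L2_norm M H \<le> 2 * L2_norm M G + (real n)\<^sup>2 * e"
proof -
  have HL: "H \<in> L2 M" unfolding H by (rule L2_diff[OF V_L2[OF p G] G])
  have e0: "e \<ge> 0" using e L2_norm_nonneg by (rule order.trans[rotated])
  have HiL: "(V p ^^ i) H \<in> L2 M" for i by (rule funpow_V_L2[OF p HL])
  have tele: "(\<Sum>i<m. (V p ^^ i) H x) = (V p ^^ m) G x - G x" for m x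
  proof (induction m arbitrary: x)
    case (Suc m)
    have it: "(V p ^^ m) H = (\<lambda>x. (V p ^^ Suc m) G x - (V p ^^ m) G x)"
    proof (induction m)
      case (Suc m)
      have "(V p ^^ Suc m) H = V p ((V p ^^ m) H)" by simp
      also have "\<dots> = (\<lambda>x. (V p ^^ Suc (Suc m)) G x - (V p ^^ Suc m) G x)"
        unfolding Suc V_diff by simp
      finally show ?case .
    qed (simp add: H)
    show ?case using Suc[of x] by (simp add: it)
  qed simp
  have "(V p ^^ n) G \<in> L2 M \<and> L2_norm M ((V p ^^ n) G) \<le> L2_norm M G"
  proof (induction n)
    case (Suc n)
    thus ?case using V_norm_le[OF p, of "(V p ^^ n) G"] V_L2[OF p, of "(V p ^^ n) G"] by simp
  qed (use G in simp)
  hence a: "L2_norm M (\<lambda>x. \<Sum>i<n. (V p ^^ i) H x) \<le> 2 * L2_norm M G"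
    using L2_norm_triangle_diff[of "(V p ^^ n) G" M G] G by (simp add: tele)
  have b: "L2_norm M (\<lambda>x. \<Sum>i<n. ((V p ^^ i) H x - H x)) \<le> (\<Sum>i<n. real i * e)"
    by (rule order.trans[OF L2_norm_sum_le[OF L2_diff[OF HiL HL]]]) (intro sum_mono almost_invariant_iterates p HL e)
  have "(\<Sum>i<n. real i * e) \<le> (\<Sum>i<n. real n * e)" using e0 by (intro sum_mono mult_right_mono) auto
  hence b': "(\<Sum>i<n. real i * e) \<le> (real n)\<^sup>2 * e" by (simp add: power2_eq_square)
  have eq: "(\<lambda>x. of_nat n * H x) = (\<lambda>x. (\<Sum>i<n. (V p ^^ i) H x) - (\<Sum>i<n. ((V p ^^ i) H x - H x)))"
    by (simp add: sum_subtractf)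
  have "real n * L2_norm M H = L2_norm M (\<lambda>x. of_nat n * H x)" by (simp add: L2_norm_scale)
  also have "\<dots> \<le> L2_norm M (\<lambda>x. \<Sum>i<n. (V p ^^ i) H x) + L2_norm M (\<lambda>x. \<Sum>i<n. ((V p ^^ i) H x - H x))"
    unfolding eq by (intro L2_norm_triangle_diff L2_sum HiL L2_diff HL)
  finally show ?thesis using a b b' by linarith
qed

text \<open>\<open>L\<close> is the limsup of the norms, packaged as an eventual upper bound and a
  recurring lower bound.\<close>

lemma limsup_A_exists:
  assumes F: "F \<in> L2 M" and nl: "\<not> ((\<lambda>t. L2_norm M (A F t)) \<longlongrightarrow> 0) at_top"
  obtains L where "L > 0" "\<And>\<epsilon>. \<epsilon> > 0 \<Longrightarrow> eventually (\<lambda>t. L2_norm M (A F t) \<le> L + \<epsilon>) at_top"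
    "\<And>\<epsilon> T. \<epsilon> > 0 \<Longrightarrow> \<exists>t\<ge>T. L2_norm M (A F t) \<ge> L - \<epsilon>"
proof -
  define E where "E = {c. eventually (\<lambda>t. L2_norm M (A F t) \<le> c) at_top}"
  define L where "L = Inf E"
  have "eventually (\<lambda>t. L2_norm M (A F t) \<le> L2_norm M F) at_top"
    using eventually_gt_at_top[of 0] by eventually_elim (rule A_norm_le[OF F])
  hence ne: "E \<noteq> {}" by (auto simp: E_def)
  have nonneg: "c \<ge> 0" if "c \<in> E" for c
  proof -
    obtain t where "L2_norm M (A F t) \<le> c"
      using \<open>c \<in> E\<close> unfolding E_def eventually_at_top_linorder by auto
    thus ?thesis using L2_norm_nonneg order.trans by blast
  qed
  have bdd: "bdd_below E" using nonneg by (rule bdd_belowI)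
  have L0: "L \<ge> 0" unfolding L_def using ne nonneg by (rule cInf_greatest)
  have up: "eventually (\<lambda>t. L2_norm M (A F t) \<le> L + \<epsilon>) at_top" if "\<epsilon> > 0" for \<epsilon>
  proof -
    have "Inf E < L + \<epsilon>" using that by (simp add: L_def)
    then obtain c where c: "c \<in> E" "c < L + \<epsilon>" using cInf_less_iff[OF ne bdd] by blast
    from c(1) have "eventually (\<lambda>t. L2_norm M (A F t) \<le> c) at_top" by (simp add: E_def)
    thus ?thesis by eventually_elim (use c(2) in linarith)
  qed
  have freq: "\<exists>t\<ge>T. L2_norm M (A F t) \<ge> L - \<epsilon>" if "\<epsilon> > 0" for \<epsilon> T
  proof (rule ccontr)
    assume "\<not> (\<exists>t\<ge>T. L2_norm M (A F t) \<ge> L - \<epsilon>)"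
    hence "\<And>t. t \<ge> T \<Longrightarrow> L2_norm M (A F t) \<le> L - \<epsilon>" by force
    hence "L - \<epsilon> \<in> E" unfolding E_def by (auto simp: eventually_at_top_linorder)
    hence "L \<le> L - \<epsilon>" unfolding L_def using bdd by (rule cInf_lower)
    with that show False by simp
  qed
  have "L \<noteq> 0"
  proof
    assume L: "L = 0"
    have "((\<lambda>t. L2_norm M (A F t)) \<longlongrightarrow> 0) at_top"
    proof (rule tendstoI)
      fix e :: real assume "e > 0"
      hence "eventually (\<lambda>t. L2_norm M (A F t) \<le> L + e / 2) at_top" by (intro up) simp
      thus "eventually (\<lambda>t. dist (L2_norm M (A F t)) 0 < e) at_top"
        by eventually_elim (use L \<open>e > 0\<close> in \<open>simp add: dist_norm\<close>)
    qed
    with nl show False by contradiction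
  qed
  with L0 have "L > 0" by simp
  thus ?thesis using up freq by (rule that)
qed

text \<open>As \<open>V p\<close> commutes with every \<open>V n\<close>, the average of a
  coboundary is again a coboundary, of \<open>A G t\<close>, whose norm stays bounded by that of
  \<open>G\<close> at every scale.\<close>

lemma A_coboundary:
  assumes p: "p > 0"
  shows "A (\<lambda>x. V p G x - G x) t = (\<lambda>x. V p (A G t) x - A G t x)"
proof -
  have "Z (\<lambda>x. V p G x - G x) t = (\<lambda>x. V p (Z G t) x - Z G t x)"
  proof
    fix x
    have "Z (\<lambda>x. V p G x - G x) t x = (\<Sum>n\<in>nat_upto t. V n (V p G) x - V n G x)"
      by (simp only: Z_def V_diff)
    also have "\<dots> = (\<Sum>n\<in>nat_upto t. V p (V n G) x - V n G x)"
      by (intro sum.cong refl) (simp only: V_commute[OF nat_upto_pos p])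
    also have "\<dots> = V p (Z G t) x - Z G t x" by (simp only: sum_subtractf Z_def V_sum)
    finally show "Z (\<lambda>x. V p G x - G x) t x = V p (Z G t) x - Z G t x" .
  qed
  thus ?thesis by (simp only: A_def V_scale right_diff_distrib)
qed

text \<open>Were the limsup positive, \<open>slow_variation\<close> would give a scale
  \<open>y\<close> with \<open>A F (y / q)\<close> close to \<open>A F y\<close> for all
  \<open>q\<close> in a large set \<open>B\<close>; Turan-Kubilius then makes \<open>A F y\<close>
  almost invariant under \<open>V p\<close>. An almost invariant coboundary is small by
  \<open>coboundary_norm_le\<close>, which contradicts the norm at \<open>y\<close>.\<close>

proposition coboundary_averages:
  assumes fg: "finitely_generated S" and p: "p > 0"
    and big: "\<not> thin {q. prime q \<and> S q = S p \<and> chi q = chi p}"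
    and G: "G \<in> L2 M"
  shows "((\<lambda>t. L2_norm M (A (\<lambda>x. V p G x - G x) t)) \<longlongrightarrow> 0) at_top"
proof (rule ccontr)
  define F where "F = (\<lambda>x. V p G x - G x)"
  assume "\<not> ((\<lambda>t. L2_norm M (A (\<lambda>x. V p G x - G x) t)) \<longlongrightarrow> 0) at_top"
  hence nl: "\<not> ((\<lambda>t. L2_norm M (A F t)) \<longlongrightarrow> 0) at_top" unfolding F_def .
  have F: "F \<in> L2 M" unfolding F_def by (rule L2_diff[OF V_L2[OF p G] G])
  obtain L where L: "L > 0" "\<And>\<epsilon>. \<epsilon> > 0 \<Longrightarrow> eventually (\<lambda>t. L2_norm M (A F t) \<le> L + \<epsilon>) at_top"
    "\<And>\<epsilon> T. \<epsilon> > 0 \<Longrightarrow> \<exists>t\<ge>T. L2_norm M (A F t) \<ge> L - \<epsilon>"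
    using limsup_A_exists[OF F nl] by blast
  define K where "K = L2_norm M F + 1"
  have K: "K > 0" "L2_norm M F \<le> K" by (auto simp: K_def add_nonneg_pos)
  have AL: "A F u \<in> L2 M" for u by (rule A_L2[OF F])
  have approx: "\<exists>y>0. L2_norm M (A F y) \<ge> L - e \<and> L2_norm M (\<lambda>x. V p (A F y) x - A F y x) \<le> e" if e: "e > 0" for e
  proof -
    \<comment> \<open>The threshold is equivalent to
      \<open>sqrt (2 * L') * K \<le> L' * (e / 2)\<close>: the Turan-Kubilius error grows only like
      the square root of the reciprocal sum.\<close>
    obtain B where B: "finite B" "B \<subseteq> {q. prime q \<and> S q = S p \<and> chi q = chi p}"
      "(\<Sum>q\<in>B. 1 / real q) > 8 * K\<^sup>2 / e\<^sup>2"
      using not_thinD[OF big] by blast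
    define L' where "L' = (\<Sum>q\<in>B. 1 / real q)"
    have L': "L' > 0" "8 * K\<^sup>2 / e\<^sup>2 < L'"
    proof -
      show "8 * K\<^sup>2 / e\<^sup>2 < L'" using B(3) by (simp add: L'_def)
      moreover have "8 * K\<^sup>2 / e\<^sup>2 \<ge> 0" by simp
      ultimately show "L' > 0" by linarith
    qed
    define R where "R = real (Max (insert 1 B))"
    have R: "R \<ge> 1" "\<And>q. q \<in> B \<Longrightarrow> real q \<le> R" unfolding R_def using B(1) by simp_all
    \<comment> \<open>\<open>y \<ge> 2 * card B\<close> bounds the rounding term in Turan-Kubilius
      by \<open>L'\<close>, and \<open>R\<close> makes the window reach every
      \<open>y / q\<close>.\<close>
    obtain y where y: "y \<ge> max 1 (2 * real (card B))" "L2_norm M (A F y) \<ge> L - e / 2"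
      "\<And>z. y / R \<le> z \<Longrightarrow> z \<le> y \<Longrightarrow> L2_norm M (\<lambda>x. A F z x - A F y x) \<le> e / 2"
      using slow_variation[OF fg F L(1) L(2) L(3), of "e / 2" R "max 1 (2 * real (card B))"] e R by auto
    have y0: "y > 0" using y(1) by simp
    have VB: "V q = V p" if "q \<in> B" for q using that B(2) by (auto simp: V_def fun_eq_iff)
    have qpos: "q > 0" if "q \<in> B" for q using that B(2) prime_gt_0_nat by auto
    have 1: "L2_norm M (\<lambda>x. of_real L' * A F y x - (\<Sum>q\<in>B. of_real (1 / real q) * V p (A F (y / real q)) x)) \<le> L' * (e / 2)"
    proof -
      have "L2_norm M (\<lambda>x. of_real L' * A F y x - (\<Sum>q\<in>B. of_real (1 / real q) * V p (A F (y / real q)) x))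
        \<le> sqrt (L' + 2 * L' * real (card B) / y) * L2_norm M F"
        unfolding L'_def using B VB by (intro turan_kubilius_average[OF F] y0) auto
      also have "\<dots> \<le> sqrt (2 * L') * K"
      proof (intro mult_mono real_sqrt_le_mono K)
        have "L' * (2 * real (card B)) \<le> L' * y" using y(1) L' by (intro mult_left_mono) auto
        hence "2 * L' * real (card B) / y \<le> L'" using y0 by (simp add: pos_divide_le_eq mult_ac)
        thus "L' + 2 * L' * real (card B) / y \<le> 2 * L'" by simp
      qed (use L' in auto)
      also have "\<dots> \<le> L' * (e / 2)"
      proof (rule power2_le_imp_le)
        have "8 * K\<^sup>2 \<le> L' * e\<^sup>2" using L'(2) e by (simp add: pos_divide_less_eq)
        hence "L' * (8 * K\<^sup>2) \<le> L' * (L' * e\<^sup>2)" using L' by (intro mult_left_mono) auto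
        moreover have "(sqrt (2 * L') * K)\<^sup>2 = 2 * L' * K\<^sup>2" using L'(1) by (simp add: power_mult_distrib)
        moreover have "(L' * (e / 2))\<^sup>2 = L' * (L' * e\<^sup>2) / 4" by (simp add: power2_eq_square)
        ultimately show "(sqrt (2 * L') * K)\<^sup>2 \<le> (L' * (e / 2))\<^sup>2" by linarith
      qed (use L' e in simp)
      finally show ?thesis .
    qed
    have 2: "L2_norm M (\<lambda>x. (\<Sum>q\<in>B. of_real (1 / real q) * V p (A F (y / real q)) x) - of_real L' * V p (A F y) x) \<le> L' * (e / 2)"
    proof -
      have eq: "(\<lambda>x. (\<Sum>q\<in>B. of_real (1 / real q) * V p (A F (y / real q)) x) - of_real L' * V p (A F y) x) =
        (\<lambda>x. \<Sum>q\<in>B. of_real (1 / real q) * V p (\<lambda>x. A F (y / real q) x - A F y x) x)"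
        by (simp add: L'_def V_diff sum_subtractf sum_distrib_right algebra_simps)
      have "L2_norm M (\<lambda>x. (\<Sum>q\<in>B. of_real (1 / real q) * V p (A F (y / real q)) x) - of_real L' * V p (A F y) x) \<le>
        (\<Sum>q\<in>B. L2_norm M (\<lambda>x. of_real (1 / real q) * V p (\<lambda>x. A F (y / real q) x - A F y x) x))"
        unfolding eq by (rule L2_norm_sum_le, rule L2_scale, rule V_L2[OF p L2_diff[OF AL AL]])
      also have "\<dots> \<le> (\<Sum>q\<in>B. 1 / real q * (e / 2))"
      proof (rule sum_mono)
        fix q assume q: "q \<in> B"
        have "L2_norm M (V p (\<lambda>x. A F (y / real q) x - A F y x)) \<le> L2_norm M (\<lambda>x. A F (y / real q) x - A F y x)"
          by (rule V_norm_le[OF p L2_diff[OF AL AL]])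
        also have "\<dots> \<le> e / 2"
        proof (rule y(3))
          show "y / R \<le> y / real q" using R q y0 qpos[OF q] by (intro divide_left_mono) auto
          have "y / real q \<le> y / 1" using y0 qpos[OF q] by (intro divide_left_mono) auto
          thus "y / real q \<le> y" by simp
        qed
        finally have "1 / real q * L2_norm M (V p (\<lambda>x. A F (y / real q) x - A F y x)) \<le> 1 / real q * (e / 2)"
          by (rule mult_left_mono) simp
        thus "L2_norm M (\<lambda>x. of_real (1 / real q) * V p (\<lambda>x. A F (y / real q) x - A F y x) x) \<le> 1 / real q * (e / 2)"
          by (simp only: L2_norm_scale norm_of_real) simp
      qed
      also have "\<dots> = L' * (e / 2)" by (simp only: L'_def sum_distrib_right)
      finally show ?thesis .
    qed
    have SL: "(\<lambda>x. \<Sum>q\<in>B. of_real (1 / real q) * V p (A F (y / real q)) x) \<in> L2 M"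
      by (rule L2_sum, rule L2_scale, rule V_L2[OF p AL])
    have "L' * L2_norm M (\<lambda>x. A F y x - V p (A F y) x) = L2_norm M (\<lambda>x. of_real L' * A F y x - of_real L' * V p (A F y) x)"
      using L' by (simp add: L2_norm_scale flip: right_diff_distrib)
    also have "\<dots> \<le> L' * (e / 2) + L' * (e / 2)"
      using L2_norm_diff_triangle[OF L2_scale[OF AL[of y], of "of_real L'"] SL L2_scale[OF V_L2[OF p AL[of y]], of "of_real L'"]] 1 2
      by linarith
    also have "\<dots> = L' * e" by simp
    finally have "L2_norm M (\<lambda>x. A F y x - V p (A F y) x) \<le> e" by (rule mult_left_le_imp_le) (rule L'(1))
    hence "L2_norm M (\<lambda>x. V p (A F y) x - A F y x) \<le> e" by (subst L2_norm_minus_commute)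
    moreover have "L2_norm M (A F y) \<ge> L - e" using y(2) e by linarith
    ultimately show ?thesis using y0 by blast
  qed
  \<comment> \<open>With \<open>e = L / (4 n)\<close>, the left side of
    \<open>coboundary_norm_le\<close> is at least \<open>n L - L / 4\<close>, while the right side
    is below \<open>n L / 4 + n L / 4\<close>; this is impossible for
    \<open>n \<ge> 1\<close>.\<close>
  obtain n :: nat where n: "real n > 8 * L2_norm M G / L" using reals_Archimedean2 by blast
  have "8 * L2_norm M G / L \<ge> 0" using L(1) by simp
  hence n0: "real n > 0" using n by linarith
  define e where "e = L / (4 * real n)"
  have e: "e > 0" using L(1) n0 by (simp add: e_def)
  obtain y where y: "y > 0" "L2_norm M (A F y) \<ge> L - e" "L2_norm M (\<lambda>x. V p (A F y) x - A F y x) \<le> e"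
    using approx[OF e] by blast
  have AG: "A F y = (\<lambda>x. V p (A G y) x - A G y x)" unfolding F_def by (rule A_coboundary[OF p])
  have "real n * L2_norm M (A F y) \<le> 2 * L2_norm M (A G y) + (real n)\<^sup>2 * e"
    by (rule coboundary_norm_le[OF p A_L2[OF G] AG y(3)])
  moreover have "L2_norm M (A G y) \<le> L2_norm M G" by (rule A_norm_le[OF G y(1)])
  moreover have "real n * (L - e) \<le> real n * L2_norm M (A F y)" using y(2) n0 by (intro mult_left_mono) auto
  moreover have "real n * e = L / 4" using n0 by (simp add: e_def)
  moreover from this have "(real n)\<^sup>2 * e = real n * L / 4" by (simp add: power2_eq_square mult.assoc)
  moreover have "8 * L2_norm M G < real n * L" using n L(1) by (simp add: pos_divide_less_eq)
  moreover have "real n * L \<ge> 1 * L" using n0 L(1) by (intro mult_right_mono) auto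
  moreover have "real n * (L - e) = real n * L - real n * e" by (simp add: right_diff_distrib)
  ultimately show False using L(1) by linarith
qed

end

subsection \<open>Pretentious spaces\<close>

definition bounded_sums :: "(nat \<Rightarrow> real) \<Rightarrow> nat set \<Rightarrow> bool" where
  "bounded_sums g X \<longleftrightarrow> (\<exists>C. \<forall>B. finite B \<longrightarrow> B \<subseteq> X \<longrightarrow> (\<Sum>p\<in>B. g p) \<le> C)"

lemma infsum_ennreal_finite_iff:
  assumes "\<And>p. p \<in> X \<Longrightarrow> g p \<ge> 0"
  shows "(\<Sum>\<^sub>\<infinity>p\<in>X. ennreal (g p)) < \<infinity> \<longleftrightarrow> bounded_sums g X"
proof -
  have eq: "(\<Sum>\<^sub>\<infinity>p\<in>X. ennreal (g p)) = (SUP B\<in>{B. finite B \<and> B \<subseteq> X}. \<Sum>p\<in>B. ennreal (g p))"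
    by (rule nonneg_infsum_complete) simp
  have se: "(\<Sum>p\<in>B. ennreal (g p)) = ennreal (\<Sum>p\<in>B. g p)" if "B \<subseteq> X" for B
    using that assms by (intro sum_ennreal) auto
  show ?thesis
  proof
    assume fin: "(\<Sum>\<^sub>\<infinity>p\<in>X. ennreal (g p)) < \<infinity>"
    then obtain C where C: "C \<ge> 0" "(\<Sum>\<^sub>\<infinity>p\<in>X. ennreal (g p)) = ennreal C" by (cases "\<Sum>\<^sub>\<infinity>p\<in>X. ennreal (g p)") auto
    show "bounded_sums g X" unfolding bounded_sums_def
    proof (intro exI[of _ C] allI impI)
      fix B assume B: "finite B" "B \<subseteq> X"
      have "ennreal (\<Sum>p\<in>B. g p) \<le> ennreal C"
        unfolding C(2)[symmetric] eq se[OF B(2), symmetric] using B by (intro SUP_upper) auto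
      thus "(\<Sum>p\<in>B. g p) \<le> C" using C(1) by (simp add: ennreal_le_iff)
    qed
  next
    assume "bounded_sums g X"
    then obtain C where C: "\<And>B. finite B \<Longrightarrow> B \<subseteq> X \<Longrightarrow> (\<Sum>p\<in>B. g p) \<le> C" unfolding bounded_sums_def by blast
    have "(\<Sum>\<^sub>\<infinity>p\<in>X. ennreal (g p)) \<le> ennreal C"
      unfolding eq
    proof (rule SUP_least)
      fix B assume "B \<in> {B. finite B \<and> B \<subseteq> X}"
      thus "(\<Sum>p\<in>B. ennreal (g p)) \<le> ennreal C" using C[of B] by (auto simp: se intro: ennreal_leI)
    qed
    thus "(\<Sum>\<^sub>\<infinity>p\<in>X. ennreal (g p)) < \<infinity>" by (rule le_less_trans) simp
  qed
qed

lemma bounded_sums_finite_perturb: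
  assumes "bounded_sums g X" and E: "finite E" "c \<ge> 0"
    and le: "\<And>p. p \<in> X \<Longrightarrow> h p \<le> g p + (if p \<in> E then c else 0)"
  shows "bounded_sums h X"
proof -
  obtain C where C: "\<And>B. finite B \<Longrightarrow> B \<subseteq> X \<Longrightarrow> (\<Sum>p\<in>B. g p) \<le> C" using assms(1) unfolding bounded_sums_def by blast
  show ?thesis unfolding bounded_sums_def
  proof (intro exI[of _ "C + c * real (card E)"] allI impI)
    fix B assume B: "finite B" "B \<subseteq> X"
    have "(\<Sum>p\<in>B. h p) \<le> (\<Sum>p\<in>B. g p + (if p \<in> E then c else 0))" using B(2) by (intro sum_mono le) auto
    also have "\<dots> = (\<Sum>p\<in>B. g p) + c * real (card (B \<inter> E))"
      using B by (simp add: sum.distrib sum.If_cases Int_def)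
    also have "\<dots> \<le> C + c * real (card E)"
      using E B by (intro add_mono C mult_left_mono of_nat_mono card_mono) auto
    finally show "(\<Sum>p\<in>B. h p) \<le> C + c * real (card E)" .
  qed
qed

text \<open>Finitely many numerators leave a positive minimum among the nonzero ones. This turns a
  quantitative convergence condition into exact vanishing off a thin set.\<close>

lemma bounded_sums_imp_thin:
  assumes "bounded_sums (\<lambda>p. v p / real p) X" "\<And>p. p \<in> X \<Longrightarrow> v p \<ge> 0" and fin: "finite (v ` X)"
  shows "thin {p\<in>X. v p \<noteq> 0}"
proof -
  obtain C where C: "\<And>B. finite B \<Longrightarrow> B \<subseteq> X \<Longrightarrow> (\<Sum>p\<in>B. v p / real p) \<le> C" using assms(1) unfolding bounded_sums_def by blast
  define d where "d = Min (insert 1 (v ` X - {0}))"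
  have "d \<in> insert 1 (v ` X - {0})" unfolding d_def using fin by (intro Min_in) auto
  hence d0: "d > 0" using assms(2) by force
  have dle: "d \<le> v p" if "p \<in> X" "v p \<noteq> 0" for p unfolding d_def using fin that by (intro Min_le) auto
  show ?thesis unfolding thin_def
  proof (intro exI[of _ "C / d"] allI impI)
    fix B assume B: "finite B" "B \<subseteq> {p\<in>X. v p \<noteq> 0}"
    have "d * (\<Sum>p\<in>B. 1 / real p) = (\<Sum>p\<in>B. d / real p)" by (simp add: sum_distrib_left)
    also have "\<dots> \<le> (\<Sum>p\<in>B. v p / real p)" using B dle by (intro sum_mono divide_right_mono) auto
    also have "\<dots> \<le> C" using B by (intro C) auto
    finally show "(\<Sum>p\<in>B. 1 / real p) \<le> C / d" using d0 by (simp add: pos_le_divide_eq mult.commute)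
  qed
qed

lemma sqrt_ennreal_finite_iff: "sqrt_ennreal x < \<infinity> \<longleftrightarrow> x < \<infinity>"
  by (auto simp: sqrt_ennreal_def less_top)

lemma half_ennreal_finite_iff: "(1 / 2) * (x :: ennreal) < \<infinity> \<longleftrightarrow> x < \<infinity>"
  by (auto simp: ennreal_mult_less_top ennreal_mult_eq_top_iff ennreal_divide_eq_top_iff less_top[symmetric])

lemma pretentious_dist_finite_iff:
  assumes "\<And>p. prime p \<Longrightarrow> cmod (f p) \<le> 1" "\<And>p. prime p \<Longrightarrow> cmod (g p) \<le> 1"
  shows "pretentious_dist f g < \<infinity> \<longleftrightarrow> bounded_sums (\<lambda>p. (1 - Re (f p * cnj (g p))) / real p) {p. prime p}"
  unfolding pretentious_dist_def sqrt_ennreal_finite_iff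
proof (rule infsum_ennreal_finite_iff)
  fix p :: nat assume "p \<in> {p. prime p}"
  hence "cmod (f p * cnj (g p)) \<le> 1 * 1" unfolding norm_mult using assms by (intro mult_mono) auto
  hence "Re (f p * cnj (g p)) \<le> 1" using complex_Re_le_cmod[of "f p * cnj (g p)"] by linarith
  thus "(1 - Re (f p * cnj (g p))) / real p \<ge> 0" by simp
qed

context multiplicative_system
begin

definition defect :: "(nat \<Rightarrow> complex) \<Rightarrow> ('a \<Rightarrow> complex) \<Rightarrow> nat \<Rightarrow> real" where
  "defect f F p = L2_norm M (\<lambda>x. F (S p x) - f p * F x)"

lemma defect_L2: "p > 0 \<Longrightarrow> F \<in> L2 M \<Longrightarrow> (\<lambda>x. F (S p x) - f p * F x) \<in> L2 M"
  by (intro L2_diff L2_comp_S L2_scale)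

lemma defect_eq_0_iff:
  "p > 0 \<Longrightarrow> F \<in> L2 M \<Longrightarrow> defect f F p = 0 \<longleftrightarrow> (AE x in M. F (S p x) = f p * F x)"
  unfolding defect_def by (subst L2_norm_eq_0_iff) (auto intro: defect_L2)

lemma pretentious_space_iff_bounded_sums:
  "F \<in> pretentious_space M S f \<longleftrightarrow> F \<in> L2 M \<and> bounded_sums (\<lambda>p. (defect f F p)\<^sup>2 / real p) {p. prime p}"
  unfolding pretentious_space_def dist_along_def sqrt_ennreal_finite_iff half_ennreal_finite_iff defect_def
  by (subst infsum_ennreal_finite_iff) auto

lemma finite_prime_actions:
  assumes fg: "finitely_generated S" and chi: "dirichlet_character k chi"
  shows "finite ((\<lambda>p. (S p, chi p)) ` {p. prime p})"
proof (rule finite_subset)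
  show "(\<lambda>p. (S p, chi p)) ` {p. prime p} \<subseteq> S ` {p. prime p} \<times> range chi" by auto
  show "finite (S ` {p. prime p} \<times> range chi)"
    using fg finite_range_dirichlet_character[OF chi] unfolding finitely_generated_def by (rule finite_cartesian_product)
qed

text \<open>The defect depends only on the pair \<open>(S p, chi p)\<close>, so it takes finitely
  many values and \<open>bounded_sums_imp_thin\<close> applies. Conversely each defect is at most
  twice the norm of \<open>F\<close>.\<close>

lemma pretentious_space_iff_thin:
  assumes fg: "finitely_generated S" and chi: "dirichlet_character k chi"
  shows "F \<in> pretentious_space M S chi \<longleftrightarrow> F \<in> L2 M \<and> thin {p. prime p \<and> defect chi F p \<noteq> 0}"
proof (cases "F \<in> L2 M")
  case F: True
  show ?thesis
  proof
    assume "F \<in> pretentious_space M S chi"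
    hence bs: "bounded_sums (\<lambda>p. (defect chi F p)\<^sup>2 / real p) {p. prime p}"
      by (simp add: pretentious_space_iff_bounded_sums)
    have "(\<lambda>p. (defect chi F p)\<^sup>2) ` {p. prime p} =
      (\<lambda>(s, c). (L2_norm M (\<lambda>x. F (s x) - c * F x))\<^sup>2) ` (\<lambda>p. (S p, chi p)) ` {p. prime p}"
      by (simp add: defect_def image_image)
    hence "finite ((\<lambda>p. (defect chi F p)\<^sup>2) ` {p. prime p})"
      using finite_imageI[OF finite_prime_actions[OF fg chi]] by (simp only:)
    from bounded_sums_imp_thin[OF bs _ this] F show "F \<in> L2 M \<and> thin {p. prime p \<and> defect chi F p \<noteq> 0}" by simp
  next
    assume R: "F \<in> L2 M \<and> thin {p. prime p \<and> defect chi F p \<noteq> 0}"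
    define Q where "Q = {p. prime p \<and> defect chi F p \<noteq> 0}"
    obtain C where C: "\<And>B. finite B \<Longrightarrow> B \<subseteq> Q \<Longrightarrow> (\<Sum>p\<in>B. 1 / real p) \<le> C"
      using R unfolding Q_def[symmetric] thin_def by blast
    define K where "K = (2 * L2_norm M F)\<^sup>2"
    have "bounded_sums (\<lambda>p. (defect chi F p)\<^sup>2 / real p) {p. prime p}"
      unfolding bounded_sums_def
    proof (intro exI[of _ "K * C"] allI impI)
      fix B :: "nat set" assume B: "finite B" "B \<subseteq> {p. prime p}"
      have "(\<Sum>p\<in>B. (defect chi F p)\<^sup>2 / real p) = (\<Sum>p\<in>B \<inter> Q. (defect chi F p)\<^sup>2 / real p)"
        using B by (intro sum.mono_neutral_right) (auto simp: Q_def)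
      also have "\<dots> \<le> (\<Sum>p\<in>B \<inter> Q. K * (1 / real p))"
      proof (rule sum_mono)
        fix p assume "p \<in> B \<inter> Q"
        hence p: "p > 0" by (auto simp: Q_def prime_gt_0_nat)
        have "defect chi F p \<le> L2_norm M (\<lambda>x. F (S p x)) + L2_norm M (\<lambda>x. chi p * F x)"
          unfolding defect_def by (intro L2_norm_triangle_diff L2_comp_S L2_scale p F)
        also have "\<dots> = L2_norm M F + cmod (chi p) * L2_norm M F"
          using p F by (simp add: L2_norm_comp_S L2_norm_scale)
        also have "cmod (chi p) * L2_norm M F \<le> 1 * L2_norm M F"
          by (intro mult_right_mono norm_dirichlet_character_le_1[OF chi]) simp
        finally have "(defect chi F p)\<^sup>2 \<le> K" unfolding K_def by (intro power_mono) (auto simp: defect_def)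
        from divide_right_mono[OF this, of "real p"] show "(defect chi F p)\<^sup>2 / real p \<le> K * (1 / real p)" by simp
      qed
      also have "\<dots> = K * (\<Sum>p\<in>B \<inter> Q. 1 / real p)" by (simp only: sum_distrib_left)
      also have "\<dots> \<le> K * C" using B by (intro mult_left_mono C) (auto simp: K_def)
      finally show "(\<Sum>p\<in>B. (defect chi F p)\<^sup>2 / real p) \<le> K * C" .
    qed
    with R show "F \<in> pretentious_space M S chi" by (simp add: pretentious_space_iff_bounded_sums)
  qed
qed (simp add: pretentious_space_def)

lemma pretentious_space_one_iff_thin:
  assumes fg: "finitely_generated S"
  shows "F \<in> pretentious_space M S (\<lambda>_. 1) \<longleftrightarrow> F \<in> L2 M \<and> thin {p. prime p \<and> defect (\<lambda>_. 1) F p \<noteq> 0}"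
  by (rule pretentious_space_iff_thin[OF fg dirichlet_character_one])

lemma AE_eigenfunction:
  assumes chi: "dirichlet_character k chi" and F: "F \<in> L2 M" and n: "n > 0"
    and p: "\<And>p. prime p \<Longrightarrow> p dvd n \<Longrightarrow> defect chi F p = 0"
  shows "AE x in M. F (S n x) = chi n * F x"
  using n p
proof (induction n rule: prime_divisors_induct)
  case (unit n)
  hence "n = 1" by simp
  show ?case unfolding \<open>n = 1\<close> S_1 dirichlet_character_1[OF chi] by simp
next
  case (factor p n)
  have pos: "p > 0" "n > 0" using factor by auto
  note [measurable] = L2_measurable[OF F] S_measurable[OF pos(1)] S_measurable[OF pos(2)]
  have n: "AE x in M. F (S n x) = chi n * F x" using factor by auto
  have "defect chi F p = 0" using factor by auto
  hence "AE x in M. F (S p x) = chi p * F x" using defect_eq_0_iff[OF pos(1) F] by simp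
  hence "AE x in M. F (S p (S n x)) = chi p * F (S n x)" by (rule AE_comp_S[OF pos(2)]) measurable
  with n show ?case
    by eventually_elim (simp add: S_mult[OF pos] dirichlet_character_mult[OF chi])
qed simp

text \<open>Along \<open>q * n + 1\<close> with \<open>k\<close> dividing \<open>q\<close> the
  character is 1, so \<open>F\<close> is unchanged by \<open>S (q * n + 1)\<close> unless an
  exceptional prime divides this number. The averages thus stay close to \<open>F\<close> while
  aperiodicity sends them to the integral.\<close>

lemma aperiodic_imp_AE_const:
  assumes ap: "aperiodic M S" and fg: "finitely_generated S" and chi: "dirichlet_character k chi"
    and FH: "F \<in> pretentious_space M S chi"
  shows "AE x in M. F x = (\<integral>y. F y \<partial>M)"
proof -
  define c where "c = (\<integral>y. F y \<partial>M)"
  define K where "K = L2_norm M F"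
  define Q where "Q = {p. prime p \<and> defect chi F p \<noteq> 0}"
  have F: "F \<in> L2 M" and Q: "thin Q"
    using FH pretentious_space_iff_thin[OF fg chi] by (auto simp: Q_def)
  have Fc: "(\<lambda>x. F x - c) \<in> L2 M" by (intro L2_diff F L2_const)
  have k: "k > 0" using chi by (simp add: dirichlet_character_def)
  \<comment> \<open>At most \<open>3 * \<epsilon> * N\<close> indices are bad, and each contributes
    a vector of norm at most \<open>2 * K\<close>.\<close>
  have main: "L2_norm M (\<lambda>x. F x - c) \<le> \<epsilon> * (6 * K)" if eps: "\<epsilon> > 0" for \<epsilon>
  proof -
    obtain y where y: "\<And>B. finite B \<Longrightarrow> B \<subseteq> {p\<in>Q. p > y} \<Longrightarrow> (\<Sum>p\<in>B. 1 / real p) \<le> \<epsilon>"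
      using thin_tail[OF Q eps] by blast
    define P where "P = \<Prod>{p\<in>Q. p \<le> y}"
    have fin: "finite {p\<in>Q. p \<le> y}" by (rule finite_subset[of _ "{..y}"]) auto
    have P0: "P > 0" unfolding P_def by (intro prod_pos) (auto simp: Q_def prime_gt_0_nat)
    define q where "q = k * P"
    have q0: "q > 0" using k P0 by (simp add: q_def)
    define bad where "bad = (\<lambda>N. {m\<in>{1..N}. \<exists>p\<in>Q. p dvd q * m + 1})"
    have "eventually (\<lambda>N. real (card (bad N)) \<le> 3 * \<epsilon> * real N) sequentially"
      unfolding bad_def
    proof (rule progression_sieve[OF Q _ q0 _ _ y eps])
      fix p assume p: "p \<in> Q" "p \<le> y"
      have "p dvd P" unfolding P_def using p fin by (intro dvd_prodI[of _ _ "\<lambda>x. x"]) auto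
      thus "p dvd q" by (simp add: q_def)
    qed (auto simp: Q_def)
    hence ev: "eventually (\<lambda>N. L2_norm M (\<lambda>x. F x - c) \<le>
        L2_norm M (\<lambda>x. (\<Sum>n=1..N. F (S (q * n + 1) x)) / of_nat N - c) + \<epsilon> * (6 * K)) sequentially"
      using eventually_gt_at_top[of 0]
    proof eventually_elim
      case (elim N)
      define E where "E = (\<lambda>n x. F (S (q * n + 1) x) - F x)"
      have EL: "E n \<in> L2 M" for n unfolding E_def by (intro L2_diff L2_comp_S F) simp
      have E2: "L2_norm M (E n) \<le> 2 * K" for n
        using L2_norm_triangle_diff[OF L2_comp_S[OF _ F] F, of "q * n + 1"] L2_norm_comp_S[OF _ F, of "q * n + 1"]
        by (simp add: E_def K_def)
      have E0: "L2_norm M (E n) = 0" if "n \<in> {1..N} - bad N" for n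
      proof -
        have "AE x in M. F (S (q * n + 1) x) = chi (q * n + 1) * F x"
          using that by (intro AE_eigenfunction[OF chi F]) (auto simp: bad_def Q_def)
        moreover have "chi (q * n + 1) = 1"
          using dirichlet_character_period[OF chi, of 1 "P * n"] dirichlet_character_1[OF chi]
          by (simp add: q_def mult.assoc)
        ultimately have "AE x in M. E n x = 0" by (simp add: E_def)
        thus ?thesis using L2_norm_eq_0_iff[OF EL] by blast
      qed
      have avgL: "(\<lambda>x. (\<Sum>n=1..N. F (S (q * n + 1) x)) / of_nat N - c) \<in> L2 M"
      proof -
        have "(\<lambda>x. (\<Sum>n=1..N. F (S (q * n + 1) x))) \<in> L2 M" by (rule L2_sum, rule L2_comp_S[OF _ F]) simp
        from L2_diff[OF L2_scale[OF this, of "1 / of_nat N"] L2_const[of c]] show ?thesis by simp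
      qed
      have sumL: "(\<lambda>x. \<Sum>n=1..N. E n x) \<in> L2 M" by (rule L2_sum[OF EL])
      have eq: "(\<lambda>x. F x - c) = (\<lambda>x. ((\<Sum>n=1..N. F (S (q * n + 1) x)) / of_nat N - c) - of_real (1 / real N) * (\<Sum>n=1..N. E n x))"
        using elim(2) by (intro ext) (simp add: E_def sum_subtractf field_simps)
      have "L2_norm M (\<lambda>x. F x - c) \<le> L2_norm M (\<lambda>x. (\<Sum>n=1..N. F (S (q * n + 1) x)) / of_nat N - c)
        + L2_norm M (\<lambda>x. of_real (1 / real N) * (\<Sum>n=1..N. E n x))"
        by (subst eq) (rule L2_norm_triangle_diff[OF avgL L2_scale[OF sumL]])
      also have "L2_norm M (\<lambda>x. of_real (1 / real N) * (\<Sum>n=1..N. E n x)) \<le> \<epsilon> * (6 * K)"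
      proof -
        have "L2_norm M (\<lambda>x. of_real (1 / real N) * (\<Sum>n=1..N. E n x)) = 1 / real N * L2_norm M (\<lambda>x. \<Sum>n=1..N. E n x)"
          by (simp only: L2_norm_scale norm_of_real) simp
        also have "\<dots> \<le> 1 / real N * (real N * (\<epsilon> * (6 * K)))"
        proof (rule mult_left_mono)
          have "L2_norm M (\<lambda>x. \<Sum>n=1..N. E n x) \<le> (\<Sum>n=1..N. L2_norm M (E n))" by (rule L2_norm_sum_le[OF EL])
          also have "\<dots> = (\<Sum>n\<in>bad N. L2_norm M (E n))"
            by (rule sum.mono_neutral_right) (auto simp: bad_def intro: E0[unfolded bad_def])
          also have "\<dots> \<le> real (card (bad N)) * (2 * K)" by (rule sum_bounded_above) (rule E2)
          also have "\<dots> \<le> 3 * \<epsilon> * real N * (2 * K)" using elim(1) by (intro mult_right_mono) (auto simp: K_def)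
          finally show "L2_norm M (\<lambda>x. \<Sum>n=1..N. E n x) \<le> real N * (\<epsilon> * (6 * K))" by (simp add: mult_ac)
        qed simp
        also have "\<dots> = \<epsilon> * (6 * K)" using elim(2) by simp
        finally show ?thesis .
      qed
      finally show ?case by simp
    qed
    have "(\<lambda>N. L2_norm M (\<lambda>x. (\<Sum>n=1..N. F (S (q * n + 1) x)) / of_nat N - c)) \<longlonglongrightarrow> 0"
      using ap[unfolded aperiodic_def, rule_format, OF F zero_less_one q0] unfolding c_def .
    from tendsto_add[OF this tendsto_const[of "\<epsilon> * (6 * K)"]]
    have "(\<lambda>N. L2_norm M (\<lambda>x. (\<Sum>n=1..N. F (S (q * n + 1) x)) / of_nat N - c) + \<epsilon> * (6 * K)) \<longlonglongrightarrow> \<epsilon> * (6 * K)" by simp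
    from tendsto_lowerbound[OF this ev] show ?thesis by simp
  qed
  have "L2_norm M (\<lambda>x. F x - c) \<le> 0"
  proof (rule field_le_epsilon)
    fix e :: real assume e: "e > 0"
    have K1: "6 * K + 1 > 0" by (simp add: K_def add_nonneg_pos)
    have "L2_norm M (\<lambda>x. F x - c) \<le> e / (6 * K + 1) * (6 * K)" using e K1 by (intro main) simp
    also have "\<dots> \<le> e / (6 * K + 1) * (6 * K + 1)" using e K1 by (intro mult_left_mono) auto
    also have "\<dots> = 0 + e" using K1 by simp
    finally show "L2_norm M (\<lambda>x. F x - c) \<le> 0 + e" .
  qed
  hence "L2_norm M (\<lambda>x. F x - c) = 0" using L2_norm_nonneg[of M "\<lambda>x. F x - c"] by linarith
  thus ?thesis using L2_norm_eq_0_iff[OF Fc] by (simp add: c_def)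
qed

lemma null_in_pretentious_space:
  assumes fg: "finitely_generated S" and chi: "dirichlet_character k chi" and F: "F \<in> L2 M" "AE x in M. F x = 0"
  shows "F \<in> pretentious_space M S chi"
proof -
  have "defect chi F p = 0" if "prime p" for p
  proof -
    have p: "p > 0" using that by (rule prime_gt_0_nat)
    note [measurable] = L2_measurable[OF F(1)]
    have "AE x in M. F (S p x) = 0" by (rule AE_comp_S[OF p F(2)]) measurable
    with F(2) have "AE x in M. F (S p x) = chi p * F x" by eventually_elim simp
    thus ?thesis using defect_eq_0_iff[OF p F(1)] by blast
  qed
  hence eq: "{p. prime p \<and> defect chi F p \<noteq> 0} = {}" by auto
  have "thin {p. prime p \<and> defect chi F p \<noteq> 0}" unfolding eq by (rule thin_finite) simp
  thus ?thesis using F(1) pretentious_space_iff_thin[OF fg chi] by blast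
qed

text \<open>A nonzero constant has zero defect only at primes with \<open>chi p = 1\<close>, so
  \<open>nonprincipal_not_thin\<close> applies.\<close>

lemma nonprincipal_const_zero:
  assumes fg: "finitely_generated S" and chi: "dirichlet_character k chi" "chi \<noteq> principal_character k"
    and FH: "F \<in> pretentious_space M S chi" and c: "AE x in M. F x = c"
  shows "c = 0"
proof (rule ccontr)
  assume c0: "c \<noteq> 0"
  have F: "F \<in> L2 M" and th: "thin {p. prime p \<and> defect chi F p \<noteq> 0}"
    using FH pretentious_space_iff_thin[OF fg chi(1)] by auto
  note [measurable] = L2_measurable[OF F]
  have "{p. prime p \<and> chi p \<noteq> 1} \<subseteq> {p. prime p \<and> defect chi F p \<noteq> 0}"
  proof clarify
    fix p assume p: "prime p" "defect chi F p = 0" and ne: "chi p \<noteq> 1"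
    have p0: "p > 0" using p(1) by (rule prime_gt_0_nat)
    have 1: "AE x in M. F (S p x) = chi p * F x" using p(2) defect_eq_0_iff[OF p0 F] by blast
    have 2: "AE x in M. F (S p x) = c" by (rule AE_comp_S[OF p0 c]) measurable
    have "AE x in M. c = chi p * c" using 1 2 c by eventually_elim simp
    hence "c = chi p * c" by (simp add: AE_const)
    with c0 ne show False by simp
  qed
  with th have "thin {p. prime p \<and> chi p \<noteq> 1}" by (rule thin_subset)
  with nonprincipal_not_thin[OF chi] show False by contradiction
qed

end

subsection \<open>Aperiodicity from the spectral condition\<close>

context twisted_system
begin

lemma A_add: "A (\<lambda>x. F x + G x) t = (\<lambda>x. A F t x + A G t x)"
  by (simp add: A_def Z_def V_def sum.distrib algebra_simps)

lemma A_scale: "A (\<lambda>x. c * F x) t = (\<lambda>x. c * A F t x)"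
  by (simp add: A_def Z_def V_def sum_distrib_left mult_ac)

text \<open>The operators \<open>A\<close> at positive scales are contractions, so approximation
  errors are uniform in the scale.\<close>

lemma A_norm_limit_closed:
  assumes W: "\<And>n::nat. W n \<in> L2 M" "\<And>n. ((\<lambda>t. L2_norm M (A (W n) t)) \<longlongrightarrow> 0) at_top"
    and F: "F \<in> L2 M" and lim: "(\<lambda>n. L2_norm M (\<lambda>x. W n x - F x)) \<longlonglongrightarrow> 0"
  shows "((\<lambda>t. L2_norm M (A F t)) \<longlongrightarrow> 0) at_top"
proof (rule tendstoI)
  fix e :: real assume e: "e > 0"
  have "eventually (\<lambda>n. L2_norm M (\<lambda>x. W n x - F x) < e / 2) sequentially"
    using lim e by (intro order_tendstoD(2)) auto
  then obtain n where n: "L2_norm M (\<lambda>x. W n x - F x) < e / 2" by (auto simp: eventually_sequentially)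
  have "eventually (\<lambda>t. L2_norm M (A (W n) t) < e / 2) at_top"
    using W(2)[of n] e by (intro order_tendstoD(2)) auto
  thus "eventually (\<lambda>t. dist (L2_norm M (A F t)) 0 < e) at_top"
    using eventually_gt_at_top[of 0]
  proof eventually_elim
    case (elim t)
    have D: "(\<lambda>x. F x - W n x) \<in> L2 M" by (rule L2_diff[OF F W(1)])
    have "A F t = A (\<lambda>x. W n x + (F x - W n x)) t" by simp
    also have "\<dots> = (\<lambda>x. A (W n) t x + A (\<lambda>x. F x - W n x) t x)" by (rule A_add)
    finally have "L2_norm M (A F t) \<le> L2_norm M (A (W n) t) + L2_norm M (A (\<lambda>x. F x - W n x) t)"
      using L2_norm_triangle[OF A_L2[OF W(1)] A_L2[OF D]] by simp
    moreover have "L2_norm M (A (\<lambda>x. F x - W n x) t) \<le> L2_norm M (\<lambda>x. F x - W n x)"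
      by (rule A_norm_le[OF D elim(2)])
    moreover have "L2_norm M (\<lambda>x. F x - W n x) = L2_norm M (\<lambda>x. W n x - F x)" by (rule L2_norm_minus_commute)
    ultimately show ?case using elim(1) n L2_norm_nonneg[of M "A F t"] by (simp add: dist_norm)
  qed
qed

text \<open>
  \<open>W\<close> is the projection of \<open>F\<close> onto the closed subspace of functions with vanishing averages. It contains
  \<open>V p G - G\<close> for all non-negligible \<open>p\<close>, so the residual is fixed by these \<open>V p\<close>.
\<close>

lemma ergodic_decomposition:
  assumes fg: "finitely_generated S" and F: "F \<in> L2 M"
  obtains W where "W \<in> L2 M" "((\<lambda>t. L2_norm M (A W t)) \<longlongrightarrow> 0) at_top"
    "chi = principal_character k \<Longrightarrow> (\<integral>x. W x \<partial>M) = 0"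
    "(\<lambda>x. F x - W x) \<in> pretentious_space M S (\<lambda>n. cnj (chi n))"
proof -
  have k: "k > 0" using chi by (simp add: dirichlet_character_def)
  \<comment> \<open>In the principal case the averages cannot detect whether the residual is a
    nonzero constant being projected away; the integral condition makes the residual keep the
    integral of \<open>F\<close>.\<close>
  define U where "U = {W \<in> L2 M. ((\<lambda>t. L2_norm M (A W t)) \<longlongrightarrow> 0) at_top \<and>
                        (chi = principal_character k \<longrightarrow> (\<integral>x. W x \<partial>M) = 0)}"
  have zero: "(\<lambda>_. 0) \<in> U"
  proof -
    have "A (\<lambda>_. 0) t = (\<lambda>_. 0)" for t by (simp add: A_def Z_def V_def)
    thus ?thesis by (simp add: U_def)
  qed
  have add: "(\<lambda>x. F x + G x) \<in> U" if FG: "F \<in> U" "G \<in> U" for F G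
  proof -
    have L: "F \<in> L2 M" "G \<in> L2 M" using FG by (auto simp: U_def)
    have "((\<lambda>t. L2_norm M (A (\<lambda>x. F x + G x) t)) \<longlongrightarrow> 0) at_top"
    proof (rule tendsto_sandwich[of "\<lambda>_. 0"])
      show "((\<lambda>t. L2_norm M (A F t) + L2_norm M (A G t)) \<longlongrightarrow> 0) at_top"
        using FG tendsto_add[of "\<lambda>t. L2_norm M (A F t)" 0 at_top "\<lambda>t. L2_norm M (A G t)" 0] by (simp add: U_def)
      show "eventually (\<lambda>t. L2_norm M (A (\<lambda>x. F x + G x) t) \<le> L2_norm M (A F t) + L2_norm M (A G t)) at_top"
        unfolding A_add by (intro always_eventually allI L2_norm_triangle A_L2 L)
    qed auto
    moreover have "(\<integral>x. F x + G x \<partial>M) = (\<integral>x. F x \<partial>M) + (\<integral>x. G x \<partial>M)"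
      by (intro Bochner_Integration.integral_add L2_integrable_1 L)
    ultimately show ?thesis using FG L2_add[OF L] by (simp add: U_def)
  qed
  have scale: "(\<lambda>x. c * F x) \<in> U" if FU: "F \<in> U" for c F
  proof -
    have "((\<lambda>t. L2_norm M (A (\<lambda>x. c * F x) t)) \<longlongrightarrow> 0) at_top"
      unfolding A_scale L2_norm_scale using FU by (intro tendsto_mult_right_zero) (simp add: U_def)
    thus ?thesis using FU L2_scale[of F M c] by (simp add: U_def)
  qed
  have closed: "G \<in> U" if W: "\<And>n::nat. W n \<in> U" and G: "G \<in> L2 M"
    and lim: "(\<lambda>n. L2_norm M (\<lambda>x. W n x - G x)) \<longlonglongrightarrow> 0" for W G
  proof -
    have WL: "W n \<in> L2 M" for n using W by (simp add: U_def)
    have "((\<lambda>t. L2_norm M (A G t)) \<longlongrightarrow> 0) at_top"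
      using W by (intro A_norm_limit_closed[OF WL _ G lim]) (simp add: U_def)
    moreover have "(\<integral>x. G x \<partial>M) = 0" if "chi = principal_character k"
    proof -
      have "cmod (\<integral>x. G x \<partial>M) \<le> L2_norm M (\<lambda>x. W n x - G x)" for n
      proof -
        have "(\<integral>x. W n x - G x \<partial>M) = (\<integral>x. W n x \<partial>M) - (\<integral>x. G x \<partial>M)"
          by (intro Bochner_Integration.integral_diff L2_integrable_1 WL G)
        hence "cmod (\<integral>x. G x \<partial>M) = cmod (\<integral>x. W n x - G x \<partial>M)" using W[of n] that by (simp add: U_def)
        thus ?thesis using norm_integral_le_L2_norm[OF L2_diff[OF WL G], of n] by simp
      qed
      hence "cmod (\<integral>x. G x \<partial>M) \<le> 0" by (intro LIMSEQ_le_const[OF lim]) auto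
      thus ?thesis by simp
    qed
    ultimately show ?thesis using G by (simp add: U_def)
  qed
  define cls where "cls = (\<lambda>p. {q. prime q \<and> S q = S p \<and> chi q = chi p})"
  have cob: "(\<lambda>x. V p G x - G x) \<in> U" if p: "prime p" "\<not> thin (cls p)" and G: "G \<in> L2 M" for p G
  proof -
    have p0: "p > 0" using p(1) by (rule prime_gt_0_nat)
    have "chi p \<noteq> 0"
    proof
      assume "chi p = 0"
      hence "cls p \<subseteq> {q. prime q \<and> \<not> coprime q k}"
        using chi by (auto simp: cls_def dirichlet_character_def)
      with p(2) show False using thin_subset[OF thin_finite[OF finite_primes_not_coprime[OF k]]] by blast
    qed
    have "(\<integral>x. V p G x - G x \<partial>M) = 0" if pr: "chi = principal_character k"
    proof -
      have "chi p = 1" using \<open>chi p \<noteq> 0\<close> unfolding pr principal_character_def by (simp split: if_splits)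
      hence Vp: "V p G = (\<lambda>x. G (S p x))" by (simp add: V_def)
      have "(\<integral>x. V p G x - G x \<partial>M) = (\<integral>x. V p G x \<partial>M) - (\<integral>x. G x \<partial>M)"
        by (intro Bochner_Integration.integral_diff L2_integrable_1 V_L2 p0 G)
      thus ?thesis unfolding Vp using integral_comp_S[OF p0 L2_measurable[OF G]] by simp
    qed
    moreover have "((\<lambda>t. L2_norm M (A (\<lambda>x. V p G x - G x) t)) \<longlongrightarrow> 0) at_top"
      by (rule coboundary_averages[OF fg p0 p(2)[unfolded cls_def] G])
    ultimately show ?thesis using L2_diff[OF V_L2[OF p0 G] G] by (simp add: U_def)
  qed
  have UL: "U \<subseteq> L2 M" by (auto simp: U_def)
  obtain W where W: "W \<in> U" "\<And>G. G \<in> U \<Longrightarrow> L2_norm M (\<lambda>x. F x - W x) \<le> L2_norm M (\<lambda>x. F x - G x)"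
    by (rule L2_nearest_point[OF UL zero add scale closed F]) auto
  define R where "R = (\<lambda>x. F x - W x)"
  have WL: "W \<in> L2 M" using W UL by auto
  have RL: "R \<in> L2 M" unfolding R_def by (rule L2_diff[OF F WL])
  have fixed: "L2_norm M (\<lambda>x. V p R x - R x) = 0" if p: "prime p" "\<not> thin (cls p)" for p
  proof -
    have p0: "p > 0" using p(1) by (rule prime_gt_0_nat)
    have VR: "V p R \<in> L2 M" by (rule V_L2[OF p0 RL])
    \<comment> \<open>This competitor has residual \<open>(V p R + R) / 2\<close>. Minimality makes
      its norm at least that of \<open>R\<close>, and since \<open>V p\<close> is a contraction, the
      parallelogram law forces \<open>V p R = R\<close>.\<close>
    have "(\<lambda>x. W x + (-1/2) * (V p R x - R x)) \<in> U" by (intro add W(1) scale cob p RL)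
    from W(2)[OF this] have "L2_norm M R \<le> L2_norm M (\<lambda>x. F x - (W x + (-1/2) * (V p R x - R x)))"
      by (simp only: R_def)
    also have "(\<lambda>x. F x - (W x + (-1/2) * (V p R x - R x))) = (\<lambda>x. (1/2) * (V p R x + R x))"
      by (intro ext) (simp add: R_def field_simps)
    also have "L2_norm M \<dots> = 1/2 * L2_norm M (\<lambda>x. V p R x + R x)" by (subst L2_norm_scale) (simp add: norm_divide)
    finally have "(2 * L2_norm M R)\<^sup>2 \<le> (L2_norm M (\<lambda>x. V p R x + R x))\<^sup>2" by (intro power_mono) auto
    moreover have "(L2_norm M (V p R))\<^sup>2 \<le> (L2_norm M R)\<^sup>2" by (intro power_mono V_norm_le p0 RL) simp
    moreover have "(2 * L2_norm M R)\<^sup>2 = 4 * (L2_norm M R)\<^sup>2" by (simp add: power_mult_distrib)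
    ultimately have "(L2_norm M (\<lambda>x. V p R x - R x))\<^sup>2 \<le> 0"
      using L2_norm_parallelogram[OF VR RL] by linarith
    thus ?thesis by (simp only: power2_less_eq_zero_iff)
  qed
  have chi': "dirichlet_character k (\<lambda>n. cnj (chi n))" by (rule dirichlet_character_cnj[OF chi])
  define E where "E = {p. prime p \<and> \<not> coprime p k}"
  define I where "I = (\<lambda>p. (S p, chi p)) ` {p. prime p}"
  define Q where "Q = (\<lambda>(s, c). {q. prime q \<and> S q = s \<and> chi q = c})"
  have finI: "finite I" unfolding I_def by (rule finite_prime_actions[OF fg chi])
  have "thin (\<Union>i\<in>{i\<in>I. thin (Q i)}. Q i)" by (rule thin_UN) (use finI in auto)
  moreover have "thin E" unfolding E_def by (rule thin_finite[OF finite_primes_not_coprime[OF k]])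
  \<comment> \<open>A thin class of primes gives no information about \<open>R\<close>, but there
    are finitely many classes, so all thin ones together with the primes dividing \<open>k\<close>
    are still negligible.\<close>
  ultimately have th: "thin (E \<union> (\<Union>i\<in>{i\<in>I. thin (Q i)}. Q i))" by (intro thin_Un)
  have "{p. prime p \<and> defect (\<lambda>n. cnj (chi n)) R p \<noteq> 0} \<subseteq> E \<union> (\<Union>i\<in>{i\<in>I. thin (Q i)}. Q i)"
  proof
    fix p assume p: "p \<in> {p. prime p \<and> defect (\<lambda>n. cnj (chi n)) R p \<noteq> 0}"
    show "p \<in> E \<union> (\<Union>i\<in>{i\<in>I. thin (Q i)}. Q i)"
    proof (cases "coprime p k \<and> \<not> thin (cls p)")
      case True
      have "cmod (chi p) = 1" using True norm_dirichlet_character[OF chi, of p] by simp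
      hence "cnj (chi p) * chi p = 1" using complex_norm_square[of "chi p"] mult.commute[of "chi p" "cnj (chi p)"] by simp
      hence "(\<lambda>x. R (S p x) - cnj (chi p) * R x) = (\<lambda>x. cnj (chi p) * (V p R x - R x))"
        by (simp add: V_def right_diff_distrib mult.assoc[symmetric])
      hence "defect (\<lambda>n. cnj (chi n)) R p = cmod (cnj (chi p)) * L2_norm M (\<lambda>x. V p R x - R x)"
        unfolding defect_def by (simp only: L2_norm_scale)
      also have "\<dots> = 0" using fixed[of p] p True by simp
      finally show ?thesis using p by simp
    next
      case False
      show ?thesis
      proof (cases "coprime p k")
        case True
        hence "thin (Q (S p, chi p))" using False by (simp add: Q_def cls_def)
        moreover have "(S p, chi p) \<in> I" using p by (simp add: I_def)
        moreover have "p \<in> Q (S p, chi p)" using p by (simp add: Q_def)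
        ultimately show ?thesis by blast
      qed (use p in \<open>simp add: E_def\<close>)
    qed
  qed
  with th have "thin {p. prime p \<and> defect (\<lambda>n. cnj (chi n)) R p \<noteq> 0}" by (rule thin_subset)
  hence "R \<in> pretentious_space M S (\<lambda>n. cnj (chi n))"
    using RL pretentious_space_iff_thin[OF fg chi'] by blast
  thus ?thesis using W(1) by (intro that[of W]) (auto simp: U_def R_def)
qed

end

section \<open>From twisted averages to averages along progressions\<close>

context multiplicative_system
begin

abbreviation spectral_condition :: bool where
  "spectral_condition \<equiv> (\<forall>F\<in>pretentious_space M S (\<lambda>_. 1). ae_constant M F) \<and>
     (\<forall>k chi. dirichlet_character k chi \<and> chi \<noteq> principal_character k \<longrightarrow>
        pretentious_space M S chi = {F \<in> L2 M. AE x in M. F x = 0})"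

lemma prob_UNIV [simp]: "measure M UNIV = 1"
  using prob_space by simp

lemma AE_const_eq_integral:
  assumes "AE x in M. F x = (c :: complex)" "F \<in> borel_measurable M"
  shows "(\<integral>x. F x \<partial>M) = c"
proof -
  have "(\<integral>x. F x \<partial>M) = (\<integral>x. c \<partial>M)" using assms by (intro integral_cong_AE) auto
  thus ?thesis by simp
qed

lemma aperiodic_imp_spectral:
  assumes fg: "finitely_generated S" and ap: "aperiodic M S"
  shows spectral_condition
proof (intro conjI ballI allI impI)
  fix F assume "F \<in> pretentious_space M S (\<lambda>_. 1)"
  thus "ae_constant M F"
    using aperiodic_imp_AE_const[OF ap fg dirichlet_character_one] unfolding ae_constant_def by blast
next
  fix k chi assume *: "dirichlet_character k chi \<and> chi \<noteq> principal_character k"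
  hence chi: "dirichlet_character k chi" "chi \<noteq> principal_character k" by auto
  show "pretentious_space M S chi = {F \<in> L2 M. AE x in M. F x = 0}"
  proof (intro equalityI subsetI)
    fix F assume F: "F \<in> pretentious_space M S chi"
    have "AE x in M. F x = (\<integral>y. F y \<partial>M)" by (rule aperiodic_imp_AE_const[OF ap fg chi(1) F])
    moreover from this have "(\<integral>y. F y \<partial>M) = 0" by (rule nonprincipal_const_zero[OF fg chi F])
    ultimately show "F \<in> {F \<in> L2 M. AE x in M. F x = 0}" using F by (simp add: pretentious_space_def)
  next
    fix F assume "F \<in> {F \<in> L2 M. AE x in M. F x = 0}"
    thus "F \<in> pretentious_space M S chi" using null_in_pretentious_space[OF fg chi(1)] by blast
  qed
qed

lemma principal_pretentious_subset:
  assumes fg: "finitely_generated S" and k: "k > 0" and F: "F \<in> pretentious_space M S (principal_character k)"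
  shows "F \<in> pretentious_space M S (\<lambda>_. 1)"
proof -
  have FL: "F \<in> L2 M" and th: "thin {p. prime p \<and> defect (principal_character k) F p \<noteq> 0}"
    using F pretentious_space_iff_thin[OF fg dirichlet_character_principal[OF k]] by auto
  have "{p. prime p \<and> defect (\<lambda>_. 1) F p \<noteq> 0} \<subseteq>
    {p. prime p \<and> defect (principal_character k) F p \<noteq> 0} \<union> {p. prime p \<and> \<not> coprime p k}"
    by (auto simp: defect_def principal_character_def)
  hence "thin {p. prime p \<and> defect (\<lambda>_. 1) F p \<noteq> 0}"
    by (rule thin_subset[OF thin_Un[OF th thin_finite[OF finite_primes_not_coprime[OF k]]]])
  thus ?thesis using FL pretentious_space_one_iff_thin[OF fg] by blast
qed

text \<open>The residual lies in the space of the conjugate character. It is zero if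
  \<open>chi\<close> is not principal; otherwise it is constant, and its integral vanishes because
  both \<open>F\<close> and \<open>W\<close> have integral zero.\<close>

lemma character_averages_vanish:
  assumes fg: "finitely_generated S" and sp: spectral_condition and chi: "dirichlet_character k chi"
    and F: "F \<in> L2 M" and F0: "(\<integral>x. F x \<partial>M) = 0"
  shows "((\<lambda>t. L2_norm M (\<lambda>x. of_real (1 / t) * (\<Sum>n\<in>nat_upto t. chi n * F (S n x)))) \<longlongrightarrow> 0) at_top"
proof -
  interpret T: twisted_system M S k chi by unfold_locales (rule chi)
  have k: "k > 0" using chi by (simp add: dirichlet_character_def)
  have eq: "T.A G t = (\<lambda>x. of_real (1 / t) * (\<Sum>n\<in>nat_upto t. chi n * G (S n x)))" for G t
    by (simp only: T.A_def T.Z_def T.V_def)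
  obtain W where W: "W \<in> L2 M" "((\<lambda>t. L2_norm M (T.A W t)) \<longlongrightarrow> 0) at_top"
    "chi = principal_character k \<Longrightarrow> (\<integral>x. W x \<partial>M) = 0"
    "(\<lambda>x. F x - W x) \<in> pretentious_space M S (\<lambda>n. cnj (chi n))"
    using T.ergodic_decomposition[OF fg F] by blast
  have RL: "(\<lambda>x. F x - W x) \<in> L2 M" by (rule L2_diff[OF F W(1)])
  have R0: "AE x in M. F x - W x = 0"
  proof (cases "chi = principal_character k")
    case True
    hence "(\<lambda>n. cnj (chi n)) = principal_character k" by (simp add: principal_character_def fun_eq_iff)
    hence "(\<lambda>x. F x - W x) \<in> pretentious_space M S (\<lambda>_. 1)"
      using principal_pretentious_subset[OF fg k] W(4) by simp
    hence "ae_constant M (\<lambda>x. F x - W x)" using sp by blast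
    then obtain c where c: "AE x in M. F x - W x = c" unfolding ae_constant_def by blast
    hence "(\<integral>x. F x - W x \<partial>M) = c" by (rule AE_const_eq_integral[OF _ L2_measurable[OF RL]])
    moreover have "(\<integral>x. F x - W x \<partial>M) = (\<integral>x. F x \<partial>M) - (\<integral>x. W x \<partial>M)"
      by (intro Bochner_Integration.integral_diff L2_integrable_1 F W(1))
    ultimately have "c = 0" using F0 W(3)[OF True] by simp
    thus ?thesis using c by simp
  next
    case False
    have "(\<lambda>n. cnj (chi n)) \<noteq> principal_character k"
    proof
      assume e: "(\<lambda>n. cnj (chi n)) = principal_character k"
      have "chi n = principal_character k n" for n
      proof -
        have "chi n = cnj (cnj (chi n))" by simp
        also have "cnj (chi n) = principal_character k n" using fun_cong[OF e, of n] by simp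
        also have "cnj (principal_character k n) = principal_character k n" by (simp add: principal_character_def)
        finally show ?thesis .
      qed
      with False show False by blast
    qed
    with sp dirichlet_character_cnj[OF chi] have
      "pretentious_space M S (\<lambda>n. cnj (chi n)) = {F \<in> L2 M. AE x in M. F x = 0}" by blast
    with W(4) show ?thesis by simp
  qed
  hence N0: "L2_norm M (\<lambda>x. F x - W x) = 0" using L2_norm_eq_0_iff[OF RL] by blast
  have "((\<lambda>t. L2_norm M (T.A F t)) \<longlongrightarrow> 0) at_top"
  proof (rule T.A_norm_limit_closed[where W = "\<lambda>_. W"])
    have "L2_norm M (\<lambda>x. W x - F x) = 0" using N0 L2_norm_minus_commute[of M W F] by simp
    thus "(\<lambda>n. L2_norm M (\<lambda>x. W x - F x)) \<longlonglongrightarrow> 0" by simp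
  qed (use W F in auto)
  thus ?thesis by (simp only: eq)
qed

lemma periodic_averages_vanish:
  assumes fg: "finitely_generated S" and sp: spectral_condition and k: "k > 0"
    and g: "\<And>n. g (n + k) = g n" "\<And>n. \<not> coprime n k \<Longrightarrow> g n = 0"
    and F: "F \<in> L2 M" and F0: "(\<integral>x. F x \<partial>M) = 0"
  shows "((\<lambda>t. L2_norm M (\<lambda>x. of_real (1 / t) * (\<Sum>n\<in>nat_upto t. g n * F (S n x)))) \<longlongrightarrow> 0) at_top"
proof -
  define P where "P = (\<lambda>g. ((\<lambda>t. L2_norm M (\<lambda>x. of_real (1 / t) * (\<Sum>n\<in>nat_upto t. g n * F (S n x)))) \<longlongrightarrow> 0) at_top)"
  have L: "(\<lambda>x. of_real (1 / t) * (\<Sum>n\<in>nat_upto t. g n * F (S n x))) \<in> L2 M" for g t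
    by (rule L2_scale, rule L2_sum, rule L2_scale, rule L2_comp_S[OF nat_upto_pos F])
  have "P g"
  proof (rule periodic_characters_induct[where P = P and g = g and k = k])
    show "k > 0" by (rule k)
    show "g (n + k) = g n" for n by (rule g(1))
    show "g n = 0" if "\<not> coprime n k" for n by (rule g(2)[OF that])
    show "P chi" if "dirichlet_character k chi" for chi
      unfolding P_def by (rule character_averages_vanish[OF fg sp that F F0])
    show "P (\<lambda>n. g n + h n)" if "P g" "P h" for g h
      unfolding P_def
    proof (rule tendsto_sandwich[of "\<lambda>_. 0"])
      show "((\<lambda>t. L2_norm M (\<lambda>x. of_real (1 / t) * (\<Sum>n\<in>nat_upto t. g n * F (S n x))) +
        L2_norm M (\<lambda>x. of_real (1 / t) * (\<Sum>n\<in>nat_upto t. h n * F (S n x)))) \<longlongrightarrow> 0) at_top"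
        using tendsto_add[OF that[unfolded P_def]] by simp
      have eq: "(\<lambda>x. of_real (1 / t) * (\<Sum>n\<in>nat_upto t. (g n + h n) * F (S n x))) =
         (\<lambda>x. of_real (1 / t) * (\<Sum>n\<in>nat_upto t. g n * F (S n x)) + of_real (1 / t) * (\<Sum>n\<in>nat_upto t. h n * F (S n x)))" for t
        by (simp only: distrib_right sum.distrib distrib_left)
      show "eventually (\<lambda>t. L2_norm M (\<lambda>x. of_real (1 / t) * (\<Sum>n\<in>nat_upto t. (g n + h n) * F (S n x))) \<le>
        L2_norm M (\<lambda>x. of_real (1 / t) * (\<Sum>n\<in>nat_upto t. g n * F (S n x))) +
        L2_norm M (\<lambda>x. of_real (1 / t) * (\<Sum>n\<in>nat_upto t. h n * F (S n x)))) at_top"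
        unfolding eq by (intro always_eventually allI L2_norm_triangle L)
    qed auto
    show "P (\<lambda>n. c * g n)" if "P g" for c g
    proof -
      have eq: "(\<lambda>x. of_real (1 / t) * (\<Sum>n\<in>nat_upto t. (c * g n) * F (S n x))) =
         (\<lambda>x. c * (of_real (1 / t) * (\<Sum>n\<in>nat_upto t. g n * F (S n x))))" for t
        by (simp add: sum_distrib_left mult_ac)
      have "L2_norm M (\<lambda>x. of_real (1 / t) * (\<Sum>n\<in>nat_upto t. (c * g n) * F (S n x))) =
        cmod c * L2_norm M (\<lambda>x. of_real (1 / t) * (\<Sum>n\<in>nat_upto t. g n * F (S n x)))" for t
        unfolding eq by (rule L2_norm_scale)
      thus ?thesis unfolding P_def
        using tendsto_mult_right_zero[OF that[unfolded P_def], of "cmod c"] by (simp only:)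
    qed
  qed
  thus ?thesis by (simp only: P_def)
qed

text \<open>The indicator of the class of \<open>r\<close> modulo \<open>q\<close> is periodic and
  supported on integers coprime to \<open>q\<close>, so \<open>periodic_averages_vanish\<close>
  applies at scale \<open>q * N + r\<close>; the change of normalisation costs a bounded
  factor.\<close>

lemma coprime_progression_averages_vanish:
  assumes fg: "finitely_generated S" and sp: spectral_condition and q: "q > 0" "r > 0" "coprime r q"
    and F: "F \<in> L2 M" and F0: "(\<integral>x. F x \<partial>M) = 0"
  shows "(\<lambda>N. L2_norm M (\<lambda>x. (\<Sum>n=1..N. F (S (q * n + r) x)) / of_nat N)) \<longlonglongrightarrow> 0"
proof -
  define g :: "nat \<Rightarrow> complex" where "g = (\<lambda>n. if [n = r] (mod q) then 1 else 0)"
  define B where "B = (\<lambda>t x. of_real (1 / t) * (\<Sum>n\<in>nat_upto t. g n * F (S n x)))"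
  have BL: "B t \<in> L2 M" for t
    unfolding B_def by (rule L2_scale, rule L2_sum, rule L2_scale, rule L2_comp_S[OF nat_upto_pos F])
  have gper: "g (n + q) = g n" for n by (simp add: g_def cong_def)
  have gcop: "g n = 0" if "\<not> coprime n q" for n
    using that q(3) cong_imp_coprime[of r n q] by (auto simp: g_def cong_sym_eq)
  have lim: "((\<lambda>t. L2_norm M (B t)) \<longlongrightarrow> 0) at_top"
    unfolding B_def
  proof (rule periodic_averages_vanish[where g = g and k = q])
    show "g (n + q) = g n" for n by (rule gper)
    show "g n = 0" if "\<not> coprime n q" for n by (rule gcop[OF that])
  qed (rule fg sp q(1) F F0)+
  define t where "t = (\<lambda>N::nat. real (q * N + r))"
  have "filterlim t at_top sequentially"
  proof (rule filterlim_at_top_mono[OF filterlim_real_sequentially])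
    have "real N \<le> t N" for N
    proof -
      have "1 * N \<le> q * N" using q(1) by (intro mult_right_mono) auto
      hence "N \<le> q * N + r" by linarith
      thus ?thesis unfolding t_def by (rule of_nat_mono)
    qed
    thus "eventually (\<lambda>N. real N \<le> t N) sequentially" by simp
  qed
  hence limt: "(\<lambda>N. L2_norm M (B (t N))) \<longlonglongrightarrow> 0" by (rule filterlim_compose[OF lim])
  \<comment> \<open>The progression starts at \<open>n = q + r\<close>, so the terms up to
    \<open>r\<close> are subtracted; they form a fixed vector that disappears after division by
    \<open>N\<close>.\<close>
  define C where "C = (\<lambda>x. \<Sum>n\<in>{1..r}. g n * F (S n x))"
  have CL: "C \<in> L2 M" unfolding C_def by (rule L2_sum, rule L2_scale, rule L2_comp_S[OF _ F]) simp
  show ?thesis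
  proof (rule tendsto_sandwich[of "\<lambda>_. 0"])
    show "(\<lambda>N. real (q + r) * L2_norm M (B (t N)) + L2_norm M C * inverse (real N)) \<longlonglongrightarrow> 0"
      by (intro tendsto_add_zero tendsto_mult_right_zero limt lim_inverse_n)
    show "eventually (\<lambda>N. L2_norm M (\<lambda>x. (\<Sum>n=1..N. F (S (q * n + r) x)) / of_nat N) \<le>
       real (q + r) * L2_norm M (B (t N)) + L2_norm M C * inverse (real N)) sequentially"
      using eventually_gt_at_top[of 0]
    proof eventually_elim
      case (elim N)
      have set: "{n\<in>{1..q * N + r}. [n = r] (mod q) \<and> \<not> n \<le> r} = (\<lambda>n. q * n + r) ` {1..N}"
      proof (intro equalityI subsetI)
        fix n assume n: "n \<in> {n\<in>{1..q * N + r}. [n = r] (mod q) \<and> \<not> n \<le> r}"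
        hence "r \<le> n" "[n = r] (mod q)" by auto
        hence "q dvd n - r" by (simp only: cong_altdef_nat)
        then obtain j where j: "n - r = q * j" by blast
        hence nj: "n = q * j + r" using n by auto
        have "j \<noteq> 0" using n nj by auto
        moreover have "q * j \<le> q * N" using n nj by auto
        hence "j \<le> N" using q(1) by simp
        ultimately show "n \<in> (\<lambda>n. q * n + r) ` {1..N}" using nj by (intro image_eqI[of _ _ j]) auto
      next
        fix n assume "n \<in> (\<lambda>n. q * n + r) ` {1..N}"
        then obtain j where j: "n = q * j + r" "j \<in> {1..N}" by blast
        have "q * j \<le> q * N" "q * j > 0" using j(2) q(1) by auto
        moreover have "[q * j + r = r] (mod q)" by (simp add: cong_def)
        ultimately show "n \<in> {n\<in>{1..q * N + r}. [n = r] (mod q) \<and> \<not> n \<le> r}" unfolding j(1) using q(2) by simp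
      qed
      have sum: "(\<Sum>n=1..N. F (S (q * n + r) x)) = of_real (t N) * B (t N) x - C x" for x
      proof -
        have "q * N + r \<noteq> 0" using q(2) by simp
        hence tN: "t N \<noteq> 0" unfolding t_def by (simp only: of_nat_eq_0_iff not_False_eq_True)
        have "(\<Sum>n=1..N. F (S (q * n + r) x)) = (\<Sum>n\<in>(\<lambda>n. q * n + r) ` {1..N}. F (S n x))"
        proof -
          have "inj_on (\<lambda>n. q * n + r) {1..N}"
          proof (rule inj_onI)
            fix i j assume "q * i + r = q * j + r"
            hence "q * i = q * j" by (rule add_right_imp_eq)
            thus "i = j" using q(1) by simp
          qed
          from sum.reindex[OF this, of "\<lambda>n. F (S n x)"] show ?thesis unfolding comp_def by (rule sym)
        qed
        also have "\<dots> = (\<Sum>n\<in>{n\<in>{1..q * N + r}. \<not> n \<le> r}. g n * F (S n x))"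
          unfolding set[symmetric]
        proof (rule sum.mono_neutral_cong_left)
          show "\<forall>n\<in>{n\<in>{1..q * N + r}. \<not> n \<le> r} - {n\<in>{1..q * N + r}. [n = r] (mod q) \<and> \<not> n \<le> r}. g n * F (S n x) = 0"
          proof
            fix n assume "n \<in> {n\<in>{1..q * N + r}. \<not> n \<le> r} - {n\<in>{1..q * N + r}. [n = r] (mod q) \<and> \<not> n \<le> r}"
            hence "\<not> [n = r] (mod q)" by blast
            hence "g n = 0" by (simp only: g_def if_False)
            thus "g n * F (S n x) = 0" by (simp only: mult_zero_left)
          qed
          show "F (S n x) = g n * F (S n x)" if "n \<in> {n\<in>{1..q * N + r}. [n = r] (mod q) \<and> \<not> n \<le> r}" for n
          proof -
            have "[n = r] (mod q)" using that by blast
            hence "g n = 1" by (simp only: g_def if_True)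
            thus ?thesis by (simp only: mult_1)
          qed
          show "finite {n\<in>{1..q * N + r}. \<not> n \<le> r}" by simp
          show "{n\<in>{1..q * N + r}. [n = r] (mod q) \<and> \<not> n \<le> r} \<subseteq> {n\<in>{1..q * N + r}. \<not> n \<le> r}" by blast
        qed
        also have "{n\<in>{1..q * N + r}. \<not> n \<le> r} = {1..q * N + r} - {1..r}" by auto
        also have "(\<Sum>n\<in>\<dots>. g n * F (S n x)) = (\<Sum>n\<in>{1..q * N + r}. g n * F (S n x)) - C x"
          unfolding C_def by (rule sum_diff) auto
        also have "(\<Sum>n\<in>{1..q * N + r}. g n * F (S n x)) = of_real (t N) * B (t N) x"
        proof -
          have "of_real (t N) * B (t N) x = of_real (t N * (1 / t N)) * (\<Sum>n\<in>nat_upto (t N). g n * F (S n x))"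
            by (simp only: B_def of_real_mult mult.assoc)
          also have "t N * (1 / t N) = 1" using tN by simp
          finally show ?thesis by (simp only: t_def nat_upto_of_nat of_real_1 mult_1)
        qed
        finally show ?thesis .
      qed
      have "L2_norm M (\<lambda>x. (\<Sum>n=1..N. F (S (q * n + r) x)) / of_nat N) =
            L2_norm M (\<lambda>x. of_real (1 / real N) * (of_real (t N) * B (t N) x - C x))"
      proof -
        have "(\<lambda>x. (\<Sum>n=1..N. F (S (q * n + r) x)) / of_nat N) = (\<lambda>x. of_real (1 / real N) * (of_real (t N) * B (t N) x - C x))"
          unfolding sum by (simp add: fun_eq_iff)
        thus ?thesis by (rule arg_cong)
      qed
      also have "\<dots> = 1 / real N * L2_norm M (\<lambda>x. of_real (t N) * B (t N) x - C x)"
        by (simp only: L2_norm_scale norm_of_real) simp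
      also have "\<dots> \<le> 1 / real N * (t N * L2_norm M (B (t N)) + L2_norm M C)"
      proof (rule mult_left_mono)
        have "L2_norm M (\<lambda>x. of_real (t N) * B (t N) x - C x) \<le> L2_norm M (\<lambda>x. of_real (t N) * B (t N) x) + L2_norm M C"
          by (rule L2_norm_triangle_diff[OF L2_scale[OF BL] CL])
        also have "L2_norm M (\<lambda>x. of_real (t N) * B (t N) x) = t N * L2_norm M (B (t N))"
          by (simp only: L2_norm_scale norm_of_real) (simp add: t_def)
        finally show "L2_norm M (\<lambda>x. of_real (t N) * B (t N) x - C x) \<le> t N * L2_norm M (B (t N)) + L2_norm M C" .
      qed simp
      also have "\<dots> = t N / real N * L2_norm M (B (t N)) + L2_norm M C * inverse (real N)"
        by (simp add: distrib_left divide_inverse)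
      finally have main: "L2_norm M (\<lambda>x. (\<Sum>n=1..N. F (S (q * n + r) x)) / of_nat N) \<le>
        t N / real N * L2_norm M (B (t N)) + L2_norm M C * inverse (real N)" .
      have "t N / real N * L2_norm M (B (t N)) \<le> real (q + r) * L2_norm M (B (t N))"
      proof (rule mult_right_mono)
        have "r * 1 \<le> r * N" using elim by (intro mult_left_mono) auto
        hence "q * N + r \<le> (q + r) * N" by (simp add: distrib_right)
        hence "t N \<le> real ((q + r) * N)" unfolding t_def by (rule of_nat_mono)
        thus "t N / real N \<le> real (q + r)" using elim by (simp add: pos_divide_le_eq)
      qed simp
      with main show ?case by linarith
    qed
  qed auto
qed

text \<open>With \<open>d = gcd r q\<close>, each \<open>q * n + r\<close> is \<open>d\<close> times
  a member of a coprime progression, so \<open>F\<close> composed with \<open>S d\<close>, recentred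
  to mean zero, reduces the general case to the coprime one.\<close>

lemma spectral_imp_aperiodic:
  assumes fg: "finitely_generated S" and sp: spectral_condition
  shows "aperiodic M S"
  unfolding aperiodic_def
proof (intro ballI allI impI)
  fix F and r q :: nat assume F: "F \<in> L2 M" and r: "r > 0" and q: "q > 0"
  define c where "c = (\<integral>y. F y \<partial>M)"
  define d where "d = gcd r q"
  define r' where "r' = r div d"
  define q' where "q' = q div d"
  have d: "d > 0" "r = d * r'" "q = d * q'" using r q by (auto simp: d_def r'_def q'_def)
  have rq: "r' > 0" "q' > 0" using d r q by auto
  have cop: "coprime r' q'" unfolding r'_def q'_def d_def using r by (intro div_gcd_coprime) simp
  define G where "G = (\<lambda>x. F (S d x) - c)"
  have GL: "G \<in> L2 M" unfolding G_def by (rule L2_diff[OF L2_comp_S[OF d(1) F] L2_const])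
  have "(\<integral>x. G x \<partial>M) = (\<integral>x. F (S d x) \<partial>M) - (\<integral>x. c \<partial>M)"
    unfolding G_def by (rule Bochner_Integration.integral_diff[OF L2_integrable_1[OF L2_comp_S[OF d(1) F]] L2_integrable_1[OF L2_const]])
  also have "\<dots> = 0" using integral_comp_S[OF d(1) L2_measurable[OF F]] by (simp add: c_def)
  finally have G0: "(\<integral>x. G x \<partial>M) = 0" .
  have lim: "(\<lambda>N. L2_norm M (\<lambda>x. (\<Sum>n=1..N. G (S (q' * n + r') x)) / of_nat N)) \<longlonglongrightarrow> 0"
    by (rule coprime_progression_averages_vanish[OF fg sp rq(2,1) cop GL G0])
  show "(\<lambda>N. L2_norm M (\<lambda>x. (\<Sum>n=1..N. F (S (q * n + r) x)) / of_nat N - (\<integral>y. F y \<partial>M))) \<longlonglongrightarrow> 0"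
  proof (rule Lim_transform_eventually[OF lim])
    show "eventually (\<lambda>N. L2_norm M (\<lambda>x. (\<Sum>n=1..N. G (S (q' * n + r') x)) / of_nat N) =
      L2_norm M (\<lambda>x. (\<Sum>n=1..N. F (S (q * n + r) x)) / of_nat N - (\<integral>y. F y \<partial>M))) sequentially"
      using eventually_gt_at_top[of 0]
    proof eventually_elim
      case (elim N)
      have "G (S (q' * n + r') x) = F (S (q * n + r) x) - c" for n x
      proof -
        have "S (d * (q' * n + r')) x = S d (S (q' * n + r') x)" using d rq by (intro S_mult) auto
        moreover have "d * (q' * n + r') = q * n + r" by (simp add: d(2,3) algebra_simps)
        ultimately show ?thesis by (simp add: G_def)
      qed
      hence "(\<Sum>n=1..N. G (S (q' * n + r') x)) / of_nat N = (\<Sum>n=1..N. F (S (q * n + r) x)) / of_nat N - (\<integral>y. F y \<partial>M)" for x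
        using elim by (simp add: sum_subtractf c_def diff_divide_distrib)
      thus ?case by simp
    qed
  qed
qed

end

subsection \<open>The pretentious rational spectrum\<close>

lemma bounded_sums_finite_support:
  assumes "finite E" "c \<ge> 0" "\<And>p. p \<in> X \<Longrightarrow> h p \<le> (if p \<in> E then c else 0)"
  shows "bounded_sums h X"
proof (rule bounded_sums_finite_perturb[OF _ assms(1,2)])
  show "bounded_sums (\<lambda>_. 0) X" unfolding bounded_sums_def by (intro exI[of _ 0]) simp
qed (use assms(3) in simp)

lemma unimodular_norm:
  "g \<in> completely_multiplicative_unimodular \<Longrightarrow> prime p \<Longrightarrow> cmod (g p) = 1"
  unfolding completely_multiplicative_unimodular_def using prime_gt_0_nat by auto

text \<open>The two distances differ only at the finitely many primes dividing \<open>k\<close>,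
  each contributing at most 1.\<close>

lemma pretentious_class_principal_subset:
  assumes k: "k > 0"
  shows "pretentious_class (principal_character k) \<subseteq> pretentious_class (\<lambda>_. 1)"
proof
  fix g assume "g \<in> pretentious_class (principal_character k)"
  hence g: "g \<in> completely_multiplicative_unimodular" "pretentious_dist (principal_character k) g < \<infinity>"
    by (auto simp: pretentious_class_def)
  have gn: "cmod (g p) \<le> 1" if "prime p" for p using unimodular_norm[OF g(1) that] by simp
  have "bounded_sums (\<lambda>p. (1 - Re (principal_character k p * cnj (g p))) / real p) {p. prime p}"
    using g(2) by (subst (asm) pretentious_dist_finite_iff) (auto simp: principal_character_def gn)
  hence "bounded_sums (\<lambda>p. (1 - Re (1 * cnj (g p))) / real p) {p. prime p}"
  proof (rule bounded_sums_finite_perturb[OF _ finite_primes_not_coprime[OF k]])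
    fix p :: nat assume p: "p \<in> {p. prime p}"
    show "(1 - Re (1 * cnj (g p))) / real p \<le> (1 - Re (principal_character k p * cnj (g p))) / real p +
      (if p \<in> {p. prime p \<and> \<not> coprime p k} then 1 else 0)"
    proof (cases "coprime p k")
      case False
      have "real p \<ge> 1" using p prime_gt_0_nat[of p] by simp
      moreover have "- Re (g p) \<le> 1" using abs_Re_le_cmod[of "g p"] gn[of p] p by simp
      ultimately have "0 < real p" "- Re (g p) \<le> 1 * real p" by linarith+
      hence "- Re (g p) / real p \<le> 1" by (simp only: pos_divide_le_eq)
      thus ?thesis using False p by (simp add: principal_character_def diff_divide_distrib)
    qed (simp add: principal_character_def)
  qed simp
  hence "pretentious_dist (\<lambda>_. 1) g < \<infinity>" by (subst pretentious_dist_finite_iff) (auto simp: gn)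
  thus "g \<in> pretentious_class (\<lambda>_. 1)" using g(1) by (simp add: pretentious_class_def)
qed

text \<open>A character vanishes at primes dividing its modulus and so need not be unimodular.
  Setting it to 1 there and extending over prime factorisations changes the distance by finitely
  many terms and provides a witness in its class.\<close>

lemma character_unimodular_modification:
  assumes chi: "dirichlet_character k chi"
  obtains g where "g \<in> pretentious_class chi" "\<And>p. prime p \<Longrightarrow> g p = (if coprime p k then chi p else 1)"
proof -
  have k: "k > 0" using chi by (simp add: dirichlet_character_def)
  define h where "h = (\<lambda>p. if coprime p k then chi p else 1)"
  define g where "g = (\<lambda>n. if n = 0 then 0 else \<Prod>p\<in>#prime_factorization n. h p)"
  have hn: "cmod (h p) = 1" for p using norm_dirichlet_character[OF chi, of p] by (simp add: h_def)
  have gp: "g p = h p" if "prime p" for p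
    using that by (simp add: g_def prime_factorization_prime)
  have "cmod (\<Prod>p\<in>#A. h p) = 1" for A by (induction A) (simp_all add: norm_mult hn)
  hence gn: "cmod (g n) = 1" if "n > 0" for n using that by (simp add: g_def)
  have gm: "g (m * n) = g m * g n" if "m > 0" "n > 0" for m n
    using that by (simp add: g_def prime_factorization_mult)
  have gc: "g \<in> completely_multiplicative_unimodular"
    unfolding completely_multiplicative_unimodular_def using gn gm by (simp add: g_def)
  have "bounded_sums (\<lambda>p. (1 - Re (chi p * cnj (g p))) / real p) {p. prime p}"
  proof (rule bounded_sums_finite_support[OF finite_primes_not_coprime[OF k], of 1])
    fix p :: nat assume p: "p \<in> {p. prime p}"
    hence p1: "real p \<ge> 1" using prime_gt_0_nat[of p] by simp
    show "(1 - Re (chi p * cnj (g p))) / real p \<le> (if p \<in> {p. prime p \<and> \<not> coprime p k} then 1 else 0)"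
    proof (cases "coprime p k")
      case True
      have "chi p * cnj (chi p) = 1"
        using complex_norm_square[of "chi p"] norm_dirichlet_character[OF chi, of p] True by simp
      hence "chi p * cnj (g p) = 1" using True p by (simp add: gp h_def)
      thus ?thesis using True by simp
    next
      case False
      hence "chi p = 0" using chi by (auto simp: dirichlet_character_def)
      thus ?thesis using False p p1 by simp
    qed
  qed simp
  hence "pretentious_dist chi g < \<infinity>"
    using norm_dirichlet_character_le_1[OF chi] unimodular_norm[OF gc] by (subst pretentious_dist_finite_iff) auto
  with gc have "g \<in> pretentious_class chi" by (simp add: pretentious_class_def)
  thus ?thesis by (rule that) (simp add: gp h_def)
qed

text \<open>The unimodular modification of \<open>chi\<close> takes finitely many values, so finite
  distance from 1 would make it equal to 1 off a thin set, which
  \<open>nonprincipal_not_thin\<close> forbids.\<close>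

lemma nonprincipal_class_not_subset:
  assumes chi: "dirichlet_character k chi" "chi \<noteq> principal_character k"
  shows "\<not> pretentious_class chi \<subseteq> pretentious_class (\<lambda>_. 1)"
proof
  assume sub: "pretentious_class chi \<subseteq> pretentious_class (\<lambda>_. 1)"
  have k: "k > 0" using chi by (simp add: dirichlet_character_def)
  obtain g where g: "g \<in> pretentious_class chi" "\<And>p. prime p \<Longrightarrow> g p = (if coprime p k then chi p else 1)"
    using character_unimodular_modification[OF chi(1)] by blast
  have gc: "g \<in> completely_multiplicative_unimodular" "pretentious_dist (\<lambda>_. 1) g < \<infinity>"
    using g(1) sub by (auto simp: pretentious_class_def)
  have gn: "cmod (g p) = 1" if "prime p" for p by (rule unimodular_norm[OF gc(1) that])
  have bs: "bounded_sums (\<lambda>p. (1 - Re (1 * cnj (g p))) / real p) {p. prime p}"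
    using gc(2) gn by (subst (asm) pretentious_dist_finite_iff) auto
  have "finite (g ` {p. prime p})"
    by (rule finite_subset[of _ "insert 1 (range chi)"])
       (use g(2) finite_range_dirichlet_character[OF chi(1)] in auto)
  from finite_imageI[OF this, of "\<lambda>z. 1 - Re (1 * cnj z)"]
  have fin: "finite ((\<lambda>p. 1 - Re (1 * cnj (g p))) ` {p. prime p})" by (simp only: image_image)
  have "thin {p\<in>{p. prime p}. 1 - Re (1 * cnj (g p)) \<noteq> 0}"
  proof (rule bounded_sums_imp_thin[OF bs _ fin])
    fix p :: nat assume "p \<in> {p. prime p}"
    thus "1 - Re (1 * cnj (g p)) \<ge> 0" using complex_Re_le_cmod[of "g p"] gn[of p] by simp
  qed
  moreover have "thin {p. prime p \<and> \<not> coprime p k}" by (rule thin_finite[OF finite_primes_not_coprime[OF k]])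
  ultimately have th: "thin ({p\<in>{p. prime p}. 1 - Re (1 * cnj (g p)) \<noteq> 0} \<union> {p. prime p \<and> \<not> coprime p k})"
    by (rule thin_Un)
  have "{p. prime p \<and> chi p \<noteq> 1} \<subseteq> {p\<in>{p. prime p}. 1 - Re (1 * cnj (g p)) \<noteq> 0} \<union> {p. prime p \<and> \<not> coprime p k}"
  proof
    fix p assume p: "p \<in> {p. prime p \<and> chi p \<noteq> 1}"
    show "p \<in> {p\<in>{p. prime p}. 1 - Re (1 * cnj (g p)) \<noteq> 0} \<union> {p. prime p \<and> \<not> coprime p k}"
    proof (cases "coprime p k")
      case True
      hence "g p \<noteq> 1" using p g(2)[of p] by simp
      have "Re (g p) \<noteq> 1"
      proof
        assume 1: "Re (g p) = 1"
        have "(Re (g p))\<^sup>2 + (Im (g p))\<^sup>2 = 1" using gn[of p] p cmod_power2[of "g p"] by simp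
        hence "Im (g p) = 0" using 1 by simp
        with 1 \<open>g p \<noteq> 1\<close> show False by (simp add: complex_eq_iff)
      qed
      thus ?thesis using p by simp
    qed (use p in simp)
  qed
  from thin_subset[OF th this] nonprincipal_not_thin[OF chi] show False by contradiction
qed

section \<open>Pretentious ergodicity and the spectrum against the spectral condition\<close>

context multiplicative_system
begin

lemma one_in_pretentious_space: "(\<lambda>_. 1) \<in> pretentious_space M S (\<lambda>_. 1)"
proof -
  have "bounded_sums (\<lambda>p. (defect (\<lambda>_. 1) (\<lambda>_. 1) p)\<^sup>2 / real p) {p. prime p}"
    unfolding bounded_sums_def by (intro exI[of _ 0]) (simp add: defect_def)
  thus ?thesis by (simp add: pretentious_space_iff_bounded_sums L2_const)
qed

lemma spectrum_one_subset: "pretentious_class (\<lambda>_. 1) \<subseteq> pretentious_rational_spectrum M S"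
proof -
  have "dist_along M S (\<lambda>_. 1) (\<lambda>_. 1) < \<infinity>" using one_in_pretentious_space by (simp add: pretentious_space_def)
  moreover have "(\<lambda>_. 1) \<in> {F \<in> L2 M. L2_norm M F = 1}" by (simp add: L2_const L2_norm_const)
  ultimately have "system_dist M S (\<lambda>_. 1) < \<infinity>"
    unfolding system_dist_def INF_less_iff by blast
  thus ?thesis unfolding pretentious_rational_spectrum_def using dirichlet_character_one by blast
qed

lemma spectral_imp_ergodic:
  assumes sp: spectral_condition
  shows "pretentiously_ergodic M S \<and> pretentious_rational_spectrum M S = pretentious_class (\<lambda>_. 1)"
proof (intro conjI equalityI spectrum_one_subset)
  show "pretentiously_ergodic M S" unfolding pretentiously_ergodic_def
  proof (intro ballI impI)
    fix A assume A: "A \<in> sets M" "(indicator A :: 'a \<Rightarrow> complex) \<in> pretentious_space M S (\<lambda>_. 1)"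
    then obtain c where c: "AE x in M. (indicator A x :: complex) = c"
      using sp unfolding ae_constant_def by blast
    show "measure M A \<in> {0, 1}"
    proof (cases "c = 1")
      case True
      have "AE x in M. x \<in> A" using c by eventually_elim (simp add: True indicator_def split: if_splits)
      thus ?thesis using prob_eq_1[OF A(1)] by simp
    next
      case False
      have "AE x in M. x \<notin> A" using c by eventually_elim (use False in \<open>auto simp: indicator_def\<close>)
      thus ?thesis using prob_eq_0[OF A(1)] by simp
    qed
  qed
  show "pretentious_rational_spectrum M S \<subseteq> pretentious_class (\<lambda>_. 1)"
  proof
    fix g assume "g \<in> pretentious_rational_spectrum M S"
    then obtain k chi where chi: "dirichlet_character k chi" "system_dist M S chi < \<infinity>" "g \<in> pretentious_class chi"
      unfolding pretentious_rational_spectrum_def by blast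
    from chi(2) obtain F where F: "F \<in> L2 M" "L2_norm M F = 1" "dist_along M S F chi < \<infinity>"
      unfolding system_dist_def INF_less_iff by blast
    have "chi = principal_character k"
    proof (rule ccontr)
      assume "chi \<noteq> principal_character k"
      with sp chi(1) have "pretentious_space M S chi = {F \<in> L2 M. AE x in M. F x = 0}" by blast
      moreover have "F \<in> pretentious_space M S chi" using F by (simp add: pretentious_space_def)
      ultimately have "AE x in M. F x = 0" by simp
      hence "L2_norm M F = 0" using L2_norm_eq_0_iff[OF F(1)] by blast
      with F(2) show False by simp
    qed
    moreover have "k > 0" using chi(1) by (simp add: dirichlet_character_def)
    ultimately show "g \<in> pretentious_class (\<lambda>_. 1)" using pretentious_class_principal_subset chi(3) by blast
  qed
qed

text \<open>A level set inherits invariance: the indicator of a preimage under \<open>F\<close> has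
  zero defect wherever \<open>F\<close> does. Every level set thus has measure 0 or 1, and countably
  many rational half-planes determine the value of \<open>F\<close> almost everywhere.\<close>

lemma ergodic_imp_AE_const:
  assumes fg: "finitely_generated S" and erg: "pretentiously_ergodic M S"
    and FH: "F \<in> pretentious_space M S (\<lambda>_. 1)"
  shows "ae_constant M F"
proof -
  have F: "F \<in> L2 M" and th: "thin {p. prime p \<and> defect (\<lambda>_. 1) F p \<noteq> 0}"
    using FH pretentious_space_one_iff_thin[OF fg] by auto
  note [measurable] = L2_measurable[OF F]
  have dich: "\<exists>b. AE x in M. (F x \<in> B) = b" if [measurable]: "B \<in> sets borel" for B
  proof -
    define A where "A = F -` B \<inter> space M"
    have A: "A \<in> sets M" unfolding A_def by measurable
    have Amem: "x \<in> A \<longleftrightarrow> F x \<in> B" for x by (simp add: A_def)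
    define G :: "'a \<Rightarrow> complex" where "G = indicator A"
    have GL: "G \<in> L2 M"
      unfolding G_def by (rule L2_bounded[of _ 1]) (use A in \<open>auto simp: indicator_def\<close>)
    have "{p. prime p \<and> defect (\<lambda>_. 1) G p \<noteq> 0} \<subseteq> {p. prime p \<and> defect (\<lambda>_. 1) F p \<noteq> 0}"
    proof clarify
      fix p assume p: "prime p" and z: "defect (\<lambda>_. 1) F p = 0" and nz: "defect (\<lambda>_. 1) G p \<noteq> 0"
      have p0: "p > 0" using p by (rule prime_gt_0_nat)
      have "AE x in M. F (S p x) = 1 * F x" using z defect_eq_0_iff[OF p0 F, of "\<lambda>_. 1"] by blast
      hence "AE x in M. G (S p x) = 1 * G x" by eventually_elim (simp add: G_def indicator_def Amem)
      with nz show False using defect_eq_0_iff[OF p0 GL, of "\<lambda>_. 1"] by blast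
    qed
    from thin_subset[OF th this] have "G \<in> pretentious_space M S (\<lambda>_. 1)"
      using GL pretentious_space_one_iff_thin[OF fg] by blast
    hence "measure M A \<in> {0, 1}" using erg A unfolding pretentiously_ergodic_def G_def by blast
    hence "(AE x in M. x \<notin> A) \<or> (AE x in M. x \<in> A)" using prob_eq_0[OF A] prob_eq_1[OF A] by blast
    thus ?thesis
    proof
      assume "AE x in M. x \<notin> A"
      thus ?thesis by (intro exI[of _ False]) (simp add: Amem)
    next
      assume "AE x in M. x \<in> A"
      thus ?thesis by (intro exI[of _ True]) (simp add: Amem)
    qed
  qed
  have "\<exists>b. AE x in M. (Re (F x) < of_rat q) = b" for q
    using dich[of "{z. Re z < of_rat q}"] by simp
  then obtain b where b: "\<And>q. AE x in M. (Re (F x) < of_rat q) = b q" by metis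
  have "\<exists>b. AE x in M. (Im (F x) < of_rat q) = b" for q
    using dich[of "{z. Im z < of_rat q}"] by simp
  then obtain b' where b': "\<And>q. AE x in M. (Im (F x) < of_rat q) = b' q" by metis
  have ae: "AE x in M. \<forall>q. (Re (F x) < of_rat q) = b q \<and> (Im (F x) < of_rat q) = b' q"
    unfolding AE_all_countable using b b' by auto
  have "\<exists>x. \<forall>q. (Re (F x) < of_rat q) = b q \<and> (Im (F x) < of_rat q) = b' q"
  proof (rule ccontr)
    assume none: "\<nexists>x. \<forall>q. (Re (F x) < of_rat q) = b q \<and> (Im (F x) < of_rat q) = b' q"
    from ae have "AE x in M. False" by eventually_elim (use none in blast)
    thus False by simp
  qed
  then obtain x0 where x0: "\<And>q. (Re (F x0) < of_rat q) = b q" "\<And>q. (Im (F x0) < of_rat q) = b' q" by blast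
  have eq: "u = v" if "\<And>q. (u < of_rat q) = (v < of_rat q)" for u v :: real
  proof (rule ccontr)
    assume "u \<noteq> v"
    then consider "u < v" | "v < u" by linarith
    thus False
    proof cases
      case 1
      then obtain q where "u < of_rat q" "of_rat q < v" using of_rat_dense by blast
      with that[of q] show False by simp
    next
      case 2
      then obtain q where "v < of_rat q" "of_rat q < u" using of_rat_dense by blast
      with that[of q] show False by simp
    qed
  qed
  from ae have "AE x in M. F x = F x0"
  proof eventually_elim
    case (elim x)
    have "Re (F x) = Re (F x0)" using elim x0(1) by (intro eq) simp
    moreover have "Im (F x) = Im (F x0)" using elim x0(2) by (intro eq) simp
    ultimately show ?case by (rule complex_eqI)
  qed
  thus ?thesis unfolding ae_constant_def by blast
qed

text \<open>A nonzero \<open>F\<close> in the space of a non-principal \<open>chi\<close>,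
  normalised to norm 1, makes \<open>system_dist\<close> finite and places the whole class of
  \<open>chi\<close> in the spectrum, against \<open>nonprincipal_class_not_subset\<close>.\<close>

lemma ergodic_imp_spectral:
  assumes fg: "finitely_generated S" and erg: "pretentiously_ergodic M S"
    and spec: "pretentious_rational_spectrum M S = pretentious_class (\<lambda>_. 1)"
  shows spectral_condition
proof (intro conjI ballI allI impI)
  show "ae_constant M F" if "F \<in> pretentious_space M S (\<lambda>_. 1)" for F
    by (rule ergodic_imp_AE_const[OF fg erg that])
  fix k chi assume *: "dirichlet_character k chi \<and> chi \<noteq> principal_character k"
  hence chi: "dirichlet_character k chi" "chi \<noteq> principal_character k" by auto
  show "pretentious_space M S chi = {F \<in> L2 M. AE x in M. F x = 0}"
  proof (intro equalityI subsetI)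
    fix F assume FH: "F \<in> pretentious_space M S chi"
    hence F: "F \<in> L2 M" and th: "thin {p. prime p \<and> defect chi F p \<noteq> 0}"
      using pretentious_space_iff_thin[OF fg chi(1)] by auto
    have "L2_norm M F = 0"
    proof (rule ccontr)
      assume nz: "L2_norm M F \<noteq> 0"
      define c :: complex where "c = of_real (1 / L2_norm M F)"
      define G where "G = (\<lambda>x. c * F x)"
      have GL: "G \<in> L2 M" unfolding G_def by (rule L2_scale[OF F])
      have G1: "L2_norm M G = 1" unfolding G_def L2_norm_scale c_def norm_of_real using nz by simp
      have "defect chi G p = cmod c * defect chi F p" for p
      proof -
        have "(\<lambda>x. G (S p x) - chi p * G x) = (\<lambda>x. c * (F (S p x) - chi p * F x))"
          by (simp add: G_def algebra_simps)
        thus ?thesis unfolding defect_def by (simp only: L2_norm_scale)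
      qed
      hence "{p. prime p \<and> defect chi G p \<noteq> 0} \<subseteq> {p. prime p \<and> defect chi F p \<noteq> 0}" by auto
      from thin_subset[OF th this] have "G \<in> pretentious_space M S chi"
        using GL pretentious_space_iff_thin[OF fg chi(1)] by blast
      hence "dist_along M S G chi < \<infinity>" by (simp add: pretentious_space_def)
      moreover have "G \<in> {F \<in> L2 M. L2_norm M F = 1}" using GL G1 by simp
      ultimately have "system_dist M S chi < \<infinity>"
        unfolding system_dist_def INF_less_iff by blast
      hence "pretentious_class chi \<subseteq> pretentious_rational_spectrum M S"
        unfolding pretentious_rational_spectrum_def using chi(1) by blast
      with nonprincipal_class_not_subset[OF chi] show False unfolding spec by contradiction
    qed
    thus "F \<in> {F \<in> L2 M. AE x in M. F x = 0}" using F L2_norm_eq_0_iff[OF F] by simp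
  next
    fix F assume "F \<in> {F \<in> L2 M. AE x in M. F x = 0}"
    thus "F \<in> pretentious_space M S chi" using null_in_pretentious_space[OF fg chi(1)] by blast
  qed
qed

end

theorem corollary1p17:
  fixes M :: "'a::metric_space measure" and S :: "nat \<Rightarrow> 'a \<Rightarrow> 'a"
  assumes "multiplicative_system M S" and "finitely_generated S"
  shows "(aperiodic M S \<longleftrightarrow>
            (\<forall>F\<in>pretentious_space M S (\<lambda>_. 1). ae_constant M F) \<and>
            (\<forall>k chi. dirichlet_character k chi \<and> chi \<noteq> principal_character k \<longrightarrow>
               pretentious_space M S chi = {F \<in> L2 M. AE x in M. F x = 0}))
       \<and> ((\<forall>F\<in>pretentious_space M S (\<lambda>_. 1). ae_constant M F) \<and>
            (\<forall>k chi. dirichlet_character k chi \<and> chi \<noteq> principal_character k \<longrightarrow>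
               pretentious_space M S chi = {F \<in> L2 M. AE x in M. F x = 0})
          \<longleftrightarrow> pretentiously_ergodic M S \<and>
            pretentious_rational_spectrum M S = pretentious_class (\<lambda>_. 1))"
proof -
  interpret multiplicative_system M S by (rule assms(1))
  have "aperiodic M S \<longleftrightarrow> spectral_condition"
    using aperiodic_imp_spectral[OF assms(2)] spectral_imp_aperiodic[OF assms(2)] by blast
  moreover have "spectral_condition \<longleftrightarrow>
      pretentiously_ergodic M S \<and> pretentious_rational_spectrum M S = pretentious_class (\<lambda>_. 1)"
    using spectral_imp_ergodic ergodic_imp_spectral[OF assms(2)] by blast
  ultimately show ?thesis by blast
qed

end
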